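(* Suppose $p>2$. Given monic polynomials $P_1(u),\ldots,P_n(u)\in\mathbb K[u]$ with $P_1(u)=P_1(-u+1)$, there exists a tuple $\mu(u)=(\mu_1(u),\ldots,\mu_n(u))$ of series in $1+u^{-1}\mathbb K[[u^{-1}]]$ and a finite-dimensional (irreducible highest weight) representation $V(\mu(u),p)$ of $Y(\mathfrak{sp}_{2n})$ such that $$\frac{\mu_i(u)}{\mu_{i+1}(u)}=\frac{P_{i+1}(u+1)}{P_{i+1}(u)},\quad i=1,\ldots,n-1,\qquad\text{and}\qquad\frac{\mu_1(-u)}{\mu_1(u)}=\frac{P_1(u+1)}{P_1(u)}.$$
   Context: $\mathbb K$ is an algebraically closed field of characteristic $p$, $N=2n$; rows and columns of $N\times N$ matrices are indexed by $I_N=\{-n,\ldots,-1,1,\ldots,n\}$. $\theta_{ij}=\mathrm{sgn}(i)\,\mathrm{sgn}(j)$, and $A'$ is the matrix with $(A')_{ij}=\theta_{ij}a_{-j,-i}$. $P=\sum E_{ij}\otimes E_{ji}$, $R(u)=1-P/u$, $R'(u)=1-P'/u$ where $P'$ is $P$ with $A\mapsto A'$ applied in the first tensor factor. $Y(\mathfrak{sp}_{2n})$ is the unital associative $\mathbb K$-algebra generated by $s_{ij}^{(r)}$ ($r\ge1$, $i,j\in I_N$) with $\mathcal S(u)=[s_{ij}(u)]$, $s_{ij}(u)=\delta_{ij}+\sum_{r\ge1}s_{ij}^{(r)}u^{-r}$, and relations $R(u-v)\mathcal S_1(u)R'(-u-v)\mathcal S_2(v)=\mathcal S_2(v)R'(-u-v)\mathcal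 S_1(u)R(u-v)$ and $\mathcal S'(-u)=\mathcal S(u)-\frac{\mathcal S(u)-\mathcal S(-u)}{2u}$. A highest weight representation with highest weight $\mu(u)$ is one generated by a nonzero vector $\xi$ with $s_{ij}(u)\xi=0$ for $i<j$ and $s_{ii}(u)\xi=\mu_i(u)\xi$ for $1\le i\le n$. $V(\mu(u),p)$ denotes the irreducible highest weight representation with highest weight $\mu(u)$ (simple quotient of the Verma module, i.e. of the quotient of $Y(\mathfrak{sp}_{2n})$ by the left ideal generated by the coefficients of $s_{ij}(u)$, $i<j$, and $s_{ii}(u)-\mu_i(u)$, $1\le i\le n$). *)

theory Defs
  imports
    "HOL-Computational_Algebra.Computational_Algebra"
    "HOL-Library.Poly_Mapping"
    "HOL-Algebra.QuotRing"
    "HOL-Algebra.Module"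
begin

section \<open>Left modules over a not necessarily commutative ring\<close>

text \<open>The locale \<open>module\<close> of \<open>HOL-Algebra\<close> insists on a commutative ring of scalars; its record
  type and the locale \<^locale>\<open>submodule\<close> do not, and are reused here.\<close>

locale left_module = R?: ring R + M?: abelian_group M for R (structure) and M (structure) +
  assumes smult_closed:
      "\<lbrakk>a \<in> carrier R; x \<in> carrier M\<rbrakk> \<Longrightarrow> a \<odot>\<^bsub>M\<^esub> x \<in> carrier M"
    and smult_l_distr:
      "\<lbrakk>a \<in> carrier R; b \<in> carrier R; x \<in> carrier M\<rbrakk> \<Longrightarrow>
        (a \<oplus>\<^bsub>R\<^esub> b) \<odot>\<^bsub>M\<^esub> x = a \<odot>\<^bsub>M\<^esub> x \<oplus>\<^bsub>M\<^esub> b \<odot>\<^bsub>M\<^esub> x"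
    and smult_r_distr:
      "\<lbrakk>a \<in> carrier R; x \<in> carrier M; y \<in> carrier M\<rbrakk> \<Longrightarrow>
        a \<odot>\<^bsub>M\<^esub> (x \<oplus>\<^bsub>M\<^esub> y) = a \<odot>\<^bsub>M\<^esub> x \<oplus>\<^bsub>M\<^esub> a \<odot>\<^bsub>M\<^esub> y"
    and smult_assoc1:
      "\<lbrakk>a \<in> carrier R; b \<in> carrier R; x \<in> carrier M\<rbrakk> \<Longrightarrow>
        (a \<otimes>\<^bsub>R\<^esub> b) \<odot>\<^bsub>M\<^esub> x = a \<odot>\<^bsub>M\<^esub> (b \<odot>\<^bsub>M\<^esub> x)"
    and smult_one:
      "x \<in> carrier M \<Longrightarrow> \<one>\<^bsub>R\<^esub> \<odot>\<^bsub>M\<^esub> x = x"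

definition regular_module :: "('a, 'm) ring_scheme \<Rightarrow> ('a, 'a) module" where
  "regular_module R = \<lparr>carrier = carrier R, mult = mult R, one = one R, zero = zero R,
     add = add R, smult = mult R\<rparr>"

definition generated_submodule ::
    "('a, 'm) ring_scheme \<Rightarrow> ('a, 'b, 'c) module_scheme \<Rightarrow> 'b set \<Rightarrow> 'b set" where
  "generated_submodule R M S = \<Inter>{N. submodule N R M \<and> S \<subseteq> N}"

text \<open>The multiplicative fields of the record are irrelevant for a module and left unspecified.\<close>

definition quotient_module :: "('a, 'b, 'c) module_scheme \<Rightarrow> 'b set \<Rightarrow> ('a, 'b set) module" where
  "quotient_module M N = \<lparr>carrier = a_rcosets\<^bsub>M\<^esub> N, mult = undefined, one = undefined,
     zero = N, add = set_add M, smult = (\<lambda>a X. \<Union>x\<in>X. N +>\<^bsub>M\<^esub> (a \<odot>\<^bsub>M\<^esub> x))\<rparr>"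

definition irreducible_module ::
    "('a, 'm) ring_scheme \<Rightarrow> ('a, 'b, 'c) module_scheme \<Rightarrow> bool" where
  "irreducible_module R M \<longleftrightarrow> left_module R M \<and> carrier M \<noteq> {\<zero>\<^bsub>M\<^esub>} \<and>
     (\<forall>N. submodule N R M \<longrightarrow> N = {\<zero>\<^bsub>M\<^esub>} \<or> N = carrier M)"


section \<open>The free algebra\<close>

text \<open>Words under concatenation, written additively, so that the convolution product of
  \<^type>\<open>poly_mapping\<close> is the product of the free associative algebra.\<close>

datatype 'g fword = FWord (letters: "'g list")

instantiation fword :: (type) monoid_add
begin

definition zero_fword :: "'a fword" where "0 = FWord []"

definition plus_fword :: "'a fword \<Rightarrow> 'a fword \<Rightarrow> 'a fword" where
  "x + y = FWord (letters x @ letters y)"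

instance
  by standard (auto simp: zero_fword_def plus_fword_def)

end

text \<open>The triple \<open>(i, j, r)\<close> stands for the generator $s_{ij}^{(r)}$.\<close>

type_synonym 'k falg = "(int \<times> int \<times> nat) fword \<Rightarrow>\<^sub>0 'k"

definition index_set :: "nat \<Rightarrow> int set" where
  "index_set n = {- int n..int n} - {0}"

definition free_alg :: "nat \<Rightarrow> ('k::field) falg ring" where
  "free_alg n = \<lparr>
     carrier = {f. \<forall>w\<in>Poly_Mapping.keys f. set (letters w) \<subseteq> index_set n \<times> index_set n \<times> {1..}},
     mult = (*), one = 1, zero = 0, add = (+)\<rparr>"

definition scal :: "'k::field \<Rightarrow> 'k falg" where
  "scal c = Poly_Mapping.single 0 c"

definition gen_s :: "int \<Rightarrow> int \<Rightarrow> nat \<Rightarrow> ('k::field) falg" where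
  "gen_s i j r =
     (if r = 0 then of_bool (i = j) else Poly_Mapping.single (FWord [(i, j, r)]) 1)"


section \<open>The defining relations\<close>

text \<open>A power series in $u^{-1}$ is an \<^typ>\<open>'a fps\<close> whose variable is read as $u^{-1}$; likewise
  for \<^typ>\<open>'a fls\<close>, where therefore $u$ is \<^const>\<open>fls_X_inv\<close>. Two variables are
  handled in $A((v^{-1}))((u^{-1}))$, the outer variable being $u^{-1}$; thus $1/(u \pm v)$ is
  expanded in nonnegative powers of $v$. Since $u^2 - v^2$ is central and invertible in this ring,
  the choice of the expansion does not affect the ideal generated by the relations.\<close>

definition map_fls :: "('a::zero \<Rightarrow> 'b::zero) \<Rightarrow> 'a fls \<Rightarrow> 'b fls" where
  "map_fls g f = Abs_fls (\<lambda>k. g (fls_nth f k))"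

definition theta :: "int \<Rightarrow> int \<Rightarrow> int" where
  "theta i j = sgn i * sgn j"

text \<open>The entry \<open>X (i, k) (j, l)\<close> is the coefficient of $E_{ij} \otimes E_{kl}$ in \<open>X\<close>.\<close>

type_synonym 'a tensor_mat = "int \<times> int \<Rightarrow> int \<times> int \<Rightarrow> 'a"

definition tensor_mult ::
    "nat \<Rightarrow> ('a::ring_1) tensor_mat \<Rightarrow> 'a tensor_mat \<Rightarrow> 'a tensor_mat" where
  "tensor_mult n X Y I J = (\<Sum>L\<in>index_set n \<times> index_set n. X I L * Y L J)"

definition id_mat :: "('a::ring_1) tensor_mat" where
  "id_mat I J = of_bool (I = J)"

definition perm_mat :: "('a::ring_1) tensor_mat" where
  "perm_mat = (\<lambda>(i, k) (j, l). of_bool (k = j \<and> l = i))"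

definition prime1 :: "('a::ring_1) tensor_mat \<Rightarrow> 'a tensor_mat" where
  "prime1 X = (\<lambda>(i, k) (j, l). of_int (theta i j) * X (- j, k) (- i, l))"

definition R_mat :: "('a::field) \<Rightarrow> 'a tensor_mat" where
  "R_mat w I J = id_mat I J - perm_mat I J / w"

definition R'_mat :: "('a::field) \<Rightarrow> 'a tensor_mat" where
  "R'_mat w I J = id_mat I J - prime1 perm_mat I J / w"

definition u_var :: "('k::field) fls fls" where
  "u_var = fls_X_inv"

definition v_var :: "('k::field) fls fls" where
  "v_var = fls_const fls_X_inv"

definition scal_mat :: "('k::field) fls fls tensor_mat \<Rightarrow> 'k falg fls fls tensor_mat" where
  "scal_mat X I J = map_fls (map_fls scal) (X I J)"

definition S1_u :: "('k::field) falg fls fls tensor_mat" where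
  "S1_u = (\<lambda>(i, k) (j, l).
     of_bool (k = l) * fps_to_fls (Abs_fps (\<lambda>r. fls_const (gen_s i j r))))"

definition S2_v :: "('k::field) falg fls fls tensor_mat" where
  "S2_v = (\<lambda>(i, k) (j, l).
     of_bool (i = j) * fls_const (fps_to_fls (Abs_fps (gen_s k l))))"

definition reflection_lhs :: "nat \<Rightarrow> ('k::field) falg fls fls tensor_mat" where
  "reflection_lhs n =
     tensor_mult n (tensor_mult n (tensor_mult n
       (scal_mat (R_mat (u_var - v_var))) S1_u) (scal_mat (R'_mat (- u_var - v_var)))) S2_v"

definition reflection_rhs :: "nat \<Rightarrow> ('k::field) falg fls fls tensor_mat" where
  "reflection_rhs n =
     tensor_mult n (tensor_mult n (tensor_mult n
       S2_v (scal_mat (R'_mat (- u_var - v_var)))) S1_u) (scal_mat (R_mat (u_var - v_var)))"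

definition reflection_relations :: "nat \<Rightarrow> ('k::field) falg set" where
  "reflection_relations n =
     {fls_nth (fls_nth (reflection_lhs n I J - reflection_rhs n I J) a) b | I J a b.
        I \<in> index_set n \<times> index_set n \<and> J \<in> index_set n \<times> index_set n}"

definition s_pos :: "int \<Rightarrow> int \<Rightarrow> ('k::field) falg fls" where
  "s_pos i j = fps_to_fls (Abs_fps (gen_s i j))"

definition s_neg :: "int \<Rightarrow> int \<Rightarrow> ('k::field) falg fls" where
  "s_neg i j = fps_to_fls (fps_compose (Abs_fps (gen_s i j)) (- fps_X))"

definition symmetry_relations :: "nat \<Rightarrow> ('k::field) falg set" where
  "symmetry_relations n =
     {fls_nth (of_int (theta i j) * s_neg (- j) (- i)
        - (s_pos i j - map_fls scal (1 / (2 * fls_X_inv)) * (s_pos i j - s_neg i j))) a | i j a.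
        i \<in> index_set n \<and> j \<in> index_set n}"


section \<open>The twisted Yangian and its highest weight modules\<close>

definition yangian_ideal :: "nat \<Rightarrow> ('k::field) falg set" where
  "yangian_ideal n = Idl\<^bsub>free_alg n\<^esub> (reflection_relations n \<union> symmetry_relations n)"

definition yangian_sp :: "nat \<Rightarrow> ('k::field) falg set ring" where
  "yangian_sp n = free_alg n Quot yangian_ideal n"

definition Y_s :: "nat \<Rightarrow> int \<Rightarrow> int \<Rightarrow> nat \<Rightarrow> ('k::field) falg set" where
  "Y_s n i j r = yangian_ideal n +>\<^bsub>free_alg n\<^esub> gen_s i j r"

definition Y_scal :: "nat \<Rightarrow> 'k::field \<Rightarrow> 'k falg set" where
  "Y_scal n c = yangian_ideal n +>\<^bsub>free_alg n\<^esub> scal c"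

text \<open>\<open>Y_scal n\<close> embeds the ground field; through it every module over the algebra is a vector
  space, and finite-dimensionality means the existence of a finite spanning set.\<close>

definition finite_dimensional_rep ::
    "nat \<Rightarrow> (('k::field) falg set, 'b, 'c) module_scheme \<Rightarrow> bool" where
  "finite_dimensional_rep n V \<longleftrightarrow>
     (\<exists>B. finite B \<and> B \<subseteq> carrier V \<and>
       (\<forall>x\<in>carrier V. \<exists>c. x = (\<Oplus>\<^bsub>V\<^esub>b\<in>B. Y_scal n (c b) \<odot>\<^bsub>V\<^esub> b)))"

definition highest_weight_rep ::
    "nat \<Rightarrow> (nat \<Rightarrow> ('k::field) fps) \<Rightarrow> ('k falg set, 'b, 'c) module_scheme \<Rightarrow> bool" where
  "highest_weight_rep n \<mu> V \<longleftrightarrow> left_module (yangian_sp n) V \<and>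
     (\<exists>\<xi>\<in>carrier V. \<xi> \<noteq> \<zero>\<^bsub>V\<^esub> \<and>
       generated_submodule (yangian_sp n) V {\<xi>} = carrier V \<and>
       (\<forall>i\<in>index_set n. \<forall>j\<in>index_set n. i < j \<longrightarrow> (\<forall>r. Y_s n i j r \<odot>\<^bsub>V\<^esub> \<xi> = \<zero>\<^bsub>V\<^esub>)) \<and>
       (\<forall>i\<in>{1..n}. \<forall>r. Y_s n (int i) (int i) r \<odot>\<^bsub>V\<^esub> \<xi>
          = Y_scal n (fps_nth (\<mu> i) r) \<odot>\<^bsub>V\<^esub> \<xi>))"

definition verma_left_ideal :: "nat \<Rightarrow> (nat \<Rightarrow> ('k::field) fps) \<Rightarrow> 'k falg set set" where
  "verma_left_ideal n \<mu> = generated_submodule (yangian_sp n) (regular_module (yangian_sp n))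
     ({Y_s n i j r | i j r. i \<in> index_set n \<and> j \<in> index_set n \<and> i < j} \<union>
      {Y_s n (int i) (int i) r \<ominus>\<^bsub>yangian_sp n\<^esub> Y_scal n (fps_nth (\<mu> i) r) | i r. i \<in> {1..n}})"

definition verma_module ::
    "nat \<Rightarrow> (nat \<Rightarrow> ('k::field) fps) \<Rightarrow> ('k falg set, 'k falg set set) module" where
  "verma_module n \<mu> = quotient_module (regular_module (yangian_sp n)) (verma_left_ideal n \<mu>)"

text \<open>In positive characteristic a Verma module need not have a unique maximal submodule, so
  being an irreducible highest weight representation $V(\mu(u),p)$ is a property of \<open>V\<close>.\<close>

definition irreducible_highest_weight_rep ::
    "nat \<Rightarrow> (nat \<Rightarrow> ('k::field) fps) \<Rightarrow> ('k falg set, 'k falg set set set) module \<Rightarrow> bool" where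
  "irreducible_highest_weight_rep n \<mu> V \<longleftrightarrow>
     highest_weight_rep n \<mu> V \<and> irreducible_module (yangian_sp n) V \<and>
     (\<exists>N. submodule N (yangian_sp n) (verma_module n \<mu>) \<and>
          V = quotient_module (verma_module n \<mu>) N)"

definition poly_at :: "('k::field) poly \<Rightarrow> 'k fls \<Rightarrow> 'k fls" where
  "poly_at p w = poly (map_poly fls_const p) w"

end

theory Submission
  imports Defs "HOL-Library.Function_Algebras" "HOL-Library.Countable"
begin

text \<open>A solution $S(u)$ of the reflection equation and of the symmetry relation can be dressed: if
  $T(u)$ satisfies the RTT relation and its entries commute with those of $S$, then $T(u) S(u) T'(-u)$
  is again a solution. Starting from $S = 1$ and dressing with the matrices
  $1 + E^{(m)} / (u - \beta_m)$ of commuting copies $E^{(m)}$ of $\mathfrak{gl}_{2n}$, one obtains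
  an action of the twisted Yangian on every module over the copies. On the fermionic Fock space, with
  $E^{(m)}_{ij} = a^\dagger_{m,i} a_{m,j}$, the vector in which the modes $(m, i)$ with
  $i \le d_m$ are occupied is annihilated by $s_{ij}(u)$ for $i < j$ and is an eigenvector of
  $s_{ii}(u)$, $i > 0$, with eigenvalue
  $\prod_m (1 + [i \le d_m] / (u - \beta_m)) (1 - [-i \le d_m] / (u + \beta_m))$. A root $a$
  of $P_{i+1}$ is realised by a copy with $\beta = a$, $d = i$. The roots of $P_1$ come in pairs
  $b, 1 - b$ (here $p \neq 2$ enters), and each pair is realised by one copy with $\beta = b$,
  $d = -1$. The annihilator of the vector is a left ideal of finite codimension, and the quotient by a
  maximal left ideal above it is the required representation.\<close>

section \<open>Homomorphisms and Laurent series\<close>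

text \<open>The two kinds of copies decouple. For d = i >= 1 the factor of mu_1 is (1 + 1/(u-a)) (1
  + 1/(-u-a)), which is even in u and leaves mu_1(-u)/mu_1(u) alone, while passing from mu_i to
  mu_{i+1} removes exactly 1 + 1/(u-a) = (u+1-a)/(u-a). For d = -1 the factor is 1 + 1/(-u-b) in
  every mu_i, so mu_i/mu_{i+1} does not see it; to mu_1(-u)/mu_1(u) it contributes (u+1-b)(u+b) /
  ((u-b)(u+b-1)), which is F(u+1)/F(u) for F = (u-b)(u-(1-b)). Fock space is insensitive to the
  characteristic: bilinears in fermions satisfy the gl relations over any field, and filling the
  modes up to d gives a highest weight vector by exclusion. A left ideal is carried along instead of
  a subspace of Fock space because the representation has to be literally a quotient of the Verma
  module. A maximal left ideal above the annihilator contains the Verma relations, and taking it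
  from Zorn's lemma avoids any appeal to a unique maximal submodule, which may fail to exist in
  characteristic p.\<close>

locale ring_map =
  fixes f :: "'a::ring_1 \<Rightarrow> 'b::ring_1"
  assumes add: "f (x + y) = f x + f y"
    and mult: "f (x * y) = f x * f y"
    and one: "f 1 = 1"
begin

lemma zero: "f 0 = 0"
  using add[of 0 0] by simp

lemma uminus: "f (- x) = - f x"
  using add[of x "- x"] zero by (simp add: eq_neg_iff_add_eq_0 add.commute)

lemma diff: "f (x - y) = f x - f y"
  using add[of x "- y"] by (simp add: uminus)

lemma sum: "f (sum g A) = (\<Sum>x\<in>A. f (g x))"
  by (induction A rule: infinite_finite_induct) (simp_all add: zero add)

lemma of_bool: "f (of_bool b) = of_bool b"
  by (simp add: zero one)

lemma of_nat: "f (of_nat m) = of_nat m"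
  by (induction m) (simp_all add: zero one add)

lemma of_int: "f (of_int m) = of_int m"
  by (cases m rule: int_cases) (simp_all add: of_nat uminus diff one)

lemmas hom_simps = add mult one zero uminus diff sum of_bool of_int

end

lemma ring_map_inverse:
  fixes f :: "'a::field \<Rightarrow> 'b::field"
  assumes "ring_map f"
  shows "f (inverse x) = inverse (f x)"
proof (cases "x = 0")
  case True
  then show ?thesis using ring_map.zero[OF assms] by simp
next
  case False
  then have "f x * f (inverse x) = 1"
    using ring_map.mult[OF assms, of x "inverse x"] ring_map.one[OF assms] by simp
  then show ?thesis using inverse_unique by metis
qed

lemma ring_map_divide:
  fixes f :: "'a::field \<Rightarrow> 'b::field"
  assumes "ring_map f"
  shows "f (x / y) = f x / f y"
  by (simp add: divide_inverse ring_map.mult[OF assms] ring_map_inverse[OF assms])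

lemma ring_map_comp:
  "ring_map g \<Longrightarrow> ring_map f \<Longrightarrow> ring_map (\<lambda>x. g (f x))"
  by (simp add: ring_map_def)

section \<open>Laurent series: maps that act on coefficients\<close>

lemma fls_nth_Abs_dominated:
  assumes "\<And>k. fls_nth f k = 0 \<Longrightarrow> g k = 0"
  shows "fls_nth (Abs_fls g) k = g k"
proof -
  have "\<forall>\<^sub>\<infinity>n::nat. g (- int n) = 0"
    using MOST_fls_neg_nth_eq_0[of f] by (rule MOST_mono) (use assms in auto)
  then show ?thesis by (simp add: Abs_fls_inverse)
qed

lemma fls_nth_map_fls:
  assumes "g 0 = 0"
  shows "fls_nth (map_fls g f) k = g (fls_nth f k)"
  unfolding map_fls_def by (rule fls_nth_Abs_dominated[of f]) (use assms in auto)

text \<open>A homomorphism can kill leading coefficients and so raise the subdegree. With arbitrary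
  lower bounds allowed, one summation window serves both a product and its image.\<close>

lemma fls_times_nth_between:
  fixes f g :: "'a::ring_1 fls"
  assumes "\<And>i. i < a \<Longrightarrow> fls_nth f i = 0" "\<And>i. i < b \<Longrightarrow> fls_nth g i = 0"
  shows "fls_nth (f * g) k = (\<Sum>i\<in>{a..k - b}. fls_nth f i * fls_nth g (k - i))"
proof (cases "f = 0 \<or> g = 0")
  case True
  then show ?thesis by auto
next
  case False
  have 1: "a \<le> fls_subdegree f" "b \<le> fls_subdegree g"
    using False assms by (auto intro!: fls_subdegree_geI)
  have "fls_nth (f * g) k =
      (\<Sum>i=fls_subdegree f..k - fls_subdegree g. fls_nth f i * fls_nth g (k - i))"
    by (rule fls_times_nth(2))
  also have "\<dots> = (\<Sum>i\<in>{a..k - b}. fls_nth f i * fls_nth g (k - i))"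
  proof (rule sum.mono_neutral_left)
    show "\<forall>i\<in>{a..k - b} - {fls_subdegree f..k - fls_subdegree g}. fls_nth f i * fls_nth g (k - i) = 0"
    proof
      fix i assume "i \<in> {a..k - b} - {fls_subdegree f..k - fls_subdegree g}"
      then have "i < fls_subdegree f \<or> k - i < fls_subdegree g" by auto
      then show "fls_nth f i * fls_nth g (k - i) = 0" by auto
    qed
  qed (use 1 in auto)
  finally show ?thesis .
qed

lemma fls_nth_below_subdegree: "i < fls_subdegree f \<Longrightarrow> fls_nth f i = 0"
  by simp

lemma ring_map_map_fls:
  assumes "ring_map g"
  shows "ring_map (map_fls g)"
proof -
  interpret ring_map g by fact
  note nth = fls_nth_map_fls[of g, OF zero]
  show ?thesis
  proof
    fix x y :: "'a fls"
    show "map_fls g (x + y) = map_fls g x + map_fls g y"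
      by (rule fls_eqI) (simp add: nth add)
    show "map_fls g 1 = 1"
      by (rule fls_eqI) (simp add: nth one zero)
    show "map_fls g (x * y) = map_fls g x * map_fls g y"
    proof (rule fls_eqI)
      fix k
      let ?a = "fls_subdegree x" and ?b = "fls_subdegree y"
      have "fls_nth (map_fls g (x * y)) k =
          (\<Sum>i\<in>{?a..k - ?b}. g (fls_nth x i) * g (fls_nth y (k - i)))"
        by (simp add: nth fls_times_nth_between[of ?a x ?b y] sum mult)
      also have "\<dots> = fls_nth (map_fls g x * map_fls g y) k"
        by (subst fls_times_nth_between[of ?a _ ?b]) (simp_all add: nth zero)
      finally show "fls_nth (map_fls g (x * y)) k = fls_nth (map_fls g x * map_fls g y) k" .
    qed
  qed
qed

lemma map_fls_map_fls:
  "g 0 = 0 \<Longrightarrow> h 0 = 0 \<Longrightarrow> map_fls g (map_fls h f) = map_fls (\<lambda>x. g (h x)) f"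
  by (rule fls_eqI) (simp add: fls_nth_map_fls)

lemma map_fls_const: "g 0 = 0 \<Longrightarrow> map_fls g (fls_const c) = fls_const (g c)"
  by (rule fls_eqI) (simp add: fls_nth_map_fls)

lemma map_fls_X_inv: "g 0 = 0 \<Longrightarrow> g 1 = 1 \<Longrightarrow> map_fls g fls_X_inv = fls_X_inv"
  by (rule fls_eqI) (simp add: fls_nth_map_fls)

lemma ring_map_fls_const: "ring_map (fls_const :: 'a::ring_1 \<Rightarrow> 'a fls)"
  by standard (simp_all add: fls_plus_const)

section \<open>The substitution of -u for u\<close>

definition fls_flip :: "'a::ring_1 fls \<Rightarrow> 'a fls" where
  "fls_flip f = Abs_fls (\<lambda>k. if even k then fls_nth f k else - fls_nth f k)"

lemma fls_nth_flip: "fls_nth (fls_flip f) k = (if even k then fls_nth f k else - fls_nth f k)"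
  unfolding fls_flip_def by (rule fls_nth_Abs_dominated[of f]) auto

lemma ring_map_fls_flip: "ring_map (fls_flip :: 'a::ring_1 fls \<Rightarrow> 'a fls)"
proof
  fix x y :: "'a fls"
  show "fls_flip (x + y) = fls_flip x + fls_flip y"
    by (rule fls_eqI) (simp add: fls_nth_flip)
  show "fls_flip 1 = (1 :: 'a fls)"
    by (rule fls_eqI) (simp add: fls_nth_flip)
  show "fls_flip (x * y) = fls_flip x * fls_flip y"
  proof (rule fls_eqI)
    fix k
    let ?a = "fls_subdegree x" and ?b = "fls_subdegree y"
    let ?s = "\<lambda>k::int. if even k then 1 else - 1 :: 'a"
    have s: "fls_nth (fls_flip f) k = ?s k * fls_nth f k" for f :: "'a fls" and k
      by (simp add: fls_nth_flip)
    have "fls_nth (fls_flip (x * y)) k = (\<Sum>i\<in>{?a..k - ?b}. ?s k * (fls_nth x i * fls_nth y (k - i)))"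
      by (simp only: s fls_times_nth_between[of ?a x ?b y] fls_nth_below_subdegree sum_distrib_left)
    also have "\<dots> = (\<Sum>i\<in>{?a..k - ?b}. fls_nth (fls_flip x) i * fls_nth (fls_flip y) (k - i))"
      by (intro sum.cong refl) (auto simp: s)
    also have "\<dots> = fls_nth (fls_flip x * fls_flip y) k"
      by (subst fls_times_nth_between[of ?a _ ?b]) (simp_all add: fls_nth_flip)
    finally show "fls_nth (fls_flip (x * y)) k = fls_nth (fls_flip x * fls_flip y) k" .
  qed
qed

lemma fls_flip_flip: "fls_flip (fls_flip f) = f"
  by (rule fls_eqI) (simp add: fls_nth_flip)

lemma fls_flip_const: "fls_flip (fls_const c) = fls_const c"
  by (rule fls_eqI) (simp add: fls_nth_flip)

lemma fls_flip_X_inv: "fls_flip fls_X_inv = - fls_X_inv"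
  by (rule fls_eqI) (simp add: fls_nth_flip)

lemma map_fls_flip: "ring_map g \<Longrightarrow> map_fls g (fls_flip f) = fls_flip (map_fls g f)"
  by (rule fls_eqI) (simp add: fls_nth_map_fls fls_nth_flip ring_map.zero ring_map.uminus)

lemma fps_compose_uminus_X_nth:
  fixes F :: "'a::ring_1 fps"
  shows "fps_nth (fps_compose F (- fps_X)) k = (- 1) ^ k * fps_nth F k"
proof -
  have "fps_nth ((- fps_X) ^ i) k = ((- 1) ^ k * of_bool (i = k) :: 'a)" for i
    by (subst power_minus) (auto simp: fps_X_power_iff minus_one_power_iff)
  then show ?thesis
    by (simp add: fps_compose_nth minus_one_power_iff sum_negf)
qed

text \<open>The relations write S(-u) as a composition of power series, whereas
  \<open>fls_flip\<close> also acts on Laurent series such as u itself; this identifies the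
  two.\<close>

lemma fps_to_fls_compose_uminus_X:
  fixes F :: "'a::ring_1 fps"
  shows "fps_to_fls (fps_compose F (- fps_X)) = fls_flip (fps_to_fls F)"
  by (rule fls_eqI) (auto simp: fls_nth_flip fps_compose_uminus_X_nth minus_one_power_iff even_nat_iff)

lemma fls_const_commutes:
  fixes f :: "'a::ring_1 fls"
  shows "(\<And>k. c * fls_nth f k = fls_nth f k * c) \<Longrightarrow> fls_const c * f = f * fls_const c"
  by (rule fls_eqI) simp

text \<open>The variable is central, so a commutator of series is built from commutators of
  coefficients.\<close>

lemma fls_commute:
  fixes f g :: "'a::ring_1 fls"
  assumes "\<And>i j. fls_nth f i * fls_nth g j = fls_nth g j * fls_nth f i"
  shows "f * g = g * f"
proof (rule fls_eqI)
  fix k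
  let ?a = "fls_subdegree f" and ?b = "fls_subdegree g"
  have "fls_nth (f * g) k = (\<Sum>i\<in>{?a..k - ?b}. fls_nth f i * fls_nth g (k - i))"
    by (rule fls_times_nth_between) auto
  also have "\<dots> = (\<Sum>i\<in>{?b..k - ?a}. fls_nth g i * fls_nth f (k - i))"
    by (rule sum.reindex_bij_witness[of _ "\<lambda>i. k - i" "\<lambda>i. k - i"]) (auto simp: assms)
  also have "\<dots> = fls_nth (g * f) k"
    by (rule fls_times_nth_between[symmetric]) auto
  finally show "fls_nth (f * g) k = fls_nth (g * f) k" .
qed

section \<open>Subrings as sets, and series with coefficients in them\<close>

definition unital_subring :: "'a::ring_1 set \<Rightarrow> bool" where
  "unital_subring Q \<longleftrightarrow> 1 \<in> Q \<and> (\<forall>x\<in>Q. \<forall>y\<in>Q. x - y \<in> Q \<and> x * y \<in> Q)"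

lemma unital_subringD:
  assumes "unital_subring Q"
  shows "1 \<in> Q" and "0 \<in> Q"
    and "x \<in> Q \<Longrightarrow> y \<in> Q \<Longrightarrow> x - y \<in> Q" and "x \<in> Q \<Longrightarrow> y \<in> Q \<Longrightarrow> x * y \<in> Q"
    and "x \<in> Q \<Longrightarrow> - x \<in> Q" and "x \<in> Q \<Longrightarrow> y \<in> Q \<Longrightarrow> x + y \<in> Q"
proof -
  have d: "x - y \<in> Q" if "x \<in> Q" "y \<in> Q" for x y
    using that assms by (auto simp: unital_subring_def)
  show 1: "1 \<in> Q" and "x \<in> Q \<Longrightarrow> y \<in> Q \<Longrightarrow> x * y \<in> Q"
    using assms by (auto simp: unital_subring_def)
  show "x \<in> Q \<Longrightarrow> y \<in> Q \<Longrightarrow> x - y \<in> Q" by (rule d)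
  show 0: "0 \<in> Q" using d[OF 1 1] by simp
  show n: "x \<in> Q \<Longrightarrow> - x \<in> Q" for x using d[OF 0, of x] by simp
  show "x \<in> Q \<Longrightarrow> y \<in> Q \<Longrightarrow> x + y \<in> Q" using d[of x "- y"] n by simp
qed

lemma unital_subring_sum:
  assumes "unital_subring Q" "\<And>x. x \<in> A \<Longrightarrow> g x \<in> Q"
  shows "sum g A \<in> Q"
  using assms(2)
  by (induction A rule: infinite_finite_induct) (auto simp: unital_subringD[OF assms(1)])

definition fls_over :: "'a::zero set \<Rightarrow> 'a fls set" where
  "fls_over Q = {f. \<forall>k. fls_nth f k \<in> Q}"

lemma unital_subring_fls_over:
  assumes "unital_subring Q"
  shows "unital_subring (fls_over Q)"
  unfolding unital_subring_def
proof (intro conjI ballI)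
  note Q = unital_subringD[OF assms]
  show "1 \<in> fls_over Q" using Q by (simp add: fls_over_def)
  fix x y assume xy: "x \<in> fls_over Q" "y \<in> fls_over Q"
  then show "x - y \<in> fls_over Q" using Q by (simp add: fls_over_def)
  show "x * y \<in> fls_over Q"
    using xy by (auto simp: fls_over_def fls_times_nth(2) intro!: unital_subring_sum[OF assms] Q(4))
qed

section \<open>Evaluation of the free algebra\<close>

lemma update_eq_add_single:
  "v \<notin> Poly_Mapping.keys f \<Longrightarrow> Poly_Mapping.update v d f = f + Poly_Mapping.single v d"
  by (intro poly_mapping_eqI)
    (auto simp: lookup_update lookup_add lookup_single in_keys_iff when_def)

text \<open>The homomorphism provided by the universal property of the free algebra, for scalars
  acting through \<open>\<kappa>\<close>.\<close>

definition falg_eval ::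
    "('k::field \<Rightarrow> 'a::ring_1) \<Rightarrow> (int \<times> int \<times> nat \<Rightarrow> 'a) \<Rightarrow> 'k falg \<Rightarrow> 'a" where
  "falg_eval \<kappa> h f =
     (\<Sum>w\<in>Poly_Mapping.keys f. \<kappa> (Poly_Mapping.lookup f w) * prod_list (map h (letters w)))"

text \<open>A unital associative algebra over the field, given by its structure map into the
  centre.\<close>

locale scalar_map = ring_map \<kappa> for \<kappa> :: "'k::field \<Rightarrow> 'a::ring_1" +
  assumes central: "\<kappa> c * x = x * \<kappa> c"
begin

text \<open>Keys may cancel in a sum, so sums are compared over a common finite set of words, on
  which the additional terms vanish.\<close>

lemma falg_eval_superset:
  assumes "finite W" "Poly_Mapping.keys f \<subseteq> W"
  shows "falg_eval \<kappa> h f =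
    (\<Sum>w\<in>W. \<kappa> (Poly_Mapping.lookup f w) * prod_list (map h (letters w)))"
  unfolding falg_eval_def
  by (rule sum.mono_neutral_left) (use assms in \<open>auto simp: in_keys_iff zero\<close>)

lemma falg_eval_add: "falg_eval \<kappa> h (f + g) = falg_eval \<kappa> h f + falg_eval \<kappa> h g"
proof -
  let ?W = "Poly_Mapping.keys f \<union> Poly_Mapping.keys g"
  have "falg_eval \<kappa> h (f + g) =
      (\<Sum>w\<in>?W. \<kappa> (Poly_Mapping.lookup (f + g) w) * prod_list (map h (letters w)))"
    by (rule falg_eval_superset) (simp_all add: keys_add)
  also have "\<dots> = falg_eval \<kappa> h f + falg_eval \<kappa> h g"
    by (simp add: falg_eval_superset[of ?W f] falg_eval_superset[of ?W g] lookup_add add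
        distrib_right sum.distrib)
  finally show ?thesis .
qed

lemma falg_eval_single:
  "falg_eval \<kappa> h (Poly_Mapping.single w c) = \<kappa> c * prod_list (map h (letters w))"
  by (subst falg_eval_superset[of "{w}"]) auto

text \<open>Both factors are built up monomial by monomial. For two monomials the scalars are
  collected on the left, which is where centrality of \<open>\<kappa>\<close> enters.\<close>

lemma falg_eval_mult: "falg_eval \<kappa> h (f * g) = falg_eval \<kappa> h f * falg_eval \<kappa> h g"
proof -
  have z: "falg_eval \<kappa> h 0 = 0" by (simp add: falg_eval_def)
  have 1: "falg_eval \<kappa> h (Poly_Mapping.single w c * g) =
      falg_eval \<kappa> h (Poly_Mapping.single w c) * falg_eval \<kappa> h g" for w c g
  proof (induction g rule: update_induct)
    case const
    then show ?case by (simp add: z)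
  next
    case (update g v d)
    note update_eq_add_single[OF update(1), of d]
    moreover have "\<kappa> (c * d) * (p * q) = \<kappa> c * p * (\<kappa> d * q)" for p q
      by (metis central mult mult.assoc)
    ultimately show ?case
      by (simp add: distrib_left falg_eval_add update.IH mult_single falg_eval_single plus_fword_def)
  qed
  show ?thesis
  proof (induction f rule: update_induct)
    case const
    then show ?case by (simp add: z)
  next
    case (update f v d)
    note update_eq_add_single[OF update(1), of d]
    then show ?case
      by (simp add: distrib_right falg_eval_add update.IH 1)
  qed
qed

lemma falg_eval_scal: "falg_eval \<kappa> h (scal c) = \<kappa> c"
  by (simp add: scal_def falg_eval_single zero_fword_def)

lemma ring_map_falg_eval: "ring_map (falg_eval \<kappa> h)"
proof
  show "falg_eval \<kappa> h 1 = 1"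
    using falg_eval_scal[of h 1] by (simp add: scal_def one)
qed (simp_all add: falg_eval_add falg_eval_mult)

lemma falg_eval_gen_s:
  "falg_eval \<kappa> h (gen_s i j r) = (if r = 0 then of_bool (i = j) else h (i, j, r))"
  using ring_map.of_bool[OF ring_map_falg_eval, of h "i = j"]
  by (simp add: gen_s_def falg_eval_single one)

lemma falg_eval_in_subring:
  assumes "unital_subring Q" "\<And>c. \<kappa> c \<in> Q"
    and "\<And>w x. w \<in> Poly_Mapping.keys f \<Longrightarrow> x \<in> set (letters w) \<Longrightarrow> h x \<in> Q"
  shows "falg_eval \<kappa> h f \<in> Q"
proof -
  note Q = unital_subringD[OF assms(1)]
  have "prod_list (map h xs) \<in> Q" if "\<And>x. x \<in> set xs \<Longrightarrow> h x \<in> Q" for xs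
    using that by (induction xs) (auto intro: Q)
  then show ?thesis
    unfolding falg_eval_def by (intro unital_subring_sum assms Q) (use assms in auto)
qed

end

lemma scal_scalar_map: "scalar_map (scal :: 'k::field \<Rightarrow> 'k falg)"
proof
  fix c d :: 'k and x :: "'k falg"
  show "scal (c + d) = scal c + scal d" by (simp add: scal_def single_add)
  show "scal (c * d) = scal c * scal d" by (simp add: scal_def mult_single)
  show "scal 1 = (1 :: 'k falg)" by (simp add: scal_def)
  show "scal c * x = x * scal c"
  proof (induction x rule: update_induct)
    case const
    then show ?case by simp
  next
    case (update f v d)
    note update_eq_add_single[OF update(1), of d]
    then show ?case
      using update.IH by (simp add: scal_def distrib_left distrib_right mult_single mult.commute)
  qed
qed



section \<open>Dressing a solution of the reflection equation\<close>

text \<open>Entries outside the index range are set to zero, so that the identities between products of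
  tensor matrices become plain equations of functions.\<close>

definition restrict_mat :: "nat \<Rightarrow> ('a::ring_1) tensor_mat \<Rightarrow> 'a tensor_mat" where
  "restrict_mat n X I J =
     (if I \<in> index_set n \<times> index_set n \<and> J \<in> index_set n \<times> index_set n then X I J else 0)"

lemma finite_index_set [simp]: "finite (index_set n)"
  by (simp add: index_set_def)

lemma uminus_index_set [simp]: "- i \<in> index_set n \<longleftrightarrow> i \<in> index_set n"
  by (auto simp: index_set_def)

lemma tensor_mult_assoc:
  "tensor_mult n (tensor_mult n X Y) Z = tensor_mult n X (tensor_mult n Y Z)"
proof (intro ext)
  fix I J
  let ?I = "index_set n \<times> index_set n"
  have "tensor_mult n (tensor_mult n X Y) Z I J = (\<Sum>L\<in>?I. \<Sum>M\<in>?I. X I M * Y M L * Z L J)"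
    by (simp add: tensor_mult_def sum_distrib_right)
  also have "\<dots> = (\<Sum>M\<in>?I. \<Sum>L\<in>?I. X I M * Y M L * Z L J)"
    by (rule sum.swap)
  also have "\<dots> = tensor_mult n X (tensor_mult n Y Z) I J"
    by (simp add: tensor_mult_def sum_distrib_left mult.assoc)
  finally show "tensor_mult n (tensor_mult n X Y) Z I J = tensor_mult n X (tensor_mult n Y Z) I J" .
qed

lemma tensor_mult_restrict:
  "tensor_mult n (restrict_mat n X) (restrict_mat n Y) = restrict_mat n (tensor_mult n X Y)"
proof (intro ext)
  fix I J
  show "tensor_mult n (restrict_mat n X) (restrict_mat n Y) I J = restrict_mat n (tensor_mult n X Y) I J"
    by (cases "I \<in> index_set n \<times> index_set n"; cases "J \<in> index_set n \<times> index_set n")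
      (simp_all only: tensor_mult_def restrict_mat_def if_True if_False simp_thms mult_zero_left
        mult_zero_right sum.neutral_const cong: sum.cong)
qed

section \<open>Matrices acting in one tensor factor, and the two R-matrices\<close>

definition leg1 :: "nat \<Rightarrow> (int \<Rightarrow> int \<Rightarrow> 'a::ring_1) \<Rightarrow> 'a tensor_mat" where
  "leg1 n A = restrict_mat n (\<lambda>(i, k) (j, l). of_bool (k = l) * A i j)"

definition leg2 :: "nat \<Rightarrow> (int \<Rightarrow> int \<Rightarrow> 'a::ring_1) \<Rightarrow> 'a tensor_mat" where
  "leg2 n A = restrict_mat n (\<lambda>(i, k) (j, l). of_bool (i = j) * A k l)"

text \<open>The element \<open>x\<close> takes the place of 1/(u - v), and in
  \<open>R'_scaled\<close> that of 1/(- u - v): series over the operators form a ring without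
  division, in which a central element plays this part.\<close>

definition R_scaled :: "nat \<Rightarrow> 'a::ring_1 \<Rightarrow> 'a tensor_mat" where
  "R_scaled n x = restrict_mat n (\<lambda>I J. id_mat I J - x * perm_mat I J)"

definition R'_scaled :: "nat \<Rightarrow> 'a::ring_1 \<Rightarrow> 'a tensor_mat" where
  "R'_scaled n x = restrict_mat n (\<lambda>I J. id_mat I J - x * prime1 perm_mat I J)"

definition mat_mult ::
    "nat \<Rightarrow> (int \<Rightarrow> int \<Rightarrow> 'a::ring_1) \<Rightarrow> (int \<Rightarrow> int \<Rightarrow> 'a) \<Rightarrow> int \<Rightarrow> int \<Rightarrow> 'a" where
  "mat_mult n A B i j = (\<Sum>a\<in>index_set n. A i a * B a j)"

lemma sum_index_delta:
  assumes "i \<in> index_set n"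
  shows "(\<Sum>m\<in>index_set n. of_bool (m = i) * f m) = (f i :: 'a::ring_1)"
    and "(\<Sum>m\<in>index_set n. of_bool (i = m) * f m) = f i"
    and "(\<Sum>m\<in>index_set n. f m * of_bool (m = i)) = f i"
    and "(\<Sum>m\<in>index_set n. f m * of_bool (i = m)) = f i"
  using assms by (simp_all add: of_bool_def if_distrib if_distribR cong: if_cong)

context
  fixes n :: nat and i j k l :: int
  assumes idx: "i \<in> index_set n" "j \<in> index_set n" "k \<in> index_set n" "l \<in> index_set n"
begin

lemma tensor_mult_leg:
  shows "tensor_mult n (leg1 n A) X (i, k) (j, l) = (\<Sum>m\<in>index_set n. A i m * X (m, k) (j, l))"
    and "tensor_mult n (leg2 n A) X (i, k) (j, l) = (\<Sum>m\<in>index_set n. A k m * X (i, m) (j, l))"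
    and "tensor_mult n X (leg1 n A) (i, k) (j, l) = (\<Sum>m\<in>index_set n. X (i, k) (m, l) * A m j)"
    and "tensor_mult n X (leg2 n A) (i, k) (j, l) = (\<Sum>m\<in>index_set n. X (i, k) (j, m) * A m l)"
proof -
  have E: "tensor_mult n Y Z (i, k) (j, l) =
      (\<Sum>m\<in>index_set n. \<Sum>q\<in>index_set n. Y (i, k) (m, q) * Z (m, q) (j, l))" for Y Z :: "'a tensor_mat"
    by (simp add: tensor_mult_def sum.cartesian_product)
  have E': "tensor_mult n Y Z (i, k) (j, l) =
      (\<Sum>q\<in>index_set n. \<Sum>m\<in>index_set n. Y (i, k) (m, q) * Z (m, q) (j, l))" for Y Z :: "'a tensor_mat"
    unfolding E by (rule sum.swap)
  have D: "(\<Sum>m\<in>index_set n. f m * (of_bool (m = t) * g m)) = f t * g t"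
      "(\<Sum>m\<in>index_set n. (of_bool (t = m) * f m) * g m) = f t * g t"
    if "t \<in> index_set n" for f g :: "int \<Rightarrow> 'a" and t
    using that by (simp_all add: of_bool_def if_distrib if_distribR cong: if_cong)
  show "tensor_mult n (leg1 n A) X (i, k) (j, l) = (\<Sum>m\<in>index_set n. A i m * X (m, k) (j, l))"
    using idx by (simp add: E leg1_def restrict_mat_def D)
  show "tensor_mult n (leg2 n A) X (i, k) (j, l) = (\<Sum>m\<in>index_set n. A k m * X (i, m) (j, l))"
    using idx by (simp add: E' leg2_def restrict_mat_def D)
  show "tensor_mult n X (leg1 n A) (i, k) (j, l) = (\<Sum>m\<in>index_set n. X (i, k) (m, l) * A m j)"
    using idx by (simp add: E leg1_def restrict_mat_def D)
  show "tensor_mult n X (leg2 n A) (i, k) (j, l) = (\<Sum>m\<in>index_set n. X (i, k) (j, m) * A m l)"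
    using idx by (simp add: E' leg2_def restrict_mat_def D)
qed

lemma tensor_mult_leg1_leg2: "tensor_mult n (leg1 n A) (leg2 n B) (i, k) (j, l) = A i j * B k l"
proof -
  have "tensor_mult n (leg1 n A) (leg2 n B) (i, k) (j, l) =
      (\<Sum>m\<in>index_set n. A i m * (of_bool (m = j) * B k l))"
    unfolding tensor_mult_leg(1) using idx by (simp add: leg2_def restrict_mat_def)
  then show ?thesis
    using idx by (simp add: of_bool_def if_distrib if_distribR cong: if_cong)
qed

lemma tensor_mult_leg2_leg1: "tensor_mult n (leg2 n B) (leg1 n A) (i, k) (j, l) = B k l * A i j"
proof -
  have "tensor_mult n (leg2 n B) (leg1 n A) (i, k) (j, l) =
      (\<Sum>m\<in>index_set n. B k m * (of_bool (m = l) * A i j))"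
    unfolding tensor_mult_leg(2) using idx by (simp add: leg1_def restrict_mat_def)
  then show ?thesis
    using idx by (simp add: of_bool_def if_distrib if_distribR cong: if_cong)
qed

text \<open>P exchanges the tensor factors: on the left it swaps the two row indices, on the right
  the two column indices.\<close>

lemma tensor_mult_R_scaled:
  assumes x: "\<And>z. x * z = z * x"
  shows "tensor_mult n (R_scaled n x) X (i, k) (j, l) = X (i, k) (j, l) - x * X (k, i) (j, l)"
    and "tensor_mult n X (R_scaled n x) (i, k) (j, l) = X (i, k) (j, l) - x * X (i, k) (l, j)"
proof -
  let ?I = "index_set n \<times> index_set n"
  have "tensor_mult n (R_scaled n x) X (i, k) (j, l) =
      (\<Sum>L\<in>?I. of_bool ((i, k) = L) * X L (j, l) - x * (of_bool ((k, i) = L) * X L (j, l)))"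
    unfolding tensor_mult_def R_scaled_def
    by (intro sum.cong refl)
      (use idx in \<open>auto simp: restrict_mat_def id_mat_def perm_mat_def algebra_simps split: prod.splits\<close>)
  also have "\<dots> = X (i, k) (j, l) - x * X (k, i) (j, l)"
    unfolding sum_subtractf sum_distrib_left[symmetric]
    using idx by (simp add: of_bool_def if_distrib if_distribR cong: if_cong)
  finally show "tensor_mult n (R_scaled n x) X (i, k) (j, l) = X (i, k) (j, l) - x * X (k, i) (j, l)" .
  have "tensor_mult n X (R_scaled n x) (i, k) (j, l) =
      (\<Sum>L\<in>?I. X (i, k) L * of_bool (L = (j, l)) - x * (X (i, k) L * of_bool (L = (l, j))))"
    unfolding tensor_mult_def R_scaled_def
    by (intro sum.cong refl)
      (use idx x in \<open>auto simp: restrict_mat_def id_mat_def perm_mat_def algebra_simps split: prod.splits\<close>)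
  also have "\<dots> = X (i, k) (j, l) - x * X (i, k) (l, j)"
    unfolding sum_subtractf sum_distrib_left[symmetric]
    using idx by (simp add: of_bool_def if_distrib if_distribR cong: if_cong)
  finally show "tensor_mult n X (R_scaled n x) (i, k) (j, l) = X (i, k) (j, l) - x * X (i, k) (l, j)" .
qed

end

context
  fixes n :: nat and i j k l :: int
  assumes idx: "i \<in> index_set n" "j \<in> index_set n" "k \<in> index_set n" "l \<in> index_set n"
begin

text \<open>P' has rank one: its entry at (i, k), (j, l) vanishes unless k = -i and l = -j. Hence
  the correction term pairs column -k of \<open>A\<close> with row -j of \<open>B\<close>, with the
  sign given by \<open>theta\<close>.\<close>

lemma tensor_mult_leg1_R'_leg2:
  assumes x: "\<And>z. x * z = z * x"
  shows "tensor_mult n (tensor_mult n (leg1 n A) (R'_scaled n x)) (leg2 n B) (i, k) (j, l) =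
    A i j * B k l - x * of_int (theta (- k) j) * (A i (- k) * B (- j) l)"
proof -
  have R: "tensor_mult n (leg1 n A) (R'_scaled n x) (i, k) (j, m) =
      A i j * of_bool (m = k) - x * of_int (theta (- k) j) * (A i (- k) * of_bool (m = - j))"
    if m: "m \<in> index_set n" for m
  proof -
    have "tensor_mult n (leg1 n A) (R'_scaled n x) (i, k) (j, m) =
        (\<Sum>q\<in>index_set n. A i q * of_bool (k = m) * of_bool (q = j)
          - x * of_int (theta q j) * (A i q * of_bool (m = - j)) * of_bool (q = - k))"
      unfolding tensor_mult_leg(1)[OF idx(1,2,3) m]
    proof (intro sum.cong refl)
      fix q assume q: "q \<in> index_set n"
      have [simp]: "a * x * of_int t = x * of_int t * a" for t and a :: 'a
        by (metis mult_of_int_commute x mult.assoc)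
      have "- q = k \<longleftrightarrow> q = - k" by auto
      then show "A i q * R'_scaled n x (q, k) (j, m) = A i q * of_bool (k = m) * of_bool (q = j)
          - x * of_int (theta q j) * (A i q * of_bool (m = - j)) * of_bool (q = - k)"
        using q m idx
        by (auto simp: R'_scaled_def restrict_mat_def id_mat_def prime1_def perm_mat_def
            right_diff_distrib mult.assoc[symmetric])
    qed
    then show ?thesis
      using idx by (simp add: sum_subtractf sum_index_delta eq_commute)
  qed
  have "tensor_mult n (tensor_mult n (leg1 n A) (R'_scaled n x)) (leg2 n B) (i, k) (j, l) =
     (\<Sum>m\<in>index_set n. of_bool (m = k) * (A i j * B m l)
        - of_bool (m = - j) * (x * of_int (theta (- k) j) * (A i (- k) * B m l)))"
    unfolding tensor_mult_leg(4)[OF idx] by (intro sum.cong refl) (auto simp: R left_diff_distrib mult.assoc)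
  then show ?thesis
    using idx by (simp add: sum_subtractf sum_index_delta)
qed

lemma tensor_mult_leg2_R'_leg1:
  assumes x: "\<And>z. x * z = z * x"
  shows "tensor_mult n (tensor_mult n (leg2 n B) (R'_scaled n x)) (leg1 n A) (i, k) (j, l) =
    B k l * A i j - x * of_int (theta i (- l)) * (B k (- i) * A (- l) j)"
proof -
  have R: "tensor_mult n (leg2 n B) (R'_scaled n x) (i, k) (m, l) =
      B k l * of_bool (m = i) - x * of_int (theta i (- l)) * (B k (- i) * of_bool (m = - l))"
    if m: "m \<in> index_set n" for m
  proof -
    have "tensor_mult n (leg2 n B) (R'_scaled n x) (i, k) (m, l) =
        (\<Sum>q\<in>index_set n. B k q * of_bool (i = m) * of_bool (q = l)
          - x * of_int (theta i (- l)) * (B k q * of_bool (m = - l)) * of_bool (q = - i))"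
      unfolding tensor_mult_leg(2)[OF idx(1) m idx(3,4)]
    proof (intro sum.cong refl)
      fix q assume q: "q \<in> index_set n"
      have [simp]: "a * x * of_int t = x * of_int t * a" for t and a :: 'a
        by (metis mult_of_int_commute x mult.assoc)
      have "- m = l \<longleftrightarrow> m = - l" by auto
      then show "B k q * R'_scaled n x (i, q) (m, l) = B k q * of_bool (i = m) * of_bool (q = l)
          - x * of_int (theta i (- l)) * (B k q * of_bool (m = - l)) * of_bool (q = - i)"
        using q m idx
        by (auto simp: R'_scaled_def restrict_mat_def id_mat_def prime1_def perm_mat_def
            right_diff_distrib mult.assoc[symmetric])
    qed
    then show ?thesis
      using idx by (simp add: sum_subtractf sum_index_delta eq_commute)
  qed
  have "tensor_mult n (tensor_mult n (leg2 n B) (R'_scaled n x)) (leg1 n A) (i, k) (j, l) =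
     (\<Sum>m\<in>index_set n. of_bool (m = i) * (B k l * A m j)
        - of_bool (m = - l) * (x * of_int (theta i (- l)) * (B k (- i) * A m j)))"
    unfolding tensor_mult_leg(3)[OF idx] by (intro sum.cong refl) (auto simp: R left_diff_distrib mult.assoc)
  then show ?thesis
    using idx by (simp add: sum_subtractf sum_index_delta)
qed

end

lemma restrict_mat_restrict_mat [simp]: "restrict_mat n (restrict_mat n X) = restrict_mat n X"
  by (intro ext) (simp add: restrict_mat_def)

lemma restrict_mat_leg [simp]:
  "restrict_mat n (leg1 n A) = leg1 n A" "restrict_mat n (leg2 n A) = leg2 n A"
  "restrict_mat n (R_scaled n x) = R_scaled n x" "restrict_mat n (R'_scaled n x) = R'_scaled n x"
  by (simp_all add: leg1_def leg2_def R_scaled_def R'_scaled_def)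

lemma restrict_tensor_mult:
  assumes "restrict_mat n X = X" "restrict_mat n Y = Y"
  shows "restrict_mat n (tensor_mult n X Y) = tensor_mult n X Y"
  using tensor_mult_restrict[of n X Y] assms by simp

lemma restricted_eqI:
  assumes "restrict_mat n X = X" "restrict_mat n Y = Y"
    and "\<And>i j k l. \<lbrakk>i \<in> index_set n; j \<in> index_set n; k \<in> index_set n; l \<in> index_set n\<rbrakk> \<Longrightarrow>
      X (i, k) (j, l) = Y (i, k) (j, l)"
  shows "X = Y"
proof -
  have "restrict_mat n X = restrict_mat n Y"
    by (intro ext) (auto simp: restrict_mat_def assms(3))
  then show ?thesis using assms by simp
qed

lemma leg_mat_mult:
  "leg1 n (mat_mult n A B) = tensor_mult n (leg1 n A) (leg1 n B)"
  "leg2 n (mat_mult n A B) = tensor_mult n (leg2 n A) (leg2 n B)"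
proof -
  show "leg1 n (mat_mult n A B) = tensor_mult n (leg1 n A) (leg1 n B)" (is "?L = ?R")
  proof (rule restricted_eqI[of n])
    fix i j k l assume "i \<in> index_set n" "j \<in> index_set n" "k \<in> index_set n" "l \<in> index_set n"
    then show "?L (i, k) (j, l) = ?R (i, k) (j, l)"
      by (subst tensor_mult_leg(1)) (auto simp: leg1_def restrict_mat_def mat_mult_def)
  qed (simp_all add: restrict_tensor_mult)
  show "leg2 n (mat_mult n A B) = tensor_mult n (leg2 n A) (leg2 n B)" (is "?L = ?R")
  proof (rule restricted_eqI[of n])
    fix i j k l assume "i \<in> index_set n" "j \<in> index_set n" "k \<in> index_set n" "l \<in> index_set n"
    then show "?L (i, k) (j, l) = ?R (i, k) (j, l)"
      by (subst tensor_mult_leg(2)) (auto simp: leg2_def restrict_mat_def mat_mult_def)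
  qed (simp_all add: restrict_tensor_mult)
qed

lemma leg_commute:
  assumes "\<And>i j k l. \<lbrakk>i \<in> index_set n; j \<in> index_set n; k \<in> index_set n; l \<in> index_set n\<rbrakk> \<Longrightarrow>
      A i j * B k l = B k l * A i j"
  shows "tensor_mult n (leg1 n A) (leg2 n B) = tensor_mult n (leg2 n B) (leg1 n A)"
  by (rule restricted_eqI[of n])
    (simp_all add: restrict_tensor_mult tensor_mult_leg1_leg2 tensor_mult_leg2_leg1 assms)

section \<open>The dressing of a solution, and the two relations it preserves\<close>

definition theta_transpose :: "(int \<Rightarrow> int \<Rightarrow> 'a::ring_1) \<Rightarrow> int \<Rightarrow> int \<Rightarrow> 'a" where
  "theta_transpose A i j = of_int (theta i j) * A (- j) (- i)"

text \<open>The product A S B'. In use A = T(u) and B = T(-u), so the transposition is applied to a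
  matrix already taken at -u.\<close>

definition dress ::
    "nat \<Rightarrow> (int \<Rightarrow> int \<Rightarrow> 'a::ring_1) \<Rightarrow> (int \<Rightarrow> int \<Rightarrow> 'a) \<Rightarrow> (int \<Rightarrow> int \<Rightarrow> 'a) \<Rightarrow> int \<Rightarrow> int \<Rightarrow> 'a" where
  "dress n A B S = mat_mult n (mat_mult n A S) (theta_transpose B)"

definition reflection_eq ::
    "nat \<Rightarrow> 'a::ring_1 \<Rightarrow> 'a \<Rightarrow> (int \<Rightarrow> int \<Rightarrow> 'a) \<Rightarrow> (int \<Rightarrow> int \<Rightarrow> 'a) \<Rightarrow> bool" where
  "reflection_eq n x y S U \<longleftrightarrow>
     tensor_mult n (tensor_mult n (tensor_mult n (R_scaled n x) (leg1 n S)) (R'_scaled n y)) (leg2 n U)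
   = tensor_mult n (tensor_mult n (tensor_mult n (leg2 n U) (R'_scaled n y)) (leg1 n S)) (R_scaled n x)"

text \<open>\<open>A\<close> and \<open>B\<close> stand for T(u) and T(v), and \<open>x\<close> for
  1/(u - v). The second equation is the first with the roles of (A, i, j) and (B, k, l) exchanged,
  which turns x into -x; as \<open>A\<close> and \<open>B\<close> are independent matrices here,
  both are recorded.\<close>

definition rtt :: "nat \<Rightarrow> 'a::ring_1 \<Rightarrow> (int \<Rightarrow> int \<Rightarrow> 'a) \<Rightarrow> (int \<Rightarrow> int \<Rightarrow> 'a) \<Rightarrow> bool" where
  "rtt n x A B \<longleftrightarrow> (\<forall>i\<in>index_set n. \<forall>j\<in>index_set n. \<forall>k\<in>index_set n. \<forall>l\<in>index_set n.
     A i j * B k l - B k l * A i j = x * (A k j * B i l - B k j * A i l) \<and>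
     A i j * B k l - B k l * A i j = x * (B i l * A k j - A i l * B k j))"

lemma rttD:
  assumes "rtt n x A B" "i \<in> index_set n" "j \<in> index_set n" "k \<in> index_set n" "l \<in> index_set n"
  shows "A i j * B k l - B k l * A i j = x * (A k j * B i l - B k j * A i l)"
    and "A i j * B k l - B k l * A i j = x * (B i l * A k j - A i l * B k j)"
  using assms unfolding rtt_def by blast+

text \<open>Here A1, B1, A2, B2 stand for T(u), T(-u), T(v), T(-v), and x, y for 1/(u-v), 1/(-u-v).
  The parameter of each RTT hypothesis is the inverse difference of the two arguments, for instance
  1/(-u+v) = -x for T(-u), T(-v) and 1/(u+v) = -y for T(u), T(-v).\<close>

lemma reflection_eq_dress:
  assumes x: "\<And>z. x * z = z * x" and y: "\<And>z. y * z = z * y"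
    and TT: "rtt n x A1 A2" and BT: "rtt n y B1 A2" and BB: "rtt n (- x) B1 B2"
    and TB: "rtt n (- y) A1 B2"
    and comm: "\<And>i j k l. \<lbrakk>i \<in> index_set n; j \<in> index_set n; k \<in> index_set n; l \<in> index_set n\<rbrakk> \<Longrightarrow>
      S i j * A2 k l = A2 k l * S i j \<and> S i j * B2 k l = B2 k l * S i j \<and>
      U i j * A1 k l = A1 k l * U i j \<and> U i j * B1 k l = B1 k l * U i j"
    and S: "reflection_eq n x y S U"
  shows "reflection_eq n x y (dress n A1 B1 S) (dress n A2 B2 U)"
proof -
  let ?t = theta_transpose
  note entries = tensor_mult_R_scaled[OF _ _ _ _ x] tensor_mult_leg1_R'_leg2[OF _ _ _ _ y]
    tensor_mult_leg2_R'_leg1[OF _ _ _ _ y] tensor_mult_leg1_leg2 tensor_mult_leg2_leg1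
  have ci: "of_int t * a = a * of_int t" for t and a :: 'a
    by (rule mult_of_int_commute)
  have pull: "(of_int s * a) * (of_int t * b) = of_int (s * t) * (a * b)" for s t and a b :: 'a
    by (metis ci mult.assoc of_int_mult)
  have xi: "x * (of_int s * a) = of_int s * (x * a)" "y * (of_int s * a) = of_int s * (y * a)"
    for s and a :: 'a
    by (metis ci mult.assoc)+
  \<comment> \<open>The four exchange relations are the RTT relation with no, the first, both or the second tensor factor
     transposed; the second form in \<open>rtt\<close> is needed whenever the second factor is transposed.\<close>
  have 1: "tensor_mult n (R_scaled n x) (tensor_mult n (leg1 n A1) (leg2 n A2)) =
      tensor_mult n (tensor_mult n (leg2 n A2) (leg1 n A1)) (R_scaled n x)"
    (is "?L1 = ?R1")
  proof (rule restricted_eqI[of n])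
    fix i j k l assume i: "i \<in> index_set n" "j \<in> index_set n" "k \<in> index_set n" "l \<in> index_set n"
    then show "?L1 (i, k) (j, l) = ?R1 (i, k) (j, l)"
      using rttD(1)[OF TT i] by (simp add: entries algebra_simps)
  qed (simp_all add: restrict_tensor_mult)
  have 2: "tensor_mult n (tensor_mult n (leg1 n (?t B1)) (R'_scaled n y)) (leg2 n A2) =
      tensor_mult n (tensor_mult n (leg2 n A2) (R'_scaled n y)) (leg1 n (?t B1))"
    (is "?L2 = ?R2")
  proof (rule restricted_eqI[of n])
    fix i j k l assume i: "i \<in> index_set n" "j \<in> index_set n" "k \<in> index_set n" "l \<in> index_set n"
    have t: "theta (- k) j * theta i (- k) = theta i j" "theta i (- l) * theta (- l) j = theta i j"
      "theta k i * theta j k = theta i j" "theta i l * theta j l = theta i j"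
      using i by (auto simp: theta_def index_set_def sgn_if)
    have "of_int (theta i j) * (B1 (- j) (- i) * A2 k l - A2 k l * B1 (- j) (- i)) =
        of_int (theta i j) * (y * (B1 k (- i) * A2 (- j) l - A2 k (- i) * B1 (- j) l))"
      using rttD(1)[OF BT, of "- j" "- i" k l] i by simp
    moreover have "y * of_int (theta (- k) j) * (of_int (theta i (- k)) * B1 k (- i) * A2 (- j) l)
        = of_int (theta i j) * (y * (B1 k (- i) * A2 (- j) l))"
      using t(1) by (metis (no_types, opaque_lifting) ci mult.assoc of_int_mult)
    moreover have "y * of_int (theta i (- l)) * (A2 k (- i) * (of_int (theta (- l) j) * B1 (- j) l))
        = of_int (theta i j) * (y * (A2 k (- i) * B1 (- j) l))"
      using t(2) by (metis (no_types, opaque_lifting) ci mult.assoc of_int_mult)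
    moreover have "A2 k l * (of_int (theta i j) * B1 (- j) (- i)) = of_int (theta i j) * (A2 k l * B1 (- j) (- i))"
      by (metis ci mult.assoc)
    ultimately show "?L2 (i, k) (j, l) = ?R2 (i, k) (j, l)"
      using i by (simp only: entries theta_transpose_def minus_minus right_diff_distrib mult.assoc)
        (simp add: algebra_simps)
  qed (simp_all add: restrict_tensor_mult)
  have 3: "tensor_mult n (R_scaled n x) (tensor_mult n (leg1 n (?t B1)) (leg2 n (?t B2))) =
      tensor_mult n (tensor_mult n (leg2 n (?t B2)) (leg1 n (?t B1))) (R_scaled n x)"
    (is "?L3 = ?R3")
  proof (rule restricted_eqI[of n])
    fix i j k l assume i: "i \<in> index_set n" "j \<in> index_set n" "k \<in> index_set n" "l \<in> index_set n"
    have t: "theta k j * theta i l = theta i j * theta k l" "theta k l * theta i j = theta i j * theta k l"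
      "theta k j * theta i l = theta i j * theta k l"
      using i by (auto simp: theta_def)
    have "of_int (theta i j * theta k l) * (B1 (- j) (- i) * B2 (- l) (- k) - B2 (- l) (- k) * B1 (- j) (- i)) =
        of_int (theta i j * theta k l) * (- x * (B2 (- j) (- k) * B1 (- l) (- i) - B1 (- j) (- k) * B2 (- l) (- i)))"
      using rttD(2)[OF BB, of "- j" "- i" "- l" "- k"] i by simp
    then show "?L3 (i, k) (j, l) = ?R3 (i, k) (j, l)"
      using i by (simp only: entries theta_transpose_def pull t xi) (simp add: algebra_simps)
  qed (simp_all add: restrict_tensor_mult)
  have 4: "tensor_mult n (tensor_mult n (leg1 n A1) (R'_scaled n y)) (leg2 n (?t B2)) =
      tensor_mult n (tensor_mult n (leg2 n (?t B2)) (R'_scaled n y)) (leg1 n A1)"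
    (is "?L4 = ?R4")
  proof (rule restricted_eqI[of n])
    fix i j k l assume i: "i \<in> index_set n" "j \<in> index_set n" "k \<in> index_set n" "l \<in> index_set n"
    have t: "theta (- k) j * theta (- j) l = theta k l" "theta i (- l) * theta k (- i) = theta k l"
      using i by (auto simp: theta_def index_set_def sgn_if)
    have "of_int (theta k l) * (A1 i j * B2 (- l) (- k) - B2 (- l) (- k) * A1 i j) =
        of_int (theta k l) * (- y * (B2 i (- k) * A1 (- l) j - A1 i (- k) * B2 (- l) j))"
      using rttD(2)[OF TB, of i j "- l" "- k"] i by simp
    moreover have "y * of_int (theta (- k) j) * (A1 i (- k) * (of_int (theta (- j) l) * B2 (- l) j))
        = of_int (theta k l) * (y * (A1 i (- k) * B2 (- l) j))"
      using t(1) by (metis (no_types, opaque_lifting) ci mult.assoc of_int_mult)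
    moreover have "y * of_int (theta i (- l)) * (of_int (theta k (- i)) * B2 i (- k) * A1 (- l) j)
        = of_int (theta k l) * (y * (B2 i (- k) * A1 (- l) j))"
      using t(2) by (metis (no_types, opaque_lifting) ci mult.assoc of_int_mult)
    moreover have "A1 i j * (of_int (theta k l) * B2 (- l) (- k)) = of_int (theta k l) * (A1 i j * B2 (- l) (- k))"
      by (metis ci mult.assoc)
    ultimately show "?L4 (i, k) (j, l) = ?R4 (i, k) (j, l)"
      using i by (simp only: entries theta_transpose_def minus_minus right_diff_distrib mult.assoc)
        (simp add: algebra_simps)
  qed (simp_all add: restrict_tensor_mult)
  have ct: "a * (of_int t * b) = (of_int t * b) * a \<longleftrightarrow> of_int t * (a * b) = of_int t * (b * a)"
    for t and a b :: 'a
    by (metis ci mult.assoc)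
  have 5: "tensor_mult n (leg1 n S) (leg2 n A2) = tensor_mult n (leg2 n A2) (leg1 n S)"
    by (rule leg_commute) (use comm in blast)
  have 6: "tensor_mult n (leg1 n S) (leg2 n (?t B2)) = tensor_mult n (leg2 n (?t B2)) (leg1 n S)"
    by (rule leg_commute) (use comm in \<open>simp add: theta_transpose_def ct\<close>)
  have 7: "tensor_mult n (leg1 n A1) (leg2 n U) = tensor_mult n (leg2 n U) (leg1 n A1)"
    by (rule leg_commute) (use comm in metis)
  have 8: "tensor_mult n (leg1 n (?t B1)) (leg2 n U) = tensor_mult n (leg2 n U) (leg1 n (?t B1))"
  proof (rule leg_commute)
    fix i j k l assume "i \<in> index_set n" "j \<in> index_set n" "k \<in> index_set n" "l \<in> index_set n"
    then have "U k l * B1 (- j) (- i) = B1 (- j) (- i) * U k l" using comm by simp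
    then show "?t B1 i j * U k l = U k l * ?t B1 i j"
      unfolding theta_transpose_def by (metis ci mult.assoc)
  qed
  let ?m = "tensor_mult n"
  note a = tensor_mult_assoc[of n]
  \<comment> \<open>The three rules let an exchange relation act on the front part of a longer
    right-associated product.\<close>
  have r2: "?m X (?m Y V) = ?m Z (?m W V)" if "?m X Y = ?m Z W" for X Y Z W V :: "'a tensor_mat"
    by (metis a that)
  have r3: "?m X (?m Y (?m Z V)) = ?m X' (?m Y' (?m Z' V))" if "?m X (?m Y Z) = ?m X' (?m Y' Z')"
    for X Y Z X' Y' Z' V :: "'a tensor_mat"
    by (metis a that)
  have r4: "?m X (?m Y (?m Z (?m T V))) = ?m X' (?m Y' (?m Z' (?m T' V)))"
    if "?m X (?m Y (?m Z T)) = ?m X' (?m Y' (?m Z' T'))"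
    for X Y Z T X' Y' Z' T' V :: "'a tensor_mat"
    by (metis a that)
  note rules = 1[unfolded a] 2[unfolded a] 3[unfolded a] 4[unfolded a]
    S[unfolded reflection_eq_def a]
  \<comment> \<open>Each rule carries factors of the second leg leftwards past those of the first,
    or R rightwards. Applied to R A1 S B1' R' A2 U B2' they end in A2 U B2' R' A1 S B1' R, which is
    the other side.\<close>
  show ?thesis
    unfolding reflection_eq_def dress_def leg_mat_mult
    by (simp only: a rules 5 6 7 8 rules(1-4)[THEN r3] rules(5)[THEN r4] 5[THEN r2] 6[THEN r2]
        7[THEN r2] 8[THEN r2])
qed


text \<open>The two sides of the symmetry relation for a dressed matrix are combinations of such sums, where
  \<open>p a b\<close> is one of the products $A_{ia} B_{-j,-b}$, $B_{-j,-b} A_{ia}$, $A_{-j,-b} B_{ia}$,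
  $B_{ia} A_{-j,-b}$; the substitution $(a, b) \mapsto (-b, -a)$ brings the right-hand
  side of the RTT relation into this form.\<close>

definition dress_sum ::
    "nat \<Rightarrow> int \<Rightarrow> (int \<Rightarrow> int \<Rightarrow> 'a::ring_1) \<Rightarrow> (int \<Rightarrow> int \<Rightarrow> 'a) \<Rightarrow> 'a" where
  "dress_sum n j p S = (\<Sum>a\<in>index_set n. \<Sum>b\<in>index_set n. of_int (theta b j) * (p a b * S a b))"

lemma dress_sum_cong:
  assumes "\<And>a b. a \<in> index_set n \<Longrightarrow> b \<in> index_set n \<Longrightarrow> p a b = q a b"
    and "\<And>a b. a \<in> index_set n \<Longrightarrow> b \<in> index_set n \<Longrightarrow> S a b = U a b"
  shows "dress_sum n j p S = dress_sum n j q U"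
  unfolding dress_sum_def using assms by (intro sum.cong refl) simp

lemma dress_sum_diff:
  "dress_sum n j (\<lambda>a b. p a b - q a b) S = dress_sum n j p S - dress_sum n j q S"
  "dress_sum n j p (\<lambda>a b. S a b - U a b) = dress_sum n j p S - dress_sum n j p U"
  by (simp_all add: dress_sum_def left_diff_distrib right_diff_distrib sum_subtractf)

lemma dress_sum_add:
  "dress_sum n j p (\<lambda>a b. S a b + U a b) = dress_sum n j p S + dress_sum n j p U"
  by (simp add: dress_sum_def distrib_left sum.distrib)

lemma dress_sum_scale:
  assumes w: "\<And>z. w * z = z * w"
  shows "dress_sum n j (\<lambda>a b. w * p a b) S = w * dress_sum n j p S"
    and "dress_sum n j p (\<lambda>a b. w * S a b) = w * dress_sum n j p S"
proof -
  have "of_int t * (w * x * y) = w * (of_int t * (x * y))"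
    "of_int t * (x * (w * y)) = w * (of_int t * (x * y))" for t x y
    by (metis w mult.assoc)+
  then show "dress_sum n j (\<lambda>a b. w * p a b) S = w * dress_sum n j p S"
    and "dress_sum n j p (\<lambda>a b. w * S a b) = w * dress_sum n j p S"
    by (simp_all add: dress_sum_def sum_distrib_left)
qed

lemma sum_index_reflect:
  fixes g :: "int \<Rightarrow> int \<Rightarrow> 'a::ring_1"
  shows "(\<Sum>a\<in>index_set n. \<Sum>b\<in>index_set n. g a b) = (\<Sum>a\<in>index_set n. \<Sum>b\<in>index_set n. g (- b) (- a))"
proof -
  have r: "(\<Sum>a\<in>index_set n. f a) = (\<Sum>a\<in>index_set n. f (- a))" for f :: "int \<Rightarrow> 'a"
    by (rule sum.reindex_bij_witness[of _ uminus uminus]) auto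
  have "(\<Sum>a\<in>index_set n. \<Sum>b\<in>index_set n. g a b) = (\<Sum>a\<in>index_set n. \<Sum>b\<in>index_set n. g (- a) b)"
    by (rule r)
  also have "\<dots> = (\<Sum>a\<in>index_set n. \<Sum>b\<in>index_set n. g (- a) (- b))"
    by (intro sum.cong refl r)
  also have "\<dots> = (\<Sum>a\<in>index_set n. \<Sum>b\<in>index_set n. g (- b) (- a))"
    by (rule sum.swap)
  finally show ?thesis .
qed

text \<open>The minus sign comes from sgn(-a) = - sgn(a): it is the sign that distinguishes the
  symplectic from the orthogonal transposition.\<close>

lemma dress_sum_reflect:
  assumes "j \<in> index_set n"
  shows "dress_sum n j (\<lambda>a b. p (- b) (- a)) S = - dress_sum n j p (theta_transpose S)"
proof -
  have "dress_sum n j (\<lambda>a b. p (- b) (- a)) S =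
      (\<Sum>a\<in>index_set n. \<Sum>b\<in>index_set n. of_int (theta (- a) j) * (p a b * S (- b) (- a)))"
    unfolding dress_sum_def by (subst sum_index_reflect) simp
  also have "\<dots> = (\<Sum>a\<in>index_set n. \<Sum>b\<in>index_set n.
      - (of_int (theta b j) * (p a b * theta_transpose S a b)))"
  proof (intro sum.cong refl)
    fix a b assume ab: "a \<in> index_set n" "b \<in> index_set n"
    have "theta (- a) j = - (theta b j * theta a b)"
      using ab assms by (auto simp: theta_def index_set_def sgn_if)
    then show "of_int (theta (- a) j) * (p a b * S (- b) (- a)) =
        - (of_int (theta b j) * (p a b * theta_transpose S a b))"
      unfolding theta_transpose_def
      by (metis (no_types, opaque_lifting) mult.assoc mult_minus_left mult_of_int_commute of_int_minus of_int_mult)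
  qed
  also have "\<dots> = - dress_sum n j p (theta_transpose S)"
    by (simp add: dress_sum_def sum_negf)
  finally show ?thesis .
qed

lemma dress_eq_dress_sum:
  assumes comm: "\<And>a b k l. \<lbrakk>a \<in> index_set n; b \<in> index_set n; k \<in> index_set n; l \<in> index_set n\<rbrakk> \<Longrightarrow>
      S a b * B k l = B k l * S a b"
    and "i \<in> index_set n" "j \<in> index_set n"
  shows "dress n A B S i j = dress_sum n j (\<lambda>a b. A i a * B (- j) (- b)) S"
proof -
  have "dress n A B S i j =
      (\<Sum>b\<in>index_set n. \<Sum>a\<in>index_set n. A i a * S a b * (of_int (theta b j) * B (- j) (- b)))"
    by (simp add: dress_def mat_mult_def theta_transpose_def sum_distrib_right)
  also have "\<dots> = (\<Sum>a\<in>index_set n. \<Sum>b\<in>index_set n. A i a * S a b * (of_int (theta b j) * B (- j) (- b)))"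
    by (rule sum.swap)
  also have "\<dots> = dress_sum n j (\<lambda>a b. A i a * B (- j) (- b)) S"
    unfolding dress_sum_def
  proof (intro sum.cong refl)
    fix a b assume "a \<in> index_set n" "b \<in> index_set n"
    then have "S a b * B (- j) (- b) = B (- j) (- b) * S a b" using assms by simp
    then show "A i a * S a b * (of_int (theta b j) * B (- j) (- b)) =
        of_int (theta b j) * (A i a * B (- j) (- b) * S a b)"
    proof -
      assume SB: "S a b * B (- j) (- b) = B (- j) (- b) * S a b"
      have "A i a * S a b * (of_int (theta b j) * B (- j) (- b)) =
          of_int (theta b j) * (A i a * S a b) * B (- j) (- b)"
        by (metis mult.assoc mult_of_int_commute)
      also have "\<dots> = of_int (theta b j) * (A i a * (S a b * B (- j) (- b)))"
        by (simp add: mult.assoc)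
      finally show ?thesis by (simp add: SB mult.assoc)
    qed
  qed
  finally show ?thesis .
qed

text \<open>S' and w stand for S(-u) and 1/(2u), and A, B for T(u), T(-u), whose RTT parameter is
  1/(u - (-u)) = w. The hypothesis on \<open>theta_transpose S\<close> is the symmetry relation at
  -u. Exchanging T(u) and T(-u) produces sums over the transpose of S, and the symmetry of S turns
  these back into sums over S and S'. What remains is linear algebra over the central element
  w.\<close>

lemma dress_symmetric:
  assumes w: "\<And>z. w * z = z * w" and r: "rtt n w A B"
    and comm: "\<And>i j k l. \<lbrakk>i \<in> index_set n; j \<in> index_set n; k \<in> index_set n; l \<in> index_set n\<rbrakk> \<Longrightarrow>
      S i j * A k l = A k l * S i j \<and> S i j * B k l = B k l * S i j \<and>
      S' i j * A k l = A k l * S' i j \<and> S' i j * B k l = B k l * S' i j"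
    and S: "\<And>i j. \<lbrakk>i \<in> index_set n; j \<in> index_set n\<rbrakk> \<Longrightarrow>
      theta_transpose S' i j = S i j - w * (S i j - S' i j)"
    and S': "\<And>i j. \<lbrakk>i \<in> index_set n; j \<in> index_set n\<rbrakk> \<Longrightarrow>
      theta_transpose S i j = S' i j + w * (S' i j - S i j)"
    and i: "i \<in> index_set n" and j: "j \<in> index_set n"
  shows "theta_transpose (dress n B A S') i j =
    dress n A B S i j - w * (dress n A B S i j - dress n B A S' i j)"
proof -
  let ?F = "dress_sum n j"
  let ?x = "\<lambda>a b. A i a * B (- j) (- b)" and ?y = "\<lambda>a b. B (- j) (- b) * A i a"
    and ?z = "\<lambda>a b. A (- j) (- b) * B i a" and ?w = "\<lambda>a b. B i a * A (- j) (- b)"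
  define X where "X = ?F ?x S"
  define X' where "X' = ?F ?x S'"
  define Y where "Y = ?F ?y S"
  define Y' where "Y' = ?F ?y S'"
  define Z where "Z = ?F ?z S"
  define Z' where "Z' = ?F ?z S'"
  define W' where "W' = ?F ?w S'"
  have T: "?F p (theta_transpose S') = ?F p S - w * (?F p S - ?F p S')" for p
  proof -
    have "?F p (theta_transpose S') = ?F p (\<lambda>a b. S a b - w * (S a b - S' a b))"
      by (rule dress_sum_cong) (simp_all add: S)
    then show ?thesis by (simp add: dress_sum_diff dress_sum_scale[OF w])
  qed
  have T': "?F p (theta_transpose S) = ?F p S' + w * (?F p S' - ?F p S)" for p
  proof -
    have "?F p (theta_transpose S) = ?F p (\<lambda>a b. S' a b + w * (S' a b - S a b))"
      by (rule dress_sum_cong) (simp_all add: S')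
    then show ?thesis by (simp add: dress_sum_diff dress_sum_add dress_sum_scale[OF w])
  qed
  have "dress n A B S i j = X"
    unfolding X_def by (rule dress_eq_dress_sum) (use comm i j in blast)+
  moreover have "dress n B A S' i j = W'"
    unfolding W'_def by (rule dress_eq_dress_sum) (use comm i j in blast)+
  moreover have "theta_transpose (dress n B A S') i j = Y - w * (Y - Y')"
  proof -
    have "dress n B A S' (- j) (- i) = dress_sum n (- i) (\<lambda>a b. B (- j) a * A (- (- i)) (- b)) S'"
      by (rule dress_eq_dress_sum) (use comm i j in simp_all)
    also have "\<dots> = - dress_sum n (- i) ?y (theta_transpose S')"
      using dress_sum_reflect[of "- i" n ?y S'] i by simp
    finally have "theta_transpose (dress n B A S') i j =
        - (of_int (theta i j) * dress_sum n (- i) ?y (theta_transpose S'))"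
      by (simp add: theta_transpose_def)
    also have "\<dots> = ?F ?y (theta_transpose S')"
    proof -
      have "- (of_int (theta i j) * (of_int (theta b (- i)) * t)) = of_int (theta b j) * t"
        if "b \<in> index_set n" for b and t :: 'a
      proof -
        have "theta b j = - (theta i j * theta b (- i))"
          using i j that by (auto simp: theta_def index_set_def sgn_if)
        then show ?thesis by (simp add: mult.assoc)
      qed
      then show ?thesis
        by (simp add: dress_sum_def sum_distrib_left sum_negf[symmetric])
    qed
    finally show ?thesis by (simp add: T Y_def Y'_def)
  qed
  \<comment> \<open>RTT produces products in which the summation indices have changed places.
    Reflecting them restores the order of \<open>?y\<close> and \<open>?z\<close> at the price of
    transposing U.\<close>
  moreover have D: "?F ?x U - ?F ?y U = w * (?F ?y (theta_transpose U) - ?F ?z (theta_transpose U))" for U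
  proof -
    have "?F ?x U - ?F ?y U = ?F (\<lambda>a b. ?x a b - ?y a b) U"
      by (simp add: dress_sum_diff)
    also have "\<dots> = ?F (\<lambda>a b. w * (A (- j) a * B i (- b) - B (- j) a * A i (- b))) U"
      by (rule dress_sum_cong) (use rttD(1)[OF r] i j in simp_all)
    also have "\<dots> = w * (?F (\<lambda>a b. A (- j) a * B i (- b)) U - ?F (\<lambda>a b. B (- j) a * A i (- b)) U)"
      by (simp only: dress_sum_diff dress_sum_scale[OF w])
    also have "\<dots> = w * (?F ?y (theta_transpose U) - ?F ?z (theta_transpose U))"
      using dress_sum_reflect[OF j, of ?y U] dress_sum_reflect[OF j, of ?z U] by simp
    finally show ?thesis .
  qed
  have "X - Y = w * (Y' + w * (Y' - Y) - (Z' + w * (Z' - Z)))"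
    using D[of S] by (simp only: T' X_def Y_def Y'_def Z_def Z'_def)
  moreover have "X' - Y' = w * (Y - w * (Y - Y') - (Z - w * (Z - Z')))"
    using D[of S'] by (simp only: T X'_def Y_def Y'_def Z_def Z'_def)
  \<comment> \<open>The two right-hand sides of RTT express the two commutators through the same
    products with opposite signs.\<close>
  moreover have "Z' - W' = - (X' - Y')"
  proof -
    have "Z' - W' = ?F (\<lambda>a b. ?z a b - ?w a b) S'"
      by (simp add: dress_sum_diff Z'_def W'_def)
    also have "\<dots> = ?F (\<lambda>a b. ?y a b - ?x a b) S'"
    proof (rule dress_sum_cong)
      fix a b assume ab: "a \<in> index_set n" "b \<in> index_set n"
      have "?x a b - ?y a b = w * (A (- j) a * B i (- b) - B (- j) a * A i (- b))"
        using rttD(1)[OF r] i j ab by simp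
      moreover have "?z a b - ?w a b = w * (B (- j) a * A i (- b) - A (- j) a * B i (- b))"
        using rttD(2)[OF r] i j ab by simp
      ultimately have "?z a b - ?w a b = - (?x a b - ?y a b)"
        by (simp only: right_diff_distrib minus_diff_eq)
      then show "?z a b - ?w a b = ?y a b - ?x a b" by (simp only: minus_diff_eq)
    qed simp
    also have "\<dots> = - (X' - Y')"
      by (simp add: dress_sum_diff X'_def Y'_def)
    finally show ?thesis .
  qed
  \<comment> \<open>Eliminating X and W' leaves an expression in Y, Y', Z, Z' with powers of w. The
    terms with w^2 and w^3 cancel, and Y + w (Y' - Y) is left on both sides.\<close>
  moreover have "Y - w * (Y - Y') = X - w * (X - W')"
    if "X - Y = w * (Y' + w * (Y' - Y) - (Z' + w * (Z' - Z)))"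
      "X' - Y' = w * (Y - w * (Y - Y') - (Z - w * (Z - Z')))" "Z' - W' = - (X' - Y')"
  proof -
    have eX: "X = Y + w * (Y' + w * (Y' - Y) - (Z' + w * (Z' - Z)))"
      using that(1) by (simp add: algebra_simps)
    have eW: "W' = Z' + w * (Y - w * (Y - Y') - (Z - w * (Z - Z')))"
      using that(3) unfolding that(2) by (simp add: algebra_simps)
    show ?thesis unfolding eX eW by (simp add: algebra_simps)
  qed
  ultimately show ?thesis by simp
qed



section \<open>Evaluation matrices for commuting copies of the general linear Lie algebra\<close>

text \<open>For a = 1/(u - \<beta>), b = 1/(v - \<beta>) and x = 1/(u - v), the hypothesis
  \<open>ab\<close> is the partial fraction identity. The commutator is a b times the gl bracket; on
  the right of RTT the terms with a b cancel in the difference, leaving (b - a) times the same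
  bracket.\<close>

lemma rtt_evaluation:
  fixes a b x :: "'a::ring_1"
  assumes a: "\<And>z. a * z = z * a" and b: "\<And>z. b * z = z * b" and x: "\<And>z. x * z = z * x"
    and gl: "\<And>i j k l. \<lbrakk>i \<in> index_set n; j \<in> index_set n; k \<in> index_set n; l \<in> index_set n\<rbrakk> \<Longrightarrow>
      G i j * G k l - G k l * G i j = of_bool (k = j) * G i l - of_bool (i = l) * G k j"
    and ab: "a * b = x * (b - a)"
  shows "rtt n x (\<lambda>i j. of_bool (i = j) + a * G i j) (\<lambda>i j. of_bool (i = j) + b * G i j)"
  unfolding rtt_def
proof (intro ballI conjI)
  fix i j k l assume idx: "i \<in> index_set n" "j \<in> index_set n" "k \<in> index_set n" "l \<in> index_set n"
  let ?A = "\<lambda>i j. of_bool (i = j) + a * G i j" and ?B = "\<lambda>i j. of_bool (i = j) + b * G i j"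
  have p: "(a * y) * (b * z) = a * b * (y * z)" "(b * y) * (a * z) = a * b * (y * z)" for y z
    by (metis a b mult.assoc)+
  have C: "(of_bool c + a * P) * (of_bool d + b * Q) - (of_bool d + b * Q) * (of_bool c + a * P) =
      a * b * (P * Q - Q * P)" for c d and P Q :: 'a
    by (cases c; cases d) (simp_all only: of_bool_eq distrib_left distrib_right p right_diff_distrib
        mult_1_left mult_1_right add_0_left add_diff_add add_diff_cancel_left add_diff_cancel_right
        add.assoc add.left_commute diff_self)
  have F: "(of_bool c + a * P) * (of_bool d + b * Q) - (of_bool c + b * P) * (of_bool d + a * Q) =
      (b - a) * (of_bool c * Q - of_bool d * P)" for c d and P Q :: 'a
    by (cases c; cases d) (simp_all add: distrib_left distrib_right p left_diff_distrib right_diff_distrib)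
  have D: "?A i j * ?B k l - ?B k l * ?A i j =
      x * ((b - a) * (of_bool (k = j) * G i l - of_bool (i = l) * G k j))"
    unfolding C gl[OF idx] ab by (rule mult.assoc)
  show "?A i j * ?B k l - ?B k l * ?A i j = x * (?A k j * ?B i l - ?B k j * ?A i l)"
    unfolding D F ..
  have "?B i l * ?A k j - ?A i l * ?B k j = - (?A i l * ?B k j - ?B i l * ?A k j)"
    by (rule minus_diff_eq[symmetric])
  also have "\<dots> = (b - a) * (of_bool (k = j) * G i l - of_bool (i = l) * G k j)"
    unfolding F mult_minus_right[symmetric] minus_diff_eq ..
  finally show "?A i j * ?B k l - ?B k l * ?A i j = x * (?B i l * ?A k j - ?A i l * ?B k j)"
    unfolding D by simp
qed

lemma ring_map_dress:
  assumes "ring_map f"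
  shows "dress n (\<lambda>i j. f (A i j)) (\<lambda>i j. f (B i j)) (\<lambda>i j. f (S i j)) i j = f (dress n A B S i j)"
proof -
  interpret ring_map f by fact
  show ?thesis
    by (simp add: dress_def mat_mult_def theta_transpose_def hom_simps del: of_bool)
qed

lemma ring_map_theta_transpose:
  assumes "ring_map f"
  shows "theta_transpose (\<lambda>i j. f (A i j)) i j = f (theta_transpose A i j)"
  using assms by (simp add: theta_transpose_def ring_map.mult ring_map.of_int)

lemma theta_in_subring:
  assumes "unital_subring Q"
  shows "of_int (theta i j) \<in> Q"
proof -
  note Q = unital_subringD[OF assms]
  have "theta i j = 1 \<or> theta i j = 0 \<or> theta i j = - 1"
    by (auto simp: theta_def sgn_if)
  then show ?thesis
    using Q(1,2) Q(5)[OF Q(1)] by (elim disjE) (simp_all only: of_int_0 of_int_1 of_int_minus)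
qed

lemma dress_in_subring:
  assumes Q: "unital_subring Q"
    and "\<And>i j. \<lbrakk>i \<in> index_set n; j \<in> index_set n\<rbrakk> \<Longrightarrow> A i j \<in> Q \<and> B i j \<in> Q \<and> S i j \<in> Q"
    and "i \<in> index_set n" "j \<in> index_set n"
  shows "dress n A B S i j \<in> Q"
proof -
  show ?thesis
    unfolding dress_def mat_mult_def theta_transpose_def
    by (intro unital_subring_sum[OF Q] unital_subringD(4)[OF Q] theta_in_subring[OF Q])
      (use assms in auto)
qed

section \<open>Leading coefficients at u = infinity\<close>

definition starts_with :: "'a::ring_1 \<Rightarrow> 'a fls \<Rightarrow> bool" where
  "starts_with d f \<longleftrightarrow> (\<forall>k<0. fls_nth f k = 0) \<and> fls_nth f 0 = d"

lemma starts_with_add: "starts_with d f \<Longrightarrow> starts_with e g \<Longrightarrow> starts_with (d + e) (f + g)"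
  by (simp add: starts_with_def)

lemma starts_with_sum:
  "(\<And>a. a \<in> A \<Longrightarrow> starts_with (d a) (f a)) \<Longrightarrow> starts_with (sum d A) (sum f A)"
  by (induction A rule: infinite_finite_induct) (auto intro: starts_with_add simp: starts_with_def)

lemma starts_with_mult:
  assumes "starts_with d f" "starts_with e g"
  shows "starts_with (d * e) (f * g)"
proof -
  have "fls_nth (f * g) k = (\<Sum>i\<in>{0..k}. fls_nth f i * fls_nth g (k - i))" for k
    using fls_times_nth_between[of 0 f 0 g k] assms by (simp add: starts_with_def)
  then show ?thesis using assms by (simp add: starts_with_def)
qed

lemma starts_with_dress:
  assumes "\<And>i j. starts_with (of_bool (i = j)) (A i j)" "\<And>i j. starts_with (of_bool (i = j)) (B i j)"
    "\<And>i j. starts_with (of_bool (i = j)) (S i j)" "i \<in> index_set n" "j \<in> index_set n"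
  shows "starts_with (of_bool (i = j)) (dress n A B S i j)"
proof -
  have t: "starts_with (of_int t) (of_int t)" for t
    by (simp add: starts_with_def fls_of_int_nth)
  have "starts_with (\<Sum>b\<in>index_set n. (\<Sum>a\<in>index_set n. of_bool (i = a) * of_bool (a = b)) *
      (of_int (theta b j) * of_bool (- j = - b))) (dress n A B S i j)"
    unfolding dress_def mat_mult_def theta_transpose_def
    by (intro starts_with_sum starts_with_mult t assms)
  moreover have "(\<Sum>b\<in>index_set n. (\<Sum>a\<in>index_set n. of_bool (i = a) * of_bool (a = b)) *
      (of_int (theta b j) * of_bool (- j = - b))) = (of_bool (i = j) :: 'a)"
  proof -
    have "(\<Sum>a\<in>index_set n. of_bool (i = a) * of_bool (a = b)) = (of_bool (i = b) :: 'a)" for b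
      using sum_index_delta(2)[OF assms(4), of "\<lambda>a. of_bool (a = b) :: 'a"] by simp
    moreover have "(\<Sum>b\<in>index_set n. of_bool (i = b) * (of_int (theta b j) * of_bool (- j = - b))) =
        (of_int (theta i j) * of_bool (- j = - i) :: 'a)"
      by (rule sum_index_delta(2)[OF assms(4)])
    moreover have "of_int (theta i j) * of_bool (- j = - i) = (of_bool (i = j) :: 'a)"
      using assms(4) by (auto simp: theta_def index_set_def sgn_if)
    ultimately show ?thesis by (simp only:)
  qed
  ultimately show ?thesis by simp
qed

lemma starts_with_linear_inverse:
  fixes \<beta> :: "'k::field"
  shows "starts_with 0 (1 / (fls_X_inv - fls_const \<beta>))" "starts_with 0 (1 / (- fls_X_inv - fls_const \<beta>))"
proof -
  have "fls_subdegree (fls_X_inv - fls_const \<beta>) = - 1" "fls_subdegree (- fls_X_inv - fls_const \<beta>) = - 1"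
    by (rule fls_subdegree_eqI; simp)+
  then have "fls_subdegree (inverse (fls_X_inv - fls_const \<beta>)) = 1"
    "fls_subdegree (inverse (- fls_X_inv - fls_const \<beta>)) = 1"
    by (simp_all add: fls_inverse_subdegree)
  then show "starts_with 0 (1 / (fls_X_inv - fls_const \<beta>))" "starts_with 0 (1 / (- fls_X_inv - fls_const \<beta>))"
    by (simp_all add: starts_with_def divide_inverse)
qed

lemma linear_fls_nonzero:
  fixes \<beta> :: "'k::field"
  shows "fls_X_inv - fls_const \<beta> \<noteq> 0" "- fls_X_inv - fls_const \<beta> \<noteq> 0" "fls_X_inv + fls_const \<beta> \<noteq> 0"
  by (rule fls_nonzeroI[where n = "- 1"]; simp)+

text \<open>In the ring of two variables u^{-1} is the outer and v^{-1} the inner one. A series is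
  read in u by making its coefficients constant in v; read in v it is a constant, that is,
  \<open>fls_const\<close> of it.\<close>

abbreviation eval_at_u :: "'a::zero fls \<Rightarrow> 'a fls fls" where
  "eval_at_u \<equiv> map_fls fls_const"

lemma ring_map_eval_at_u: "ring_map (eval_at_u :: 'a::ring_1 fls \<Rightarrow> 'a fls fls)"
  by (rule ring_map_map_fls[OF ring_map_fls_const])

section \<open>Dressing by commuting copies of gl(2n)\<close>

locale gl_copies = scalar_map \<kappa> for \<kappa> :: "'k::field \<Rightarrow> 'r::ring_1" +
  fixes n :: nat and E :: "nat \<Rightarrow> int \<Rightarrow> int \<Rightarrow> 'r" and \<beta> :: "nat \<Rightarrow> 'k"
  assumes gl: "\<lbrakk>i \<in> index_set n; j \<in> index_set n; k \<in> index_set n; l \<in> index_set n\<rbrakk> \<Longrightarrow>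
      E m i j * E m k l - E m k l * E m i j = of_bool (k = j) * E m i l - of_bool (i = l) * E m k j"
    and copies_commute:
      "\<lbrakk>m \<noteq> m'; i \<in> index_set n; j \<in> index_set n; k \<in> index_set n; l \<in> index_set n\<rbrakk> \<Longrightarrow>
      E m i j * E m' k l = E m' k l * E m i j"
    and two_nonzero: "(2 :: 'k) \<noteq> 0"
begin

abbreviation series :: "'k fls \<Rightarrow> 'r fls" where
  "series \<equiv> map_fls \<kappa>"

abbreviation series2 :: "'k fls fls \<Rightarrow> 'r fls fls" where
  "series2 \<equiv> map_fls series"

lemma ring_map_series: "ring_map series"
  by (rule ring_map_map_fls) (rule ring_map_axioms)

lemma ring_map_series2: "ring_map series2"
  by (rule ring_map_map_fls) (rule ring_map_series)

lemma series_central: "series c * x = x * series c"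
  by (rule fls_commute) (simp add: fls_nth_map_fls zero central)

lemma series2_central: "series2 c * x = x * series2 c"
  by (rule fls_commute) (simp add: fls_nth_map_fls ring_map.zero[OF ring_map_series] series_central)

lemma eval_at_u_series: "eval_at_u (series c) = series2 (eval_at_u c)"
proof -
  have z: "series 0 = 0" by (rule ring_map.zero[OF ring_map_series])
  show ?thesis
    by (rule fls_eqI) (simp add: fls_nth_map_fls zero z map_fls_const)
qed

lemma eval_at_v_series: "fls_const (series c) = series2 (fls_const c)"
  using map_fls_const[of series c] ring_map.zero[OF ring_map_series] by simp

definition ev :: "nat \<Rightarrow> 'k fls \<Rightarrow> int \<Rightarrow> int \<Rightarrow> 'r fls" where
  "ev m c i j = of_bool (i = j) + series c * fls_const (E m i j)"

definition ev2 :: "nat \<Rightarrow> 'k fls fls \<Rightarrow> int \<Rightarrow> int \<Rightarrow> 'r fls fls" where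
  "ev2 m c i j = of_bool (i = j) + series2 c * fls_const (fls_const (E m i j))"

lemma eval_at_u_ev: "eval_at_u (ev m c i j) = ev2 m (eval_at_u c) i j"
proof -
  interpret u: ring_map "eval_at_u :: 'r fls \<Rightarrow> 'r fls fls" by (rule ring_map_eval_at_u)
  show ?thesis
    by (simp add: ev_def ev2_def u.add u.mult u.of_bool eval_at_u_series map_fls_const del: of_bool)
qed

lemma eval_at_v_ev: "fls_const (ev m c i j) = ev2 m (fls_const c) i j"
proof -
  interpret v: ring_map "fls_const :: 'r fls \<Rightarrow> 'r fls fls" by (rule ring_map_fls_const)
  show ?thesis
    unfolding ev_def ev2_def v.add v.mult v.of_bool eval_at_v_series ..
qed

text \<open>Stated for any central embedding \<open>f\<close> of the scalars and any embedding
  \<open>C\<close> of the operators, so that one argument covers one variable, for the symmetry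
  relation, and two, for the reflection equation.\<close>

lemma rtt_image:
  assumes "ring_map f" and central: "\<And>c z. f c * z = z * f c" and "ring_map C"
    and ab: "a * b = x * (b - a)"
  shows "rtt n (f x) (\<lambda>i j. of_bool (i = j) + f a * C (E m i j)) (\<lambda>i j. of_bool (i = j) + f b * C (E m i j))"
proof (rule rtt_evaluation[OF central central central])
  interpret C: ring_map C by fact
  fix i j k l assume "i \<in> index_set n" "j \<in> index_set n" "k \<in> index_set n" "l \<in> index_set n"
  then show "C (E m i j) * C (E m k l) - C (E m k l) * C (E m i j) =
      of_bool (k = j) * C (E m i l) - of_bool (i = l) * C (E m k j)"
    using arg_cong[OF gl, of i j k l C m] by (simp only: C.diff C.mult C.of_bool)
next
  interpret f: ring_map f by fact
  show "f a * f b = f x * (f b - f a)"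
    using arg_cong[OF ab, of f] by (simp only: f.mult f.diff)
qed

lemma rtt_ev: "a * b = x * (b - a) \<Longrightarrow> rtt n (series x) (ev m a) (ev m b)"
  unfolding ev_def[abs_def]
  by (rule rtt_image[OF ring_map_series series_central ring_map_fls_const])

lemma rtt_ev2: "a * b = x * (b - a) \<Longrightarrow> rtt n (series2 x) (ev2 m a) (ev2 m b)"
  unfolding ev2_def[abs_def]
  by (rule rtt_image[OF ring_map_series2 series2_central
        ring_map_comp[OF ring_map_fls_const ring_map_fls_const]])

lemma fls_flip_ev: "fls_flip (ev m c i j) = ev m (fls_flip c) i j"
proof -
  interpret F: ring_map "fls_flip :: 'r fls \<Rightarrow> 'r fls" by (rule ring_map_fls_flip)
  show ?thesis
    by (simp add: ev_def F.add F.mult F.of_bool map_fls_flip[OF ring_map_axioms] fls_flip_const del: of_bool)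
qed

abbreviation pole :: "nat \<Rightarrow> 'k fls" where
  "pole m \<equiv> 1 / (fls_X_inv - fls_const (\<beta> m))"

abbreviation neg_pole :: "nat \<Rightarrow> 'k fls" where
  "neg_pole m \<equiv> 1 / (- fls_X_inv - fls_const (\<beta> m))"

lemma flip_pole: "fls_flip (pole m) = neg_pole m" "fls_flip (neg_pole m) = pole m"
proof -
  interpret F: ring_map "fls_flip :: 'k fls \<Rightarrow> 'k fls" by (rule ring_map_fls_flip)
  show "fls_flip (pole m) = neg_pole m" "fls_flip (neg_pole m) = pole m"
    by (simp_all add: ring_map_divide[OF ring_map_fls_flip] F.diff F.one F.uminus fls_flip_X_inv fls_flip_const)
qed

text \<open>The newest copy is placed outermost, so the inner matrix involves only earlier copies
  and commutes entrywise with the new factors, as dressing demands.\<close>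

primrec dressed :: "nat \<Rightarrow> int \<Rightarrow> int \<Rightarrow> 'r fls" where
  "dressed 0 = (\<lambda>i j. of_bool (i = j))"
| "dressed (Suc m) = dress n (ev m (pole m)) (ev m (neg_pole m)) (dressed m)"

text \<open>Serves two subrings: the centralizer of an entry of a later copy, and the operators that
  preserve a finite-dimensional part of Fock space.\<close>

lemma dressed_over:
  assumes "unital_subring Q" "\<And>c. \<kappa> c \<in> Q"
    and "\<And>m i j. \<lbrakk>m < M; i \<in> index_set n; j \<in> index_set n\<rbrakk> \<Longrightarrow> E m i j \<in> Q"
    and "m \<le> M" "i \<in> index_set n" "j \<in> index_set n"
  shows "dressed m i j \<in> fls_over Q"
  using assms(4-6)
proof (induction m arbitrary: i j)
  note Q = unital_subringD[OF unital_subring_fls_over[OF assms(1)]]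
  case 0
  then show ?case using Q(1,2) by simp
next
  note Q = unital_subringD[OF unital_subring_fls_over[OF assms(1)]]
  case (Suc m)
  have "ev m c a b \<in> fls_over Q" if "a \<in> index_set n" "b \<in> index_set n" for a b c
  proof -
    have "series c \<in> fls_over Q" using assms(2) by (simp add: fls_over_def fls_nth_map_fls zero)
    moreover have "fls_const (E m a b) \<in> fls_over Q"
      using assms(3)[of m a b] that Suc.prems unital_subringD(2)[OF assms(1)]
      by (simp add: fls_over_def)
    ultimately show ?thesis unfolding ev_def using Q(1,2) by (intro Q(6) Q(4)) auto
  qed
  then show ?case
    using Suc by (auto intro!: dress_in_subring unital_subring_fls_over assms(1))
qed

lemma dressed_commutes:
  assumes "m \<le> m'" "i \<in> index_set n" "j \<in> index_set n" "k \<in> index_set n" "l \<in> index_set n"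
  shows "fls_nth (dressed m i j) q * E m' k l = E m' k l * fls_nth (dressed m i j) q"
proof -
  \<comment> \<open>The centralizer of a single operator is a unital subring; it contains the
    scalars and all earlier copies.\<close>
  let ?Q = "{x. x * E m' k l = E m' k l * x}"
  have "dressed m i j \<in> fls_over ?Q"
  proof (rule dressed_over[of ?Q m])
    have "x * y * E m' k l = E m' k l * (x * y)"
      if "x * E m' k l = E m' k l * x" "y * E m' k l = E m' k l * y" for x y
      using that by (metis mult.assoc)
    then show "unital_subring ?Q"
      by (auto simp: unital_subring_def algebra_simps)
  qed (use assms copies_commute central in auto)
  then show ?thesis by (simp add: fls_over_def)
qed

lemma ev_commutes:
  assumes "\<And>q. fls_nth f q * E m k l = E m k l * fls_nth f q"
  shows "f * ev m c k l = ev m c k l * f"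
proof -
  have f: "fls_const (E m k l) * f = f * fls_const (E m k l)"
    by (rule fls_const_commutes) (simp add: assms)
  have "f * (series c * fls_const (E m k l)) = series c * fls_const (E m k l) * f"
    by (metis f mult.assoc series_central)
  then show ?thesis by (simp add: ev_def distrib_left distrib_right)
qed

lemma ev2_commutes:
  assumes "\<And>q. fls_nth f q * E m k l = E m k l * fls_nth f q"
  shows "eval_at_u f * ev2 m c k l = ev2 m c k l * eval_at_u f"
    and "fls_const f * ev2 m c k l = ev2 m c k l * fls_const f"
proof -
  have 1: "fls_const (E m k l) * f = f * fls_const (E m k l)"
    by (rule fls_const_commutes) (simp add: assms)
  have *: "F * ev2 m c k l = ev2 m c k l * F"
    if "fls_const (fls_const (E m k l)) * F = F * fls_const (fls_const (E m k l))" for F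
  proof -
    have "F * (series2 c * fls_const (fls_const (E m k l))) = series2 c * fls_const (fls_const (E m k l)) * F"
      by (metis that mult.assoc series2_central)
    then show ?thesis by (simp add: ev2_def distrib_left distrib_right)
  qed
  show "eval_at_u f * ev2 m c k l = ev2 m c k l * eval_at_u f"
    by (rule *, rule fls_const_commutes) (simp add: fls_nth_map_fls assms)
  show "fls_const f * ev2 m c k l = ev2 m c k l * fls_const f"
    by (rule *) (simp add: 1)
qed

text \<open>\<open>starts_with_dress\<close> asks for its premises at all integers, while a dressed
  matrix has the identity as leading term only on the index range: outside it the sums that define
  the product vanish to leading order. The induction therefore carries an auxiliary matrix,
  continued by the identity outside the range.\<close>

lemma starts_with_dressed:
  assumes "i \<in> index_set n" "j \<in> index_set n"
  shows "starts_with (of_bool (i = j)) (dressed m i j)"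
proof -
  have "\<exists>S. (\<forall>i j. starts_with (of_bool (i = j)) (S i j)) \<and>
      (\<forall>i\<in>index_set n. \<forall>j\<in>index_set n. S i j = dressed m i j)"
  proof (induction m)
    case 0
    show ?case by (rule exI[of _ "dressed 0"]) (simp add: starts_with_def)
  next
    case (Suc m)
    then obtain S where S: "\<And>i j. starts_with (of_bool (i = j)) (S i j)"
      "\<And>i j. i \<in> index_set n \<Longrightarrow> j \<in> index_set n \<Longrightarrow> S i j = dressed m i j" by blast
    have ev: "starts_with (of_bool (i = j)) (ev m c i j)" if "starts_with 0 c" for c i j
    proof -
      have "starts_with (0 * E m i j) (series c * fls_const (E m i j))"
        by (rule starts_with_mult) (use that in \<open>auto simp: starts_with_def fls_nth_map_fls zero\<close>)
      moreover have "starts_with (of_bool (i = j)) (of_bool (i = j) :: 'r fls)"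
        by (simp add: starts_with_def)
      ultimately show ?thesis
        unfolding ev_def using starts_with_add[of "of_bool (i = j)" _ "0 * E m i j"] by simp
    qed
    let ?S = "\<lambda>i j. if i \<in> index_set n \<and> j \<in> index_set n then dressed (Suc m) i j else of_bool (i = j)"
    have "dressed (Suc m) i j = dress n (ev m (pole m)) (ev m (neg_pole m)) S i j"
      if "i \<in> index_set n" "j \<in> index_set n" for i j
      using S(2) that by (simp add: dress_def mat_mult_def)
    moreover have "starts_with (of_bool (i = j)) (dress n (ev m (pole m)) (ev m (neg_pole m)) S i j)"
      if "i \<in> index_set n" "j \<in> index_set n" for i j
      by (intro starts_with_dress ev starts_with_linear_inverse S that)
    ultimately have c: "starts_with (of_bool (i = j)) (dressed (Suc m) i j)"
      if "i \<in> index_set n" "j \<in> index_set n" for i j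
      using that by metis
    show ?case
    proof (intro exI[of _ ?S] conjI allI ballI)
      fix i j :: int
      have "starts_with (of_bool (i = j)) (of_bool (i = j) :: 'r fls)"
        by (simp add: starts_with_def)
      then show "starts_with (of_bool (i = j)) (?S i j)"
        using c by (simp del: dressed.simps)
    qed (simp del: dressed.simps)
  qed
  then show ?thesis using assms by metis
qed

lemma dressed_symmetric:
  assumes "i \<in> index_set n" "j \<in> index_set n"
  shows "theta_transpose (\<lambda>i j. fls_flip (dressed m i j)) i j =
    dressed m i j - series (1 / (2 * fls_X_inv)) * (dressed m i j - fls_flip (dressed m i j))"
  using assms
proof (induction m arbitrary: i j)
  case 0
  interpret F: ring_map "fls_flip :: 'r fls \<Rightarrow> 'r fls" by (rule ring_map_fls_flip)
  show ?case
    using 0 by (auto simp: theta_transpose_def F.one F.zero theta_def index_set_def sgn_if)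
next
  case (Suc m)
  interpret F: ring_map "fls_flip :: 'r fls \<Rightarrow> 'r fls" by (rule ring_map_fls_flip)
  interpret FK: ring_map "fls_flip :: 'k fls \<Rightarrow> 'k fls" by (rule ring_map_fls_flip)
  interpret K: ring_map series by (rule ring_map_series)
  let ?w = "series (1 / (2 * fls_X_inv))"
  let ?A = "ev m (pole m)" and ?B = "ev m (neg_pole m)"
  let ?S = "dressed m" and ?S' = "\<lambda>i j. fls_flip (dressed m i j)"
  \<comment> \<open>The relation divides by 2u, which is nonzero because 2 is.\<close>
  have X: "2 * fls_X_inv \<noteq> (0 :: 'k fls)"
    by (rule fls_nonzeroI[where n = "- 1"]) (simp add: two_nonzero)
  have w: "fls_flip ?w = - ?w"
  proof -
    have "fls_flip (1 / (2 * fls_X_inv)) = - (1 / (2 * fls_X_inv) :: 'k fls)"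
    proof -
      have "fls_flip (2 * fls_X_inv) = - (2 * fls_X_inv :: 'k fls)"
        by (rule fls_eqI) (simp add: fls_nth_flip)
      then show ?thesis
        by (simp only: ring_map_divide[OF ring_map_fls_flip] FK.one minus_divide_right)
    qed
    then show ?thesis by (simp add: map_fls_flip[OF ring_map_axioms, symmetric] K.uminus)
  qed
  have r: "rtt n ?w ?A ?B"
  proof (rule rtt_ev)
    show "pole m * neg_pole m = 1 / (2 * fls_X_inv) * (neg_pole m - pole m)"
      using linear_fls_nonzero[of "\<beta> m"] X by (simp add: field_simps)
  qed
  have comm: "?S i j * ?A k l = ?A k l * ?S i j \<and> ?S i j * ?B k l = ?B k l * ?S i j \<and>
      ?S' i j * ?A k l = ?A k l * ?S' i j \<and> ?S' i j * ?B k l = ?B k l * ?S' i j"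
    if "i \<in> index_set n" "j \<in> index_set n" "k \<in> index_set n" "l \<in> index_set n" for i j k l
  proof -
    note c = dressed_commutes[OF order_refl that]
    have c': "fls_nth (?S' i j) q * E m k l = E m k l * fls_nth (?S' i j) q" for q
      using c by (simp add: fls_nth_flip)
    show ?thesis using ev_commutes[OF c] ev_commutes[OF c'] by blast
  qed
  \<comment> \<open>This is the induction hypothesis at -u: flipping changes the sign of 1/(2u) and
    exchanges S(u) with S(-u).\<close>
  have S': "theta_transpose ?S i j = ?S' i j + ?w * (?S' i j - ?S i j)"
    if "i \<in> index_set n" "j \<in> index_set n" for i j
    using arg_cong[OF Suc.IH[OF that], of fls_flip]
    by (simp add: ring_map_theta_transpose[OF ring_map_fls_flip, symmetric] fls_flip_flip F.diff F.mult w)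
  have flip: "fls_flip (dressed (Suc m) i j) = dress n ?B ?A ?S' i j" for i j
    using ring_map_dress[OF ring_map_fls_flip, of n ?A ?B ?S i j]
    by (simp add: fls_flip_ev flip_pole)
  show ?case
    unfolding flip unfolding dressed.simps
    using dress_symmetric[OF series_central r comm Suc.IH S' Suc.prems] by simp
qed

text \<open>For S = 1 the equation says that R and R' commute, which follows from P P' = P' P = -
  P'.\<close>

lemma reflection_eq_one: "reflection_eq n (series2 x) (series2 y) (\<lambda>i j. of_bool (i = j)) (\<lambda>i j. of_bool (i = j))"
proof -
  let ?d = "\<lambda>i j::int. of_bool (i = j) :: 'r fls fls"
  have 1: "tensor_mult n X (leg1 n ?d) = X" "tensor_mult n X (leg2 n ?d) = X" "tensor_mult n (leg2 n ?d) X = X"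
    if X: "restrict_mat n X = X" for X
    by (rule restricted_eqI[of n];
        use X in \<open>simp add: restrict_tensor_mult tensor_mult_leg sum_index_delta\<close>)+
  have "tensor_mult n (R_scaled n (series2 x)) (R'_scaled n (series2 y)) =
      tensor_mult n (R'_scaled n (series2 y)) (R_scaled n (series2 x))"
    (is "?L = ?R")
  proof (rule restricted_eqI[of n])
    fix i j k l assume "i \<in> index_set n" "j \<in> index_set n" "k \<in> index_set n" "l \<in> index_set n"
    then show "?L (i, k) (j, l) = ?R (i, k) (j, l)"
      by (simp add: tensor_mult_R_scaled[OF _ _ _ _ series2_central] R'_scaled_def restrict_mat_def
          id_mat_def prime1_def perm_mat_def theta_def sgn_minus)
  qed (simp_all add: restrict_tensor_mult)
  then show ?thesis
    by (simp add: reflection_eq_def 1 restrict_tensor_mult)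
qed

lemma dressed_reflection:
  "reflection_eq n (series2 (1 / (u_var - v_var))) (series2 (1 / (- u_var - v_var)))
     (\<lambda>i j. eval_at_u (dressed m i j)) (\<lambda>i j. fls_const (dressed m i j))"
proof (induction m)
  case 0
  have "eval_at_u (of_bool c) = (of_bool c :: 'r fls fls)" "fls_const (of_bool c) = (of_bool c :: 'r fls fls)"
    for c
    by (rule ring_map.of_bool[OF ring_map_eval_at_u] ring_map.of_bool[OF ring_map_fls_const])+
  then show ?case using reflection_eq_one by simp
next
  case (Suc m)
  let ?b = "fls_const (fls_const (\<beta> m)) :: 'k fls fls"
  interpret u: ring_map "eval_at_u :: 'k fls \<Rightarrow> 'k fls fls" by (rule ring_map_eval_at_u)
  interpret v: ring_map "fls_const :: 'k fls \<Rightarrow> 'k fls fls" by (rule ring_map_fls_const)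
  interpret K: ring_map series2 by (rule ring_map_series2)
  have uX: "eval_at_u fls_X_inv = (u_var :: 'k fls fls)"
    by (simp add: u_var_def map_fls_X_inv)
  have up: "eval_at_u (pole m) = 1 / (u_var - ?b)" "eval_at_u (neg_pole m) = 1 / (- u_var - ?b)"
    by (simp_all add: ring_map_divide[OF ring_map_eval_at_u] u.diff u.uminus u.one uX map_fls_const)
  have vp: "fls_const (pole m) = 1 / (v_var - ?b)" "fls_const (neg_pole m) = 1 / (- v_var - ?b)"
    by (simp_all add: ring_map_divide[OF ring_map_fls_const] v.diff v.uminus v.one v_var_def)
  \<comment> \<open>All of these have coefficient 1 or -1 at u. The denominators in v alone are
    constants with respect to u and are reduced to the case of one variable below.\<close>
  have nz: "u_var - ?b \<noteq> 0" "- u_var - ?b \<noteq> 0" "u_var + ?b \<noteq> 0"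
    "u_var - v_var \<noteq> (0 :: 'k fls fls)" "- u_var - v_var \<noteq> (0 :: 'k fls fls)" "u_var + v_var \<noteq> (0 :: 'k fls fls)"
    by (rule fls_nonzeroI[where n = "- 1"]; simp add: u_var_def v_var_def)+
  have c0: "fls_const f \<noteq> 0" if "f \<noteq> 0" for f :: "'k fls"
    using that by (metis fls_const_nth fls_zero_nth)
  have "v_var - ?b = fls_const (fls_X_inv - fls_const (\<beta> m))"
    "- v_var - ?b = fls_const (- fls_X_inv - fls_const (\<beta> m))"
    "v_var + ?b = fls_const (fls_X_inv + fls_const (\<beta> m))"
    by (simp_all only: v_var_def v.diff v.add v.uminus)
  then have vnz: "v_var - ?b \<noteq> 0" "- v_var - ?b \<noteq> 0" "v_var + ?b \<noteq> 0"
    by (simp_all only: c0 linear_fls_nonzero not_False_eq_True)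
  let ?x = "1 / (u_var - v_var) :: 'k fls fls" and ?y = "1 / (- u_var - v_var) :: 'k fls fls"
  let ?A1 = "ev2 m (1 / (u_var - ?b))" and ?B1 = "ev2 m (1 / (- u_var - ?b))"
    and ?A2 = "ev2 m (1 / (v_var - ?b))" and ?B2 = "ev2 m (1 / (- v_var - ?b))"
  have "reflection_eq n (series2 ?x) (series2 ?y)
     (dress n ?A1 ?B1 (\<lambda>i j. eval_at_u (dressed m i j))) (dress n ?A2 ?B2 (\<lambda>i j. fls_const (dressed m i j)))"
  proof (rule reflection_eq_dress[OF series2_central series2_central _ _ _ _ _ Suc.IH])
    show "rtt n (series2 ?x) ?A1 ?A2"
      by (rule rtt_ev2) (use nz vnz in \<open>simp add: field_simps\<close>)
    show "rtt n (series2 ?y) ?B1 ?A2"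
      by (rule rtt_ev2) (use nz vnz in \<open>simp add: divide_simps\<close>)
    have "rtt n (series2 (- ?x)) ?B1 ?B2"
      by (rule rtt_ev2) (use nz vnz in \<open>simp add: divide_simps\<close>)
    then show "rtt n (- series2 ?x) ?B1 ?B2" by (simp add: K.uminus)
    have "rtt n (series2 (- ?y)) ?A1 ?B2"
      by (rule rtt_ev2) (use nz vnz in \<open>simp add: divide_simps\<close>)
    then show "rtt n (- series2 ?y) ?A1 ?B2" by (simp add: K.uminus)
    fix i j k l assume i: "i \<in> index_set n" "j \<in> index_set n" "k \<in> index_set n" "l \<in> index_set n"
    note c = ev2_commutes[OF dressed_commutes[OF order_refl i]]
    show "eval_at_u (dressed m i j) * ?A2 k l = ?A2 k l * eval_at_u (dressed m i j) \<and>
        eval_at_u (dressed m i j) * ?B2 k l = ?B2 k l * eval_at_u (dressed m i j) \<and>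
        fls_const (dressed m i j) * ?A1 k l = ?A1 k l * fls_const (dressed m i j) \<and>
        fls_const (dressed m i j) * ?B1 k l = ?B1 k l * fls_const (dressed m i j)"
      using c by blast
  qed
  moreover have "dress n ?A1 ?B1 (\<lambda>i j. eval_at_u (dressed m i j)) = (\<lambda>i j. eval_at_u (dressed (Suc m) i j))"
    by (intro ext) (simp add: ring_map_dress[OF ring_map_eval_at_u, symmetric] eval_at_u_ev up)
  moreover have "dress n ?A2 ?B2 (\<lambda>i j. fls_const (dressed m i j)) = (\<lambda>i j. fls_const (dressed (Suc m) i j))"
    by (intro ext) (simp add: ring_map_dress[OF ring_map_fls_const, symmetric] eval_at_v_ev vp)
  ultimately show ?case by simp
qed

end



section \<open>The defining relations under evaluation\<close>

lemma carrier_free_alg: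
  "f \<in> carrier (free_alg n) \<longleftrightarrow>
     (\<forall>w\<in>Poly_Mapping.keys f. set (letters w) \<subseteq> index_set n \<times> index_set n \<times> {1..})"
  by (simp add: free_alg_def)

lemma free_alg_simps [simp]:
  "mult (free_alg n) = (*)" "one (free_alg n) = 1" "zero (free_alg n) = 0" "add (free_alg n) = (+)"
  by (simp_all add: free_alg_def)

lemma unital_subring_free_alg: "unital_subring (carrier (free_alg n))"
  unfolding unital_subring_def
proof (intro conjI ballI)
  show "1 \<in> carrier (free_alg n)"
    by (simp add: carrier_free_alg zero_fword_def)
  fix f g :: "'a falg" assume fg: "f \<in> carrier (free_alg n)" "g \<in> carrier (free_alg n)"
  show "f - g \<in> carrier (free_alg n)"
    using fg keys_diff[of f g] by (auto simp: carrier_free_alg)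
  show "f * g \<in> carrier (free_alg n)"
    unfolding carrier_free_alg
  proof
    fix w assume "w \<in> Poly_Mapping.keys (f * g)"
    then obtain a b where "a \<in> Poly_Mapping.keys f" "b \<in> Poly_Mapping.keys g" "w = a + b"
      using keys_mult[of f g] by blast
    then show "set (letters w) \<subseteq> index_set n \<times> index_set n \<times> {1..}"
      using fg by (auto simp: carrier_free_alg plus_fword_def)
  qed
qed

lemmas free_alg_closed = unital_subringD[OF unital_subring_free_alg]

lemma scal_in_free_alg: "scal c \<in> carrier (free_alg n)"
  by (simp add: carrier_free_alg scal_def zero_fword_def)

lemma gen_s_in_free_alg:
  "i \<in> index_set n \<Longrightarrow> j \<in> index_set n \<Longrightarrow> gen_s i j r \<in> carrier (free_alg n)"
  using free_alg_closed(1,2)[of n] by (auto simp: gen_s_def carrier_free_alg)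

lemma ring_free_alg: "ring (free_alg n)"
proof (rule ringI)
  show "abelian_group (free_alg n)"
  proof (rule abelian_groupI)
    fix x assume "x \<in> carrier (free_alg n)"
    then show "\<exists>y\<in>carrier (free_alg n). y \<oplus>\<^bsub>free_alg n\<^esub> x = \<zero>\<^bsub>free_alg n\<^esub>"
      by (intro bexI[of _ "- x"]) (simp_all add: free_alg_closed)
  qed (simp_all add: free_alg_closed add.assoc add.commute)
  show "Group.monoid (free_alg n)"
    by (rule monoidI) (simp_all add: free_alg_closed mult.assoc)
qed (simp_all add: distrib_left distrib_right)

lemma tensor_mult_in_subring:
  assumes "unital_subring Q"
    and "\<And>L. L \<in> index_set n \<times> index_set n \<Longrightarrow> X I L \<in> Q \<and> Y L J \<in> Q"
  shows "tensor_mult n X Y I J \<in> Q"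
  unfolding tensor_mult_def
  by (intro unital_subring_sum[OF assms(1)] unital_subringD(4)[OF assms(1)]) (use assms(2) in auto)

text \<open>Membership in the carrier is a premise for working with the generated ideal. Series over
  a subring form a subring, so every operation that builds the two sides stays inside.\<close>

lemma reflection_relations_carrier:
  "(reflection_relations n :: 'k::field falg set) \<subseteq> carrier (free_alg n)"
proof -
  let ?Q = "fls_over (fls_over (carrier (free_alg n))) :: 'k falg fls fls set"
  have Q: "unital_subring ?Q"
    by (intro unital_subring_fls_over unital_subring_free_alg)
  note Q' = unital_subringD[OF Q]
  have z: "map_fls scal 0 = (0 :: 'k falg fls)" "scal 0 = (0 :: 'k falg)"
    by (rule fls_eqI; simp add: fls_nth_map_fls scal_def) (simp add: scal_def)
  have scal: "scal_mat X I J \<in> ?Q" for X :: "'k fls fls tensor_mat" and I J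
    by (simp add: scal_mat_def fls_over_def fls_nth_map_fls z scal_in_free_alg)
  have S1: "S1_u I J \<in> ?Q" and S2: "S2_v I J \<in> ?Q"
    if "I \<in> index_set n \<times> index_set n" "J \<in> index_set n \<times> index_set n" for I J
    using that Q'(1,2) unfolding S1_u_def S2_v_def
    by (auto split: prod.splits intro!: Q'(4)
        simp: fls_over_def free_alg_closed(2) gen_s_in_free_alg)
  have "reflection_lhs n I J - reflection_rhs n I J \<in> ?Q"
    if "I \<in> index_set n \<times> index_set n" "J \<in> index_set n \<times> index_set n" for I J
    unfolding reflection_lhs_def reflection_rhs_def
    by (intro Q'(3) tensor_mult_in_subring[OF Q] conjI scal S1 S2 that)
  then show ?thesis by (fastforce simp: reflection_relations_def fls_over_def)
qed

lemma s_neg_eq_flip: "s_neg i j = fls_flip (s_pos i j)"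
  by (simp add: s_neg_def s_pos_def fps_to_fls_compose_uminus_X)

lemma symmetry_relations_carrier:
  "(symmetry_relations n :: 'k::field falg set) \<subseteq> carrier (free_alg n)"
proof -
  let ?Q = "fls_over (carrier (free_alg n)) :: 'k falg fls set"
  have Q: "unital_subring ?Q"
    by (intro unital_subring_fls_over unital_subring_free_alg)
  note Q' = unital_subringD[OF Q]
  have pos: "s_pos i j \<in> ?Q" and neg: "s_neg i j \<in> ?Q"
    if "i \<in> index_set n" "j \<in> index_set n" for i j
    using that by (auto simp: s_neg_eq_flip s_pos_def fls_over_def fls_nth_flip free_alg_closed gen_s_in_free_alg)
  have z: "scal 0 = (0 :: 'k falg)" by (simp add: scal_def)
  have w: "map_fls scal c \<in> ?Q" for c :: "'k fls"
    by (simp add: fls_over_def fls_nth_map_fls z scal_in_free_alg)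
  have "of_int (theta i j) * s_neg (- j) (- i)
        - (s_pos i j - map_fls scal (1 / (2 * fls_X_inv)) * (s_pos i j - s_neg i j)) \<in> ?Q"
    if "i \<in> index_set n" "j \<in> index_set n" for i j
    using that by (intro Q'(3) Q'(4) theta_in_subring[OF Q] w pos neg) auto
  then show ?thesis by (auto simp: symmetry_relations_def fls_over_def)
qed

lemma ideal_yangian_ideal: "ideal (yangian_ideal n) (free_alg n)"
  unfolding yangian_ideal_def
  by (intro ring.genideal_ideal[OF ring_free_alg] Un_least reflection_relations_carrier
      symmetry_relations_carrier)

section \<open>Evaluation of the generators at a dressed matrix\<close>

context gl_copies
begin

definition dressed_eval :: "nat \<Rightarrow> 'k falg \<Rightarrow> 'r" where
  "dressed_eval M = falg_eval \<kappa> (\<lambda>(i, j, r). fls_nth (dressed M i j) (int r))"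

lemma ring_map_dressed_eval: "ring_map (dressed_eval M)"
  unfolding dressed_eval_def by (rule ring_map_falg_eval)

lemma dressed_eval_scal: "dressed_eval M (scal c) = \<kappa> c"
  unfolding dressed_eval_def by (rule falg_eval_scal)

text \<open>For r = 0, where \<open>gen_s\<close> is a constant and not a letter, the two sides
  agree because a dressed matrix starts with the identity.\<close>

lemma dressed_eval_gen_s:
  assumes "i \<in> index_set n" "j \<in> index_set n"
  shows "dressed_eval M (gen_s i j r) = fls_nth (dressed M i j) (int r)"
  using starts_with_dressed[OF assms, of M]
  by (auto simp: dressed_eval_def falg_eval_gen_s starts_with_def)

lemma map_fls_dressed_eval_scal: "map_fls (dressed_eval M) (map_fls scal c) = series c"
proof -
  interpret ring_map "dressed_eval M" by (rule ring_map_dressed_eval)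
  have "scal 0 = (0 :: 'k falg)" by (simp add: scal_def)
  then show ?thesis
    by (simp add: map_fls_map_fls zero dressed_eval_scal)
qed

lemma map_fls_dressed_eval_s:
  assumes "i \<in> index_set n" "j \<in> index_set n"
  shows "map_fls (dressed_eval M) (s_pos i j) = dressed M i j"
proof (rule fls_eqI)
  interpret e: ring_map "dressed_eval M" by (rule ring_map_dressed_eval)
  fix k
  show "fls_nth (map_fls (dressed_eval M) (s_pos i j)) k = fls_nth (dressed M i j) k"
    using starts_with_dressed[OF assms, of M]
    by (cases "k < 0")
      (auto simp: fls_nth_map_fls e.zero s_pos_def dressed_eval_gen_s[OF assms] starts_with_def)
qed

lemma dressed_eval_symmetry:
  assumes "f \<in> symmetry_relations n"
  shows "dressed_eval M f = 0"
proof -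
  interpret e: ring_map "dressed_eval M" by (rule ring_map_dressed_eval)
  interpret m: ring_map "map_fls (dressed_eval M)" by (rule ring_map_map_fls[OF ring_map_dressed_eval])
  obtain i j a where f: "f = fls_nth (of_int (theta i j) * s_neg (- j) (- i)
      - (s_pos i j - map_fls scal (1 / (2 * fls_X_inv)) * (s_pos i j - s_neg i j))) a"
    and ij: "i \<in> index_set n" "j \<in> index_set n"
    using assms by (auto simp: symmetry_relations_def)
  have "dressed_eval M f = fls_nth (map_fls (dressed_eval M) (of_int (theta i j) * s_neg (- j) (- i)
      - (s_pos i j - map_fls scal (1 / (2 * fls_X_inv)) * (s_pos i j - s_neg i j)))) a"
    by (simp add: f fls_nth_map_fls e.zero)
  also have "\<dots> = 0"
    using dressed_symmetric[OF ij, of M] ij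
    by (simp add: m.diff m.mult m.of_int map_fls_dressed_eval_scal s_neg_eq_flip
        map_fls_flip[OF ring_map_dressed_eval] map_fls_dressed_eval_s theta_transpose_def
        del: fls_minus_nth)
  finally show ?thesis .
qed

text \<open>Applied to coefficients, evaluation is a ring homomorphism on the series in two
  variables. After restriction to the index range it carries each factor of the defining relation to
  the corresponding factor for the dressed matrix.\<close>

lemma dressed_eval_reflection:
  assumes "f \<in> reflection_relations n"
  shows "dressed_eval M f = 0"
proof -
  let ?f = "map_fls (map_fls (dressed_eval M))"
  let ?m = "\<lambda>X I J. ?f (X I J)"
  interpret e: ring_map "dressed_eval M" by (rule ring_map_dressed_eval)
  interpret m: ring_map "map_fls (dressed_eval M)" by (rule ring_map_map_fls[OF ring_map_dressed_eval])
  interpret m2: ring_map ?f by (rule ring_map_map_fls[OF m.ring_map_axioms])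
  interpret K: ring_map series2 by (rule ring_map_series2)
  obtain I J a b where f: "f = fls_nth (fls_nth (reflection_lhs n I J - reflection_rhs n I J) a) b"
    and IJ: "I \<in> index_set n \<times> index_set n" "J \<in> index_set n \<times> index_set n"
    using assms by (auto simp: reflection_relations_def)
  have tm: "restrict_mat n (?m (tensor_mult n X Y)) =
      tensor_mult n (restrict_mat n (?m X)) (restrict_mat n (?m Y))" for X Y
    unfolding tensor_mult_restrict
    by (rule arg_cong[of _ _ "restrict_mat n"]) (auto simp: fun_eq_iff tensor_mult_def m2.sum m2.mult)
  have sc: "?f (scal_mat X I J) = series2 (X I J)" for X I J
  proof -
    have "scal 0 = (0 :: 'k falg)" by (simp add: scal_def)
    then have "map_fls scal 0 = (0 :: 'k falg fls)"
      by (intro fls_eqI) (simp add: fls_nth_map_fls)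
    then show ?thesis
      by (simp add: scal_mat_def map_fls_map_fls m.zero map_fls_dressed_eval_scal)
  qed
  have R: "restrict_mat n (?m (scal_mat (R_mat w))) = R_scaled n (series2 (1 / w))" for w
    unfolding R_scaled_def
  proof (rule arg_cong[of _ _ "restrict_mat n"], intro ext)
    fix I J
    have "series2 (perm_mat I J / w) = series2 (1 / w) * perm_mat I J"
      by (auto simp: perm_mat_def K.zero K.one split: prod.splits)
    then show "?f (scal_mat (R_mat w) I J) = id_mat I J - series2 (1 / w) * perm_mat I J"
      by (simp add: sc R_mat_def K.diff) (simp add: id_mat_def K.one K.zero)
  qed
  have R': "restrict_mat n (?m (scal_mat (R'_mat w))) = R'_scaled n (series2 (1 / w))" for w
    unfolding R'_scaled_def
  proof (rule arg_cong[of _ _ "restrict_mat n"], intro ext)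
    fix I J
    \<comment> \<open>The entries of P' over the scalars and over the operators are images of one
      and the same integer.\<close>
    let ?t = "if snd I = - fst I \<and> snd J = - fst J then theta (fst I) (fst J) else 0"
    have pp: "(prime1 perm_mat I J :: 'k fls fls) = of_int ?t"
      and pp': "(prime1 perm_mat I J :: 'r fls fls) = of_int ?t"
      by (auto simp: prime1_def perm_mat_def split: prod.splits)
    have "series2 (prime1 perm_mat I J / w) = series2 (1 / w) * prime1 perm_mat I J"
    proof -
      have p: "prime1 perm_mat I J / w = (1 / w) * prime1 perm_mat I J" by simp
      have q: "\<exists>t. (prime1 perm_mat I J :: 'k fls fls) = of_int t \<and> (prime1 perm_mat I J :: 'r fls fls) = of_int t"
        using pp pp' by blast
      show ?thesis unfolding p K.mult using q K.of_int by metis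
    qed
    then show "?f (scal_mat (R'_mat w) I J) = id_mat I J - series2 (1 / w) * prime1 perm_mat I J"
      by (simp add: sc R'_mat_def K.diff) (simp add: id_mat_def K.one K.zero)
  qed
  have S1: "restrict_mat n (?m S1_u) = leg1 n (\<lambda>i j. eval_at_u (dressed M i j))"
  proof -
    have "?f (fps_to_fls (Abs_fps (\<lambda>r. fls_const (gen_s i j r)))) = eval_at_u (dressed M i j)"
      if ij: "i \<in> index_set n" "j \<in> index_set n" for i j
    proof (rule fls_eqI)
      fix k
      show "fls_nth (?f (fps_to_fls (Abs_fps (\<lambda>r. fls_const (gen_s i j r))))) k =
          fls_nth (eval_at_u (dressed M i j)) k"
        using starts_with_dressed[OF ij, of M]
        by (cases "k < 0")
          (auto simp: fls_nth_map_fls m.zero e.zero map_fls_const dressed_eval_gen_s[OF ij] starts_with_def)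
    qed
    then show ?thesis
      by (intro ext) (auto simp: restrict_mat_def leg1_def S1_u_def m2.zero split: prod.splits)
  qed
  have S2: "restrict_mat n (?m S2_v) = leg2 n (\<lambda>i j. fls_const (dressed M i j))"
  proof -
    have "?f (fls_const (fps_to_fls (Abs_fps (gen_s i j)))) = fls_const (dressed M i j)"
      if ij: "i \<in> index_set n" "j \<in> index_set n" for i j
      using map_fls_dressed_eval_s[OF ij, of M] by (simp add: map_fls_const m.zero s_pos_def)
    then show ?thesis
      by (intro ext) (auto simp: restrict_mat_def leg2_def S2_v_def m2.zero split: prod.splits)
  qed
  have "restrict_mat n (?m (reflection_lhs n)) = restrict_mat n (?m (reflection_rhs n))"
    using dressed_reflection[of M]
    by (simp only: reflection_lhs_def reflection_rhs_def tm R R' S1 S2 reflection_eq_def)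
  then have "restrict_mat n (?m (reflection_lhs n)) I J = restrict_mat n (?m (reflection_rhs n)) I J"
    by simp
  then have "?f (reflection_lhs n I J) = ?f (reflection_rhs n I J)"
    using IJ by (simp add: restrict_mat_def)
  then have "?f (reflection_lhs n I J - reflection_rhs n I J) = 0"
    by (simp add: m2.diff)
  moreover have "dressed_eval M f = fls_nth (fls_nth (?f (reflection_lhs n I J - reflection_rhs n I J)) a) b"
    by (simp only: f fls_nth_map_fls e.zero m.zero)
  ultimately show ?thesis by simp
qed

lemma dressed_eval_yangian_ideal:
  assumes "f \<in> yangian_ideal n"
  shows "dressed_eval M f = 0"
proof -
  interpret e: ring_map "dressed_eval M" by (rule ring_map_dressed_eval)
  interpret A: ring "free_alg n :: 'k falg ring" by (rule ring_free_alg)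
  let ?I = "{f \<in> carrier (free_alg n). dressed_eval M f = 0}"
  have "ideal ?I (free_alg n)"
  proof (rule idealI)
    show "subgroup ?I (add_monoid (free_alg n))"
    proof (rule A.add.subgroupI)
      fix a assume a: "a \<in> ?I"
      have "\<ominus>\<^bsub>free_alg n\<^esub> a = - a"
        by (rule A.minus_equality) (use a in \<open>simp_all add: free_alg_closed\<close>)
      then show "\<ominus>\<^bsub>free_alg n\<^esub> a \<in> ?I" using a by (simp add: free_alg_closed e.uminus)
    qed (use e.zero in \<open>auto simp: free_alg_closed e.add\<close>)
  qed (auto simp: ring_free_alg free_alg_closed e.mult)
  then have "yangian_ideal n \<subseteq> ?I"
    unfolding yangian_ideal_def
    by (rule A.genideal_minimal)
      (use dressed_eval_reflection dressed_eval_symmetry reflection_relations_carrier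
        symmetry_relations_carrier in blast)
  then show ?thesis using assms by blast
qed

end



section \<open>The highest weight of a dressed matrix\<close>

text \<open>Congruence modulo a left ideal stands in for the action on a vector: the ideal will be
  the annihilator of a vector of Fock space.\<close>

definition left_ideal :: "'a::ring_1 set \<Rightarrow> bool" where
  "left_ideal K \<longleftrightarrow> 0 \<in> K \<and> (\<forall>x\<in>K. \<forall>y\<in>K. x + y \<in> K) \<and> (\<forall>r. \<forall>x\<in>K. r * x \<in> K)"

lemma left_idealD:
  assumes "left_ideal K"
  shows "0 \<in> K" "x \<in> K \<Longrightarrow> y \<in> K \<Longrightarrow> x + y \<in> K" "x \<in> K \<Longrightarrow> r * x \<in> K"
    "x \<in> K \<Longrightarrow> y \<in> K \<Longrightarrow> x - y \<in> K"
proof -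
  show 1: "0 \<in> K" "x \<in> K \<Longrightarrow> y \<in> K \<Longrightarrow> x + y \<in> K" "x \<in> K \<Longrightarrow> r * x \<in> K" for x y r
    using assms by (auto simp: left_ideal_def)
  show "x \<in> K \<Longrightarrow> y \<in> K \<Longrightarrow> x - y \<in> K"
    using 1(2)[of x "- y"] 1(3)[of y "- 1"] by simp
qed

lemma left_ideal_sum:
  assumes "left_ideal K" "\<And>x. x \<in> A \<Longrightarrow> g x \<in> K"
  shows "sum g A \<in> K"
  using assms(2)
  by (induction A rule: infinite_finite_induct) (auto simp: left_idealD[OF assms(1)])

lemma left_ideal_fls_over:
  assumes "left_ideal K"
  shows "left_ideal (fls_over K)"
  using left_idealD[OF assms]
  by (auto simp: left_ideal_def fls_over_def fls_times_nth(2) intro!: left_ideal_sum[OF assms])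

context gl_copies
begin

text \<open>The factor with - i stems from T'(-u), whose (i, i) entry is the (-i, -i) entry of
  T(-u).\<close>

definition weight :: "(nat \<Rightarrow> int) \<Rightarrow> nat \<Rightarrow> int \<Rightarrow> 'k fls" where
  "weight d M i =
     (\<Prod>m<M. (1 + of_bool (i \<le> d m) * pole m) * (1 + of_bool (- i \<le> d m) * neg_pole m))"

context
  fixes K :: "'r set" and d :: "nat \<Rightarrow> int"
  assumes K: "left_ideal K"
    and raising: "\<And>m i j. \<lbrakk>i \<in> index_set n; j \<in> index_set n; i < j\<rbrakk> \<Longrightarrow> E m i j \<in> K"
    and diagonal: "\<And>m i. i \<in> index_set n \<Longrightarrow> E m i i - of_bool (i \<le> d m) \<in> K"
begin

lemma ev_raising:
  assumes "i \<in> index_set n" "j \<in> index_set n" "i < j"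
  shows "ev m c i j \<in> fls_over K"
proof -
  have "fls_const (E m i j) \<in> fls_over K"
    using raising[OF assms] left_idealD(1)[OF K] by (simp add: fls_over_def)
  then show ?thesis
    using assms(3) left_idealD(3)[OF left_ideal_fls_over[OF K]] by (simp add: ev_def)
qed

lemma ev_diagonal:
  assumes "i \<in> index_set n"
  shows "ev m c i i - series (1 + of_bool (i \<le> d m) * c) \<in> fls_over K"
proof -
  interpret S: ring_map series by (rule ring_map_series)
  interpret C: ring_map "fls_const :: 'r \<Rightarrow> 'r fls" by (rule ring_map_fls_const)
  have "fls_const (E m i i - of_bool (i \<le> d m)) \<in> fls_over K"
    using diagonal[OF assms] left_idealD(1)[OF K] by (simp add: fls_over_def)
  then have "series c * fls_const (E m i i - of_bool (i \<le> d m)) \<in> fls_over K"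
    by (rule left_idealD(3)[OF left_ideal_fls_over[OF K]])
  moreover have "ev m c i i - series (1 + of_bool (i \<le> d m) * c) =
      series c * fls_const (E m i i - of_bool (i \<le> d m))"
    by (cases "i \<le> d m") (simp_all add: ev_def S.add S.one C.diff C.one C.zero right_diff_distrib)
  ultimately show ?thesis by simp
qed

text \<open>E_{i,a} is raising but stands to the left of E_{-j,-b}, so it has to be moved past it.
  The commutator leaves E_{i,-b} if a = -j and E_{-j,a} if b = -i, and the inequalities between the
  indices make the surviving operator raising again.\<close>

lemma ev_product_vanishes:
  assumes idx: "i \<in> index_set n" "j \<in> index_set n" "a \<in> index_set n" "b \<in> index_set n"
    and ij: "i < j \<or> i = j \<and> 0 < i" and ab: "j \<le> b" "b \<le> a" "i < a"
  shows "ev m p i a * ev m q (- j) (- b) \<in> fls_over K"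
proof -
  interpret C: ring_map "fls_const :: 'r \<Rightarrow> 'r fls" by (rule ring_map_fls_const)
  note L = left_idealD[OF K] and LL = left_idealD[OF left_ideal_fls_over[OF K]]
  have 1: "E m i a \<in> K" using raising idx ab by auto
  have "of_bool (- j = a) * E m i (- b) \<in> K"
    using raising[of i "- b" m] idx ij ab L(1) by (cases "- j = a") auto
  moreover have "of_bool (i = - b) * E m (- j) a \<in> K"
    using raising[of "- j" a m] idx ij ab L(1) by (cases "i = - b") auto
  moreover have "E m i a * E m (- j) (- b) = E m (- j) (- b) * E m i a +
      (of_bool (- j = a) * E m i (- b) - of_bool (i = - b) * E m (- j) a)"
    using gl[of i a "- j" "- b" m] idx by (simp add: algebra_simps)
  ultimately have 2: "E m i a * E m (- j) (- b) \<in> K"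
    using L(2,3,4) 1 by simp
  have C: "fls_const x \<in> fls_over K" if "x \<in> K" for x
    using that L(1) by (simp add: fls_over_def)
  have "ev m p i a * ev m q (- j) (- b) =
      series p * (of_bool (- j = - b) * fls_const (E m i a) + series q * fls_const (E m i a * E m (- j) (- b)))"
  proof -
    have "fls_const (E m i a) * (series q * x) = series q * (fls_const (E m i a) * x)" for x
      by (metis mult.assoc series_central)
    then show ?thesis
      using ab(3) by (cases "j = b") (simp_all add: ev_def distrib_left mult.assoc)
  qed
  then show ?thesis
    using LL(2,3) C[OF 1] C[OF 2] by simp
qed

text \<open>The two claims go together: the diagonal entry of the next dressing also receives
  products with off-diagonal entries of the inner matrix. Modulo K only the term a = b = i of a
  diagonal entry survives, and its three factors act by scalars, so the weights multiply.\<close>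

lemma dressed_highest_weight:
  shows "\<lbrakk>i \<in> index_set n; j \<in> index_set n; i < j\<rbrakk> \<Longrightarrow> dressed M i j \<in> fls_over K"
    and "\<lbrakk>i \<in> index_set n; 0 < i\<rbrakk> \<Longrightarrow> dressed M i i - series (weight d M i) \<in> fls_over K"
proof (induction M arbitrary: i j)
  interpret S: ring_map series by (rule ring_map_series)
  note LL = left_idealD[OF left_ideal_fls_over[OF K]]
  case 0
  {
    case 1
    then show ?case using LL(1) by simp
  next
    case 2
    then show ?case using LL(1) by (simp add: weight_def S.one)
  }
next
  interpret S: ring_map series by (rule ring_map_series)
  note LL = left_idealD[OF left_ideal_fls_over[OF K]]
  case (Suc M)
  let ?A = "ev M (pole M)" and ?B = "ev M (neg_pole M)" and ?S = "dressed M"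
  let ?t = "\<lambda>i j a b. of_int (theta b j) * (?A i a * ?B (- j) (- b) * ?S a b)"
  have comm: "?S a b * ev M c k l = ev M c k l * ?S a b"
    if "a \<in> index_set n" "b \<in> index_set n" "k \<in> index_set n" "l \<in> index_set n" for a b k l c
    by (rule ev_commutes[OF dressed_commutes[OF order_refl that]])
  have sum: "dressed (Suc M) i j = (\<Sum>a\<in>index_set n. \<Sum>b\<in>index_set n. ?t i j a b)"
    if "i \<in> index_set n" "j \<in> index_set n" for i j
    using dress_eq_dress_sum[OF comm that] by (simp add: dress_sum_def)
  have van: "?t i j a b \<in> fls_over K"
    if idx: "i \<in> index_set n" "j \<in> index_set n" "a \<in> index_set n" "b \<in> index_set n"
      and ij: "i < j \<or> i = j \<and> 0 < i" and ne: "\<not> (i = j \<and> a = i \<and> b = i)" for i j a b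
  proof (rule LL(3))
    have S1: "?A i a * ?B (- j) (- b) * ?S a b = ?A i a * ?S a b * ?B (- j) (- b)"
      using comm[OF idx(3,4), of "- j" "- b"] idx by (simp add: mult.assoc)
    have S2: "?A i a * ?B (- j) (- b) * ?S a b = ?S a b * (?A i a * ?B (- j) (- b))"
      using S1 comm[OF idx(3,4), of i a] idx by (simp add: mult.assoc[symmetric])
    \<comment> \<open>The annihilating factor is moved to the right in each of the three cases.\<close>
    consider "a < b" | "b < j" | "j \<le> b" "b \<le> a" "i < a"
      using ij ne by linarith
    then show "?A i a * ?B (- j) (- b) * ?S a b \<in> fls_over K"
    proof cases
      case 1
      then show ?thesis using Suc.IH(1) idx LL(3) by blast
    next
      case 2
      then have "?B (- j) (- b) \<in> fls_over K" using ev_raising idx by simp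
      then show ?thesis unfolding S1 by (rule LL(3))
    next
      case 3
      then show ?thesis unfolding S2 using ev_product_vanishes[OF idx ij] LL(3) by blast
    qed
  qed
  {
    case 1
    then show ?case
      unfolding sum[OF 1(1,2)]
      by (intro left_ideal_sum left_ideal_fls_over K van) auto
  next
    case 2
    let ?p = "1 + of_bool (i \<le> d M) * pole M" and ?q = "1 + of_bool (- i \<le> d M) * neg_pole M"
    have "(\<Sum>a\<in>index_set n. \<Sum>b\<in>index_set n. ?t i i a b) - ?t i i i i =
        (\<Sum>a\<in>index_set n. \<Sum>b\<in>index_set n. if a = i \<and> b = i then 0 else ?t i i a b)"
    proof -
      have "(\<Sum>a\<in>index_set n. \<Sum>b\<in>index_set n. if a = i \<and> b = i then ?t i i a b else 0) = ?t i i i i"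
      proof -
        have "(\<Sum>a\<in>index_set n. \<Sum>b\<in>index_set n. if a = i \<and> b = i then ?t i i a b else 0) =
            (\<Sum>a\<in>index_set n. if a = i then ?t i i i i else 0)"
          using 2(1) by (intro sum.cong refl) (auto cong: if_cong)
        then show ?thesis using 2(1) by simp
      qed
      moreover have "(\<Sum>a\<in>index_set n. \<Sum>b\<in>index_set n. ?t i i a b) =
          (\<Sum>a\<in>index_set n. \<Sum>b\<in>index_set n. if a = i \<and> b = i then ?t i i a b else 0) +
          (\<Sum>a\<in>index_set n. \<Sum>b\<in>index_set n. if a = i \<and> b = i then 0 else ?t i i a b)"
        unfolding sum.distrib[symmetric] by (intro sum.cong refl) simp
      ultimately show ?thesis by simp
    qed
    also have "\<dots> \<in> fls_over K"
      by (intro left_ideal_sum left_ideal_fls_over K) (use van[of i i] 2 LL(1) in auto)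
    finally have rest: "dressed (Suc M) i i - ?t i i i i \<in> fls_over K"
      using sum[of i i] 2(1) by simp
    \<comment> \<open>A left ideal lets only the rightmost factor be replaced by its eigenvalue;
      being central, the eigenvalue is then written in front: x S - c x = x (S - c).\<close>
    have diag: "x * ?S i i - series (weight d M i) * x \<in> fls_over K" for x
      using LL(3)[OF Suc.IH(2)[OF 2], of x] by (simp add: right_diff_distrib series_central)
    have qB: "x * ?B (- i) (- i) - series ?q * x \<in> fls_over K" for x
      using LL(3)[OF ev_diagonal[of "- i" M "neg_pole M"], of x] 2(1)
      by (simp only: right_diff_distrib series_central uminus_index_set)
    \<comment> \<open>The three factors are replaced by their eigenvalues one at a time, from right
      to left.\<close>
    have "?t i i i i - series (weight d (Suc M) i) \<in> fls_over K"
    proof -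
      have "theta i i = 1" using 2 by (simp add: theta_def)
      then have "?t i i i i - series (weight d (Suc M) i) =
          (?A i i * ?B (- i) (- i) * ?S i i - series (weight d M i) * (?A i i * ?B (- i) (- i)))
          + series (weight d M i) * ((?A i i * ?B (- i) (- i) - series ?q * ?A i i)
            + series ?q * (?A i i - series ?p))"
      proof -
        have q: "series ?q * series ?p = series ?p * series ?q" by (rule series_central)
        have w: "series (weight d (Suc M) i) = series (weight d M i) * (series ?p * series ?q)"
          by (simp only: weight_def prod.lessThan_Suc S.mult)
        show ?thesis
          unfolding \<open>theta i i = 1\<close> w q[symmetric]
          by (simp add: right_diff_distrib distrib_left del: of_bool_eq)
      qed
      then show ?thesis
        by (simp only:) (intro LL(2) LL(3) diag qB ev_diagonal 2(1))
    qed
    then show ?case using LL(2)[OF rest] by fastforce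
  }
qed

end

end



section \<open>Fermionic operators\<close>

text \<open>A vector of the Fock space is given by its coefficients on the basis indexed by the sets of
  occupied modes. All functions are allowed, so that no finiteness has to be maintained.\<close>

abbreviation fock_scale :: "'k::field \<Rightarrow> (nat set \<Rightarrow> 'k) \<Rightarrow> nat set \<Rightarrow> 'k" where
  "fock_scale c \<psi> \<equiv> \<lambda>X. c * \<psi> X"

lemma vector_space_fock: "vector_space (fock_scale :: 'k::field \<Rightarrow> _)"
  by unfold_locales (auto simp: algebra_simps fun_eq_iff)

text \<open>Linear operators receive a type of their own because the dressing argument lives in the
  class \<open>ring_1\<close>.\<close>

typedef (overloaded) 'k fock_op =
  "{f :: (nat set \<Rightarrow> 'k::field) \<Rightarrow> nat set \<Rightarrow> 'k.
     (\<forall>x y. f (x + y) = f x + f y) \<and> (\<forall>c x. f (fock_scale c x) = fock_scale c (f x))}"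
  morphisms fock_apply Fock_op
  by (rule exI[of _ "\<lambda>x. x"]) simp

lemma fock_apply_add: "fock_apply a (x + y) = fock_apply a x + fock_apply a y"
  and fock_apply_scale: "fock_apply a (fock_scale c x) = fock_scale c (fock_apply a x)"
  using fock_apply[of a] by auto

lemma fock_apply_zero: "fock_apply a 0 = 0"
  using fock_apply_add[of a 0 0] by simp

lemma fock_apply_Fock_op:
  assumes "\<And>x y. f (x + y) = f x + f y" "\<And>c x. f (fock_scale c x) = fock_scale c (f x)"
  shows "fock_apply (Fock_op f) = f"
  by (rule Fock_op_inverse) (use assms in auto)

instantiation fock_op :: (field) ring_1
begin

definition zero_fock_op :: "'a fock_op" where "0 = Fock_op (\<lambda>x. 0)"
definition one_fock_op :: "'a fock_op" where "1 = Fock_op (\<lambda>x. x)"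
definition plus_fock_op :: "'a fock_op \<Rightarrow> 'a fock_op \<Rightarrow> 'a fock_op" where
  "a + b = Fock_op (\<lambda>x. fock_apply a x + fock_apply b x)"
definition minus_fock_op :: "'a fock_op \<Rightarrow> 'a fock_op \<Rightarrow> 'a fock_op" where
  "a - b = Fock_op (\<lambda>x. fock_apply a x - fock_apply b x)"
definition uminus_fock_op :: "'a fock_op \<Rightarrow> 'a fock_op" where
  "- a = Fock_op (\<lambda>x. - fock_apply a x)"
definition times_fock_op :: "'a fock_op \<Rightarrow> 'a fock_op \<Rightarrow> 'a fock_op" where
  "a * b = Fock_op (\<lambda>x. fock_apply a (fock_apply b x))"

lemma fock_apply_ops:
  "fock_apply 0 x = 0" "fock_apply 1 x = x"
  "fock_apply (a + b) x = fock_apply a x + fock_apply b x"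
  "fock_apply (a - b) x = fock_apply a x - fock_apply b x"
  "fock_apply (- a) x = - fock_apply a x"
  "fock_apply (a * b) x = fock_apply a (fock_apply b x)"
  unfolding zero_fock_op_def one_fock_op_def plus_fock_op_def minus_fock_op_def uminus_fock_op_def
    times_fock_op_def
  by (subst fock_apply_Fock_op;
      simp add: fock_apply_add fock_apply_scale fun_eq_iff algebra_simps)+

lemma fock_op_eqI: "(\<And>x X. fock_apply a x X = fock_apply b x X) \<Longrightarrow> a = b"
  by (rule fock_apply_inject[THEN iffD1]) (simp add: fun_eq_iff)

instance
proof
  fix a b c :: "'a fock_op"
  show "(0 :: 'a fock_op) \<noteq> 1"
  proof
    assume "(0 :: 'a fock_op) = 1"
    then have "fock_apply (0 :: 'a fock_op) (\<lambda>X. 1) {} = fock_apply 1 (\<lambda>X. 1) {}" by simp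
    then show False by (simp add: fock_apply_ops)
  qed
qed (rule fock_op_eqI; simp add: fock_apply_ops fock_apply_add algebra_simps)+

end

lemma sum_apply:
  fixes g :: "'b \<Rightarrow> 'c \<Rightarrow> 'd::comm_monoid_add"
  shows "(\<Sum>a\<in>A. g a) Y = (\<Sum>a\<in>A. g a Y)"
  by (induction A rule: infinite_finite_induct) simp_all

lemma fock_apply_sum: "fock_apply (sum g A) x = (\<Sum>a\<in>A. fock_apply (g a) x)"
  by (induction A rule: infinite_finite_induct) (simp_all add: fock_apply_ops)

definition fock_scalar :: "'k::field \<Rightarrow> 'k fock_op" where
  "fock_scalar c = Fock_op (fock_scale c)"

lemma fock_apply_scalar: "fock_apply (fock_scalar c) x = fock_scale c x"
  unfolding fock_scalar_def by (subst fock_apply_Fock_op) (simp_all add: fun_eq_iff algebra_simps)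

lemma scalar_map_fock_scalar: "scalar_map fock_scalar"
  by unfold_locales
    (rule fock_op_eqI;
      simp add: fock_apply_ops fock_apply_scalar fock_apply_scale algebra_simps)+

text \<open>The sign of moving a fermion of mode p past the occupied modes below it. Modes are
  natural numbers, so only finitely many lie below p even if X is infinite.\<close>

definition mode_sign :: "nat \<Rightarrow> nat set \<Rightarrow> 'k::field" where
  "mode_sign p X = (- 1) ^ card {q \<in> X. q < p}"

lemma mode_sign_square: "mode_sign p X * (mode_sign p X * c) = c"
  by (simp add: mode_sign_def mult.assoc[symmetric] power_mult_distrib[symmetric])

lemma mode_sign_insert:
  assumes "q \<notin> X"
  shows "mode_sign p (insert q X) = (if q < p then - mode_sign p X else mode_sign p X)"
proof -
  have "finite {r \<in> X. r < p}" by (rule finite_subset[of _ "{..<p}"]) auto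
  moreover have "{r \<in> insert q X. r < p} = (if q < p then insert q {r \<in> X. r < p} else {r \<in> X. r < p})"
    by auto
  ultimately show ?thesis using assms by (simp add: mode_sign_def)
qed

lemma mode_sign_remove:
  assumes "q \<in> X"
  shows "mode_sign p (X - {q}) = (if q < p then - mode_sign p X else mode_sign p X :: 'a::field)"
proof -
  have "mode_sign p (insert q (X - {q})) =
      (if q < p then - mode_sign p (X - {q}) else mode_sign p (X - {q}) :: 'a)"
    by (rule mode_sign_insert) simp
  then show ?thesis using assms by (auto simp: insert_absorb)
qed

text \<open>The signs are those of the Jordan--Wigner transformation.\<close>

definition annihilate :: "nat \<Rightarrow> 'k::field fock_op" where
  "annihilate p = Fock_op (\<lambda>\<psi> X. if p \<in> X then 0 else mode_sign p X * \<psi> (insert p X))"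

text \<open>The coefficient at X is read off from the configuration before the operator acts; hence
  a removal here and an insertion in \<open>annihilate\<close>.\<close>

definition create :: "nat \<Rightarrow> 'k::field fock_op" where
  "create p = Fock_op (\<lambda>\<psi> X. if p \<in> X then mode_sign p X * \<psi> (X - {p}) else 0)"

lemma fock_apply_annihilate:
  "fock_apply (annihilate p) \<psi> X = (if p \<in> X then 0 else mode_sign p X * \<psi> (insert p X))"
  unfolding annihilate_def by (subst fock_apply_Fock_op) (auto simp: fun_eq_iff algebra_simps)

lemma fock_apply_create:
  "fock_apply (create p) \<psi> X = (if p \<in> X then mode_sign p X * \<psi> (X - {p}) else 0)"
  unfolding create_def by (subst fock_apply_Fock_op) (auto simp: fun_eq_iff algebra_simps)

lemma annihilate_annihilate: "annihilate p * annihilate q = - (annihilate q * annihilate p)"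
proof (cases "p = q")
  case False
  then show ?thesis
    by (intro fock_op_eqI)
      (auto simp: fock_apply_ops fock_apply_annihilate mode_sign_insert insert_commute mult.left_commute)
qed (rule fock_op_eqI, simp add: fock_apply_ops fock_apply_annihilate)

lemma create_create: "create p * create q = - (create q * create p)"
proof (cases "p = q")
  case False
  have "X - {p} - {q} = X - {q} - {p}" for X by auto
  then show ?thesis using False
    by (intro fock_op_eqI)
      (auto simp: fock_apply_ops fock_apply_create mode_sign_remove mult.left_commute)
qed (rule fock_op_eqI, simp add: fock_apply_ops fock_apply_create)

lemma annihilate_create: "annihilate p * create q = of_bool (p = q) - create q * annihilate p"
proof (cases "p = q")
  case True
  then show ?thesis
    by (intro fock_op_eqI)
      (auto simp: fock_apply_ops fock_apply_create fock_apply_annihilate mode_sign_remove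
        mode_sign_insert mode_sign_square insert_absorb)
next
  case False
  then have "insert p X - {q} = insert p (X - {q})" for X by auto
  then show ?thesis using False
    by (intro fock_op_eqI)
      (auto simp: fock_apply_ops fock_apply_create fock_apply_annihilate mode_sign_remove
        mode_sign_insert mult.left_commute)
qed

text \<open>Normal ordering splits each product into a contraction and a quartic term. Interchanging
  the two bilinears produces one sign from the creators and one from the annihilators, so the
  quartic terms cancel and the contractions form the gl bracket.\<close>

lemma hopping_commutator:
  "(create p * annihilate q) * (create r * annihilate s) - (create r * annihilate s) * (create p * annihilate q)
   = of_bool (q = r) * (create p * annihilate s) - of_bool (s = p) * (create r * annihilate q)"
proof -
  have 1: "(create p * annihilate q) * (create r * annihilate s) =
      of_bool (q = r) * (create p * annihilate s) - create p * create r * (annihilate q * annihilate s)"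
    for p q r s
  proof -
    have "(create p * annihilate q) * (create r * annihilate s) =
        create p * (annihilate q * create r) * annihilate s"
      by (simp add: mult.assoc)
    also have "\<dots> = of_bool (q = r) * (create p * annihilate s)
        - create p * create r * (annihilate q * annihilate s)"
      by (cases "q = r") (simp_all add: annihilate_create left_diff_distrib right_diff_distrib mult.assoc)
    finally show ?thesis .
  qed
  have c: "create p * create r * (annihilate q * annihilate s) = create r * create p * (annihilate s * annihilate q)"
    by (subst create_create, subst annihilate_annihilate) simp
  show ?thesis unfolding 1 c by simp
qed

text \<open>An injective numbering of the pairs (copy, index); the order it induces on the modes
  affects the signs alone.\<close>

definition mode :: "nat \<Rightarrow> int \<Rightarrow> nat" where
  "mode m i = to_nat (m, i)"

lemma mode_eq_iff: "mode m i = mode m' i' \<longleftrightarrow> m = m' \<and> i = i'"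
  by (simp add: mode_def)

definition hop :: "nat \<Rightarrow> int \<Rightarrow> int \<Rightarrow> 'k::field fock_op" where
  "hop m i j = create (mode m i) * annihilate (mode m j)"

lemma gl_copies_hop:
  assumes "(2 :: 'k::field) \<noteq> 0"
  shows "gl_copies fock_scalar n (hop :: nat \<Rightarrow> int \<Rightarrow> int \<Rightarrow> 'k fock_op)"
proof (intro gl_copies.intro scalar_map_fock_scalar gl_copies_axioms.intro)
  fix i j k l m
  show "hop m i j * hop m k l - hop m k l * hop m i j =
      of_bool (k = j) * hop m i l - of_bool (i = l) * hop m k j"
    unfolding hop_def hopping_commutator by (simp add: mode_eq_iff eq_commute)
next
  fix i j k l and m m' :: nat assume "m \<noteq> m'"
  then show "hop m i j * hop m' k l = hop m' k l * hop m i j"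
    using hopping_commutator[of "mode m i" "mode m j" "mode m' k" "mode m' l"]
    by (simp add: hop_def mode_eq_iff)
qed (rule assms)

section \<open>The reference vector and its annihilator\<close>

definition occupied :: "nat \<Rightarrow> (nat \<Rightarrow> int) \<Rightarrow> nat set" where
  "occupied n d = {mode m i | m i. i \<in> index_set n \<and> i \<le> d m}"

definition vacuum :: "nat \<Rightarrow> (nat \<Rightarrow> int) \<Rightarrow> nat set \<Rightarrow> 'k::field" where
  "vacuum n d X = of_bool (X = occupied n d)"

definition vacuum_ideal :: "nat \<Rightarrow> (nat \<Rightarrow> int) \<Rightarrow> 'k::field fock_op set" where
  "vacuum_ideal n d = {a. fock_apply a (vacuum n d) = 0}"

lemma mode_occupied: "i \<in> index_set n \<Longrightarrow> mode m i \<in> occupied n d \<longleftrightarrow> i \<le> d m"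
  by (auto simp: occupied_def mode_eq_iff)

lemma left_ideal_vacuum_ideal: "left_ideal (vacuum_ideal n d)"
  by (simp add: left_ideal_def vacuum_ideal_def fock_apply_ops fock_apply_zero)

lemma one_notin_vacuum_ideal: "1 \<notin> vacuum_ideal n d"
proof
  assume "(1 :: 'a fock_op) \<in> vacuum_ideal n d"
  then have "vacuum n d (occupied n d) = (0 :: nat set \<Rightarrow> 'a) (occupied n d)"
    by (simp only: vacuum_ideal_def mem_Collect_eq fock_apply_ops)
  then show False by (simp add: vacuum_def)
qed

text \<open>For i < j a fermion would move from j to i. If mode j is filled then so is mode i, and
  exclusion gives zero; if mode j is empty, there is nothing to move. For i = j the operator counts
  the occupation of the mode.\<close>

lemma hop_vacuum:
  assumes "i \<in> index_set n" "j \<in> index_set n"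
  shows "i < j \<Longrightarrow> hop m i j \<in> vacuum_ideal n d"
    and "hop m i i - of_bool (i \<le> d m) \<in> vacuum_ideal n d"
proof -
  let ?p = "mode m i" and ?q = "mode m j"
  assume "i < j"
  then have "?p \<noteq> ?q" "?q \<in> occupied n d \<Longrightarrow> ?p \<in> occupied n d"
    using assms by (auto simp: mode_occupied mode_eq_iff)
  then have "insert ?q (X - {?p}) \<noteq> occupied n d" for X by blast
  then show "hop m i j \<in> vacuum_ideal n d"
    by (auto simp: vacuum_ideal_def hop_def fock_apply_ops fock_apply_create fock_apply_annihilate
        vacuum_def fun_eq_iff)
next
  show "hop m i i - of_bool (i \<le> d m) \<in> vacuum_ideal n d"
    using assms(1) mode_occupied[OF assms(1), of m d]
    by (auto simp: vacuum_ideal_def hop_def fock_apply_ops fock_apply_create fock_apply_annihilate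
        vacuum_def fun_eq_iff mode_sign_remove mode_sign_square insert_absorb)
qed

section \<open>A finite-dimensional part of Fock space\<close>

definition supported_on :: "nat set set \<Rightarrow> (nat set \<Rightarrow> 'k::field) set" where
  "supported_on U = {\<psi>. \<forall>X. X \<notin> U \<longrightarrow> \<psi> X = 0}"

definition preservers :: "nat set set \<Rightarrow> 'k::field fock_op set" where
  "preservers U = {a. \<forall>\<psi>\<in>supported_on U. fock_apply a \<psi> \<in> supported_on U}"

lemma unital_subring_preservers: "unital_subring (preservers U)"
  by (auto simp: unital_subring_def preservers_def supported_on_def fock_apply_ops)

lemma fock_scalar_preserves: "fock_scalar c \<in> preservers U"
  by (auto simp: preservers_def supported_on_def fock_apply_scalar)

text \<open>The sets that differ from the reference set only in modes of the first M copies. The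
  filling of the later copies, possibly infinite, stays frozen, which keeps the number of
  configurations finite.\<close>

definition configurations :: "nat \<Rightarrow> nat \<Rightarrow> (nat \<Rightarrow> int) \<Rightarrow> nat set set" where
  "configurations n M d = (let W = {mode m i | m i. m < M \<and> i \<in> index_set n} in
     {X. X - W = occupied n d - W})"

lemma finite_configurations: "finite (configurations n M d)"
proof -
  let ?W = "{mode m i | m i. m < M \<and> i \<in> index_set n}"
  have "?W = (\<lambda>(m, i). mode m i) ` ({..<M} \<times> index_set n)" by auto
  then have "finite ?W" by simp
  moreover have "configurations n M d \<subseteq> (\<lambda>Y. Y \<union> (occupied n d - ?W)) ` Pow ?W"
  proof
    fix X assume "X \<in> configurations n M d"
    then have "X = (X \<inter> ?W) \<union> (occupied n d - ?W)"
      unfolding configurations_def Let_def by blast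
    then show "X \<in> (\<lambda>Y. Y \<union> (occupied n d - ?W)) ` Pow ?W" by blast
  qed
  ultimately show ?thesis by (meson finite_Pow_iff finite_imageI finite_subset)
qed

lemma hop_preserves:
  assumes "m < M" "i \<in> index_set n" "j \<in> index_set n"
  shows "hop m i j \<in> preservers (configurations n M d)"
proof -
  let ?U = "configurations n M d"
  have ins: "insert (mode m k) X \<in> ?U \<longleftrightarrow> X \<in> ?U" and rem: "X - {mode m k} \<in> ?U \<longleftrightarrow> X \<in> ?U"
    if "k \<in> index_set n" for k X
    using assms(1) that unfolding configurations_def Let_def by blast+
  have "create (mode m i) \<in> preservers ?U" "annihilate (mode m j) \<in> preservers ?U"
    using assms ins rem
    by (auto simp: preservers_def supported_on_def fock_apply_create fock_apply_annihilate)
  then show ?thesis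
    unfolding hop_def by (rule unital_subringD(4)[OF unital_subring_preservers])
qed

text \<open>The operators \<open>\<phi> x\<close> send the reference vector into a
  finite-dimensional space. A maximal independent subset of these images is finite and lifts to
  elements of \<open>C\<close>, and equality of images is congruence modulo the annihilator. Taking
  \<open>B\<close> inside \<open>C\<close> lets the spanning set descend to the quotient of the
  Yangian.\<close>

lemma finite_spanning_mod_vacuum_ideal:
  fixes \<phi> :: "'i \<Rightarrow> 'k::field fock_op"
  assumes "\<phi> ` C \<subseteq> preservers (configurations n M d)"
  shows "\<exists>B\<subseteq>C. finite B \<and>
    (\<forall>x\<in>C. \<exists>c. \<phi> x - (\<Sum>b\<in>B. fock_scalar (c b) * \<phi> b) \<in> vacuum_ideal n d)"
proof -
  interpret vs: vector_space "fock_scale :: 'k \<Rightarrow> _" by (rule vector_space_fock)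
  let ?U = "configurations n M d" and ?v = "vacuum n d :: nat set \<Rightarrow> 'k"
  let ?I = "(\<lambda>X Y. of_bool (Y = X) :: 'k) ` ?U"
  let ?f = "\<lambda>x. fock_apply (\<phi> x) ?v"
  have "?v \<in> supported_on ?U"
    by (auto simp: supported_on_def vacuum_def configurations_def Let_def)
  then have "?f ` C \<subseteq> supported_on ?U" using assms by (auto simp: preservers_def)
  moreover have "supported_on ?U \<subseteq> vs.span ?I"
  proof
    fix \<psi> :: "nat set \<Rightarrow> 'k" assume \<psi>: "\<psi> \<in> supported_on ?U"
    have "\<psi> = (\<Sum>X\<in>?U. fock_scale (\<psi> X) (\<lambda>Y. of_bool (Y = X)))"
    proof
      fix Y
      have "(\<Sum>X\<in>?U. fock_scale (\<psi> X) (\<lambda>Y. of_bool (Y = X))) Y = (\<Sum>X\<in>?U. \<psi> X * of_bool (Y = X))"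
        by (rule sum_apply)
      also have "\<dots> = \<psi> Y"
        using \<psi> finite_configurations[of n M d]
        by (auto simp: supported_on_def of_bool_def if_distrib if_distribR cong: if_cong)
      finally show "\<psi> Y = (\<Sum>X\<in>?U. fock_scale (\<psi> X) (\<lambda>Y. of_bool (Y = X))) Y" ..
    qed
    also have "\<dots> \<in> vs.span ?I"
      by (intro vs.span_sum vs.span_scale vs.span_base) auto
    finally show "\<psi> \<in> vs.span ?I" .
  qed
  ultimately have I: "?f ` C \<subseteq> vs.span ?I" by blast
  obtain B0 where B0: "B0 \<subseteq> ?f ` C" "vs.independent B0" "?f ` C \<subseteq> vs.span B0"
    using vs.maximal_independent_subset by metis
  have fin: "finite B0"
    using vs.independent_span_bound[OF _ B0(2), of ?I] I B0(1) finite_configurations by auto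
  obtain g where g: "\<And>b. b \<in> B0 \<Longrightarrow> g b \<in> C \<and> ?f (g b) = b"
    using B0(1) by (metis (no_types, lifting) image_iff subsetD)
  have inj: "inj_on g B0" using g by (metis inj_onI)
  show ?thesis
  proof (intro exI[of _ "g ` B0"] conjI ballI)
    show "g ` B0 \<subseteq> C" "finite (g ` B0)" using g fin by auto
    fix x assume "x \<in> C"
    then have "?f x \<in> vs.span B0" using B0(3) by auto
    then obtain u where u: "?f x = (\<Sum>b\<in>B0. fock_scale (u b) b)"
      using vs.span_finite[OF fin] by auto
    let ?c = "\<lambda>b. u (?f b)"
    have "(\<Sum>b\<in>g ` B0. fock_scalar (?c b) * \<phi> b) = (\<Sum>b\<in>B0. fock_scalar (u b) * \<phi> (g b))"
      using g by (subst sum.reindex[OF inj]) (auto intro: sum.cong)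
    then have "fock_apply (\<Sum>b\<in>g ` B0. fock_scalar (?c b) * \<phi> b) ?v = ?f x"
      using g by (simp add: u fock_apply_sum fock_apply_ops fock_apply_scalar)
    then show "\<exists>c. \<phi> x - (\<Sum>b\<in>g ` B0. fock_scalar (c b) * \<phi> b) \<in> vacuum_ideal n d"
      by (intro exI[of _ ?c]) (simp add: vacuum_ideal_def fock_apply_ops)
  qed
qed



section \<open>Quotients of left modules\<close>

lemma (in left_module) smult_zero: "x \<in> carrier M \<Longrightarrow> \<zero>\<^bsub>R\<^esub> \<odot>\<^bsub>M\<^esub> x = \<zero>\<^bsub>M\<^esub>"
proof -
  assume x: "x \<in> carrier M"
  have "\<zero>\<^bsub>R\<^esub> \<odot>\<^bsub>M\<^esub> x \<oplus>\<^bsub>M\<^esub> \<zero>\<^bsub>R\<^esub> \<odot>\<^bsub>M\<^esub> x = \<zero>\<^bsub>R\<^esub> \<odot>\<^bsub>M\<^esub> x"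
    using smult_l_distr[of "\<zero>\<^bsub>R\<^esub>" "\<zero>\<^bsub>R\<^esub>" x] x by simp
  then show ?thesis using smult_closed[of "\<zero>\<^bsub>R\<^esub>" x] x M.add.l_cancel_one by auto
qed

text \<open>Closure under negatives follows from the action of -1.\<close>

lemma submoduleI_left:
  assumes "left_module R M" and "N \<subseteq> carrier M" "\<zero>\<^bsub>M\<^esub> \<in> N"
    and "\<And>x y. x \<in> N \<Longrightarrow> y \<in> N \<Longrightarrow> x \<oplus>\<^bsub>M\<^esub> y \<in> N"
    and sm: "\<And>a x. a \<in> carrier R \<Longrightarrow> x \<in> N \<Longrightarrow> a \<odot>\<^bsub>M\<^esub> x \<in> N"
  shows "submodule N R M"
proof -
  interpret left_module R M by fact
  have neg: "\<ominus>\<^bsub>M\<^esub> x \<in> N" if "x \<in> N" for x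
  proof -
    have x: "x \<in> carrier M" using that assms(2) by blast
    have n: "\<ominus>\<^bsub>R\<^esub> \<one>\<^bsub>R\<^esub> \<in> carrier R" by simp
    have "(\<ominus>\<^bsub>R\<^esub> \<one>\<^bsub>R\<^esub>) \<odot>\<^bsub>M\<^esub> x \<oplus>\<^bsub>M\<^esub> x = (\<ominus>\<^bsub>R\<^esub> \<one>\<^bsub>R\<^esub> \<oplus>\<^bsub>R\<^esub> \<one>\<^bsub>R\<^esub>) \<odot>\<^bsub>M\<^esub> x"
      using smult_l_distr[OF n R.one_closed x] smult_one[OF x] by simp
    also have "\<dots> = \<zero>\<^bsub>M\<^esub>" by (simp add: smult_zero[OF x] R.l_neg)
    finally have "\<ominus>\<^bsub>M\<^esub> x = (\<ominus>\<^bsub>R\<^esub> \<one>\<^bsub>R\<^esub>) \<odot>\<^bsub>M\<^esub> x"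
      using x smult_closed[OF n x] by (intro M.minus_equality)
    then show ?thesis using sm[OF n that] by simp
  qed
  have "subgroup N (add_monoid M)"
    by (rule M.add.subgroupI) (use assms neg in \<open>auto simp: a_inv_def[symmetric]\<close>)
  then show ?thesis
    using sm by (simp add: submodule_def submodule_axioms_def)
qed

lemma submoduleD:
  assumes "submodule N R M"
  shows "N \<subseteq> carrier M" "\<zero>\<^bsub>M\<^esub> \<in> N"
    and "x \<in> N \<Longrightarrow> y \<in> N \<Longrightarrow> x \<oplus>\<^bsub>M\<^esub> y \<in> N"
    and "a \<in> carrier R \<Longrightarrow> x \<in> N \<Longrightarrow> a \<odot>\<^bsub>M\<^esub> x \<in> N"
proof -
  have s: "subgroup N (add_monoid M)" using assms by (simp add: submodule_def)
  show "N \<subseteq> carrier M" "\<zero>\<^bsub>M\<^esub> \<in> N" "x \<in> N \<Longrightarrow> y \<in> N \<Longrightarrow> x \<oplus>\<^bsub>M\<^esub> y \<in> N"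
    using subgroup.subset[OF s] subgroup.one_closed[OF s] subgroup.m_closed[OF s] by auto
  show "a \<in> carrier R \<Longrightarrow> x \<in> N \<Longrightarrow> a \<odot>\<^bsub>M\<^esub> x \<in> N"
    using assms by (simp add: submodule_def submodule_axioms_def)
qed

lemma submodule_generated:
  assumes M: "left_module R M" and S: "S \<subseteq> carrier M"
  shows "submodule (generated_submodule R M S) R M" "S \<subseteq> generated_submodule R M S"
    and "submodule N R M \<Longrightarrow> S \<subseteq> N \<Longrightarrow> generated_submodule R M S \<subseteq> N"
proof -
  interpret left_module R M by fact
  have c: "submodule (carrier M) R M"
    by (rule submoduleI_left[OF M]) (auto intro: smult_closed)
  show "submodule (generated_submodule R M S) R M"
  proof (rule submoduleI_left[OF M])
    show "generated_submodule R M S \<subseteq> carrier M"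
      using c S by (auto simp: generated_submodule_def)
  qed (auto simp: generated_submodule_def dest: submoduleD(2-4))
  show "S \<subseteq> generated_submodule R M S"
    and "submodule N R M \<Longrightarrow> S \<subseteq> N \<Longrightarrow> generated_submodule R M S \<subseteq> N"
    by (auto simp: generated_submodule_def)
qed

text \<open>Of \<open>M'\<close> only the operations are given: the module axioms are transported
  from \<open>M\<close> along \<open>\<rho>\<close>, and this is how quotients are seen to be
  modules.\<close>

definition module_surj ::
    "('a, 'm) ring_scheme \<Rightarrow> ('a, 'b, 'c) module_scheme \<Rightarrow> ('a, 'd, 'e) module_scheme \<Rightarrow> ('b \<Rightarrow> 'd) \<Rightarrow> bool" where
  "module_surj R M M' \<rho> \<longleftrightarrow> left_module R M \<and> \<rho> ` carrier M = carrier M' \<and> \<rho> \<zero>\<^bsub>M\<^esub> = \<zero>\<^bsub>M'\<^esub> \<and>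
     (\<forall>x\<in>carrier M. \<forall>y\<in>carrier M. \<rho> (x \<oplus>\<^bsub>M\<^esub> y) = \<rho> x \<oplus>\<^bsub>M'\<^esub> \<rho> y) \<and>
     (\<forall>a\<in>carrier R. \<forall>x\<in>carrier M. \<rho> (a \<odot>\<^bsub>M\<^esub> x) = a \<odot>\<^bsub>M'\<^esub> \<rho> x)"

lemma module_surjD:
  assumes "module_surj R M M' \<rho>"
  shows "left_module R M" "\<rho> ` carrier M = carrier M'" "\<rho> \<zero>\<^bsub>M\<^esub> = \<zero>\<^bsub>M'\<^esub>"
    "x \<in> carrier M \<Longrightarrow> y \<in> carrier M \<Longrightarrow> \<rho> (x \<oplus>\<^bsub>M\<^esub> y) = \<rho> x \<oplus>\<^bsub>M'\<^esub> \<rho> y"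
    "a \<in> carrier R \<Longrightarrow> x \<in> carrier M \<Longrightarrow> \<rho> (a \<odot>\<^bsub>M\<^esub> x) = a \<odot>\<^bsub>M'\<^esub> \<rho> x"
    "x \<in> carrier M \<Longrightarrow> \<rho> x \<in> carrier M'"
  using assms by (auto simp: module_surj_def)

lemma left_module_surj_image:
  assumes "module_surj R M M' \<rho>"
  shows "left_module R M'"
proof -
  note s = module_surjD[OF assms]
  interpret left_module R M by (rule s(1))
  have ex: "\<exists>y\<in>carrier M. x = \<rho> y" if "x \<in> carrier M'" for x
    using that s(2) by auto
  have "abelian_group M'"
  proof (rule abelian_groupI)
    fix x y assume "x \<in> carrier M'" "y \<in> carrier M'"
    then obtain x0 y0 where "x0 \<in> carrier M" "x = \<rho> x0" "y0 \<in> carrier M" "y = \<rho> y0"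
      using ex by metis
    then show "x \<oplus>\<^bsub>M'\<^esub> y \<in> carrier M'" "x \<oplus>\<^bsub>M'\<^esub> y = y \<oplus>\<^bsub>M'\<^esub> x"
      using s(4)[of x0 y0, symmetric] s(4)[of y0 x0, symmetric] s(6) by (auto simp: M.a_comm)
  next
    show "\<zero>\<^bsub>M'\<^esub> \<in> carrier M'" using s(3) s(6)[OF M.zero_closed] by simp
    fix x assume "x \<in> carrier M'"
    then obtain x0 where x0: "x0 \<in> carrier M" "x = \<rho> x0" using ex by metis
    then show "\<zero>\<^bsub>M'\<^esub> \<oplus>\<^bsub>M'\<^esub> x = x"
      using s(4)[of "\<zero>\<^bsub>M\<^esub>" x0] s(3) by simp
    show "\<exists>y\<in>carrier M'. y \<oplus>\<^bsub>M'\<^esub> x = \<zero>\<^bsub>M'\<^esub>"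
      using x0 s(4)[of "\<ominus>\<^bsub>M\<^esub> x0" x0] s(3) s(6)[of "\<ominus>\<^bsub>M\<^esub> x0"]
      by (intro bexI[of _ "\<rho> (\<ominus>\<^bsub>M\<^esub> x0)"]) (auto simp: M.l_neg)
    fix y z assume "y \<in> carrier M'" "z \<in> carrier M'"
    then obtain y0 z0 where "y0 \<in> carrier M" "y = \<rho> y0" "z0 \<in> carrier M" "z = \<rho> z0"
      using ex by metis
    then show "x \<oplus>\<^bsub>M'\<^esub> y \<oplus>\<^bsub>M'\<^esub> z = x \<oplus>\<^bsub>M'\<^esub> (y \<oplus>\<^bsub>M'\<^esub> z)"
      using x0 by (simp add: s(4)[symmetric] M.a_assoc)
  qed
  moreover have "left_module_axioms R M'"
  proof
    fix x assume x: "x \<in> carrier M'"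
    obtain x0 where x0: "x0 \<in> carrier M" "x = \<rho> x0" using ex[OF x] by metis
    show "\<one>\<^bsub>R\<^esub> \<odot>\<^bsub>M'\<^esub> x = x"
      using x0 by (simp add: s(5)[symmetric] smult_one)
    fix a assume a: "a \<in> carrier R"
    show "a \<odot>\<^bsub>M'\<^esub> x \<in> carrier M'"
      using a x0 s(5)[symmetric] s(6) smult_closed by simp
    {
      fix y assume "y \<in> carrier M'"
      then obtain y0 where "y0 \<in> carrier M" "y = \<rho> y0" using ex by metis
      then show "a \<odot>\<^bsub>M'\<^esub> (x \<oplus>\<^bsub>M'\<^esub> y) = a \<odot>\<^bsub>M'\<^esub> x \<oplus>\<^bsub>M'\<^esub> a \<odot>\<^bsub>M'\<^esub> y"
        using a x0 by (simp add: s(4,5)[symmetric] smult_r_distr smult_closed)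
    }
    fix b assume "b \<in> carrier R"
    then show "(a \<oplus>\<^bsub>R\<^esub> b) \<odot>\<^bsub>M'\<^esub> x = a \<odot>\<^bsub>M'\<^esub> x \<oplus>\<^bsub>M'\<^esub> b \<odot>\<^bsub>M'\<^esub> x"
      "(a \<otimes>\<^bsub>R\<^esub> b) \<odot>\<^bsub>M'\<^esub> x = a \<odot>\<^bsub>M'\<^esub> (b \<odot>\<^bsub>M'\<^esub> x)"
      using a x0 by (simp_all add: s(4,5)[symmetric] smult_l_distr smult_assoc1 smult_closed)
  qed
  ultimately show ?thesis
    using R.ring_axioms by (simp add: left_module_def)
qed

lemma module_surj_comp:
  assumes "module_surj R M M' f" "module_surj R M' M'' g"
  shows "module_surj R M M'' (\<lambda>x. g (f x))"
proof -
  note f = module_surjD[OF assms(1)] and g = module_surjD[OF assms(2)]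
  have "(\<lambda>x. g (f x)) ` carrier M = carrier M''"
    using f(2) g(2) by (simp add: image_image[symmetric])
  then show ?thesis
    using f g by (simp add: module_surj_def)
qed

lemma submodule_image:
  assumes "module_surj R M M' \<rho>" "submodule N R M"
  shows "submodule (\<rho> ` N) R M'"
proof (rule submoduleI_left[OF left_module_surj_image[OF assms(1)]])
  note s = module_surjD[OF assms(1)] and N = submoduleD[OF assms(2)]
  show "\<rho> ` N \<subseteq> carrier M'" using s(6) N(1) by blast
  show "\<zero>\<^bsub>M'\<^esub> \<in> \<rho> ` N" using s(3) N(2) by force
  show "x \<oplus>\<^bsub>M'\<^esub> y \<in> \<rho> ` N" if "x \<in> \<rho> ` N" "y \<in> \<rho> ` N" for x y
    using that N(1,3) s(4)[symmetric] by (auto simp: subset_iff)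
  show "a \<odot>\<^bsub>M'\<^esub> x \<in> \<rho> ` N" if "a \<in> carrier R" "x \<in> \<rho> ` N" for a x
    using that N(1,4) s(5)[symmetric] by (auto simp: subset_iff)
qed

lemma submodule_vimage:
  assumes "module_surj R M M' \<rho>" "submodule N R M'"
  shows "submodule {x \<in> carrier M. \<rho> x \<in> N} R M"
proof (rule submoduleI_left[OF module_surjD(1)[OF assms(1)]])
  note s = module_surjD[OF assms(1)] and N = submoduleD[OF assms(2)]
  interpret left_module R M by (rule s(1))
  show "\<zero>\<^bsub>M\<^esub> \<in> {x \<in> carrier M. \<rho> x \<in> N}" using s(3) N(2) by simp
  show "x \<oplus>\<^bsub>M\<^esub> y \<in> {x \<in> carrier M. \<rho> x \<in> N}"
    if "x \<in> {x \<in> carrier M. \<rho> x \<in> N}" "y \<in> {x \<in> carrier M. \<rho> x \<in> N}" for x y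
    using that N(3) by (simp add: s(4))
  show "a \<odot>\<^bsub>M\<^esub> x \<in> {x \<in> carrier M. \<rho> x \<in> N}"
    if "a \<in> carrier R" "x \<in> {x \<in> carrier M. \<rho> x \<in> N}" for a x
    using that N(4) by (simp add: s(5) smult_closed)
qed auto

lemma module_surj_quotient:
  assumes M: "left_module R M" and N: "submodule N R M"
  shows "module_surj R M (quotient_module M N) (\<lambda>x. N +>\<^bsub>M\<^esub> x)"
    and "x \<in> carrier M \<Longrightarrow> N +>\<^bsub>M\<^esub> x = N \<longleftrightarrow> x \<in> N"
proof -
  interpret left_module R M by fact
  have sub: "subgroup N (add_monoid M)" using N by (simp add: submodule_def)
  interpret N: abelian_subgroup N M
    by (intro abelian_subgroupI3 additive_subgroup.intro sub M.abelian_group_axioms)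
  \<comment> \<open>The action on cosets is defined as a union over representatives; since
    \<open>N\<close> is stable under the scalar \<open>a\<close>, all members of the union are the
    same coset.\<close>
  have smult: "(\<Union>y\<in>N +>\<^bsub>M\<^esub> x. N +>\<^bsub>M\<^esub> (a \<odot>\<^bsub>M\<^esub> y)) = N +>\<^bsub>M\<^esub> (a \<odot>\<^bsub>M\<^esub> x)"
    if a: "a \<in> carrier R" and x: "x \<in> carrier M" for a x
  proof -
    have "N +>\<^bsub>M\<^esub> (a \<odot>\<^bsub>M\<^esub> y) = N +>\<^bsub>M\<^esub> (a \<odot>\<^bsub>M\<^esub> x)" if y: "y \<in> N +>\<^bsub>M\<^esub> x" for y
    proof -
      obtain h where h: "h \<in> N" "y = h \<oplus>\<^bsub>M\<^esub> x" using y by (auto simp: a_r_coset_def')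
      have "a \<odot>\<^bsub>M\<^esub> h \<in> N" using submoduleD(4)[OF N a h(1)] .
      moreover have "a \<odot>\<^bsub>M\<^esub> y = a \<odot>\<^bsub>M\<^esub> h \<oplus>\<^bsub>M\<^esub> a \<odot>\<^bsub>M\<^esub> x"
        using h a x submoduleD(1)[OF N] smult_r_distr by blast
      ultimately have "a \<odot>\<^bsub>M\<^esub> y \<in> N +>\<^bsub>M\<^esub> (a \<odot>\<^bsub>M\<^esub> x)" by (auto simp: a_r_coset_def')
      then show ?thesis using N.a_repr_independence'[of "a \<odot>\<^bsub>M\<^esub> y" "a \<odot>\<^bsub>M\<^esub> x"] a x smult_closed by simp
    qed
    moreover have "x \<in> N +>\<^bsub>M\<^esub> x" by (rule N.a_rcos_self[OF x])
    ultimately show ?thesis by blast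
  qed
  show c: "N +>\<^bsub>M\<^esub> x = N \<longleftrightarrow> x \<in> N" if "x \<in> carrier M" for x
    using that sub M.a_coset_join1 N.a_rcos_const by blast
  show "module_surj R M (quotient_module M N) (\<lambda>x. N +>\<^bsub>M\<^esub> x)"
    unfolding module_surj_def
  proof (intro conjI ballI)
    show "(\<lambda>x. N +>\<^bsub>M\<^esub> x) ` carrier M = carrier (quotient_module M N)"
      by (auto simp: quotient_module_def A_RCOSETS_def')
    show "N +>\<^bsub>M\<^esub> \<zero>\<^bsub>M\<^esub> = \<zero>\<^bsub>quotient_module M N\<^esub>"
      using submoduleD(2)[OF N] c by (simp add: quotient_module_def)
  qed (simp_all add: quotient_module_def N.a_rcos_sum smult M)
qed

section \<open>Maximal left ideals and irreducible quotients\<close>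

lemma left_module_regular:
  assumes "ring R"
  shows "left_module R (regular_module R)"
proof -
  interpret R: ring R by fact
  have "abelian_group (regular_module R)"
  proof (rule abelian_groupI)
    fix x assume "x \<in> carrier (regular_module R)"
    then show "\<exists>y\<in>carrier (regular_module R). y \<oplus>\<^bsub>regular_module R\<^esub> x = \<zero>\<^bsub>regular_module R\<^esub>"
      by (intro bexI[of _ "\<ominus>\<^bsub>R\<^esub> x"]) (auto simp: regular_module_def R.l_neg)
  qed (auto simp: regular_module_def R.a_assoc intro: R.a_comm)
  then show ?thesis
    using assms
    by (auto simp: left_module_def left_module_axioms_def regular_module_def
        R.l_distr R.r_distr R.m_assoc)
qed

text \<open>Properness is recorded as absence of the unit, a condition that survives unions of
  chains; a left ideal that contains the unit is the whole ring.\<close>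

lemma exists_maximal_left_ideal:
  assumes R: "ring R" and J0: "submodule J0 R (regular_module R)" "\<one>\<^bsub>R\<^esub> \<notin> J0"
  shows "\<exists>J. submodule J R (regular_module R) \<and> J0 \<subseteq> J \<and> \<one>\<^bsub>R\<^esub> \<notin> J \<and>
    (\<forall>J'. submodule J' R (regular_module R) \<longrightarrow> J \<subseteq> J' \<longrightarrow> J' = J \<or> J' = carrier R)"
proof -
  interpret R: ring R by fact
  let ?M = "regular_module R"
  note lm = left_module_regular[OF R]
  let ?A = "{J. submodule J R ?M \<and> J0 \<subseteq> J \<and> \<one>\<^bsub>R\<^esub> \<notin> J}"
  have "\<exists>J\<in>?A. \<forall>X\<in>?A. J \<subseteq> X \<longrightarrow> X = J"
  proof (rule subset_Zorn)
    fix C assume C: "subset.chain ?A C"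
    show "\<exists>U\<in>?A. \<forall>X\<in>C. X \<subseteq> U"
    proof (cases "C = {}")
      case True
      then show ?thesis using J0 by blast
    next
      case False
      have CA: "C \<subseteq> ?A" and ch: "\<And>X Y. X \<in> C \<Longrightarrow> Y \<in> C \<Longrightarrow> X \<subseteq> Y \<or> Y \<subseteq> X"
        using C by (auto simp: subset_chain_def)
      have "submodule (\<Union>C) R ?M"
      proof (rule submoduleI_left[OF lm])
        show "\<Union>C \<subseteq> carrier ?M" using CA submoduleD(1) by blast
        show "\<zero>\<^bsub>?M\<^esub> \<in> \<Union>C" using CA False submoduleD(2) by blast
        show "x \<oplus>\<^bsub>?M\<^esub> y \<in> \<Union>C" if xy: "x \<in> \<Union>C" "y \<in> \<Union>C" for x y
        proof -
          obtain X Y where "X \<in> C" "Y \<in> C" "x \<in> X" "y \<in> Y" using xy by blast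
          then obtain Z where Z: "Z \<in> C" "x \<in> Z" "y \<in> Z" using ch by blast
          then have "submodule Z R ?M" using CA by blast
          from submoduleD(3)[OF this Z(2,3)] show ?thesis using Z(1) by blast
        qed
        show "a \<odot>\<^bsub>?M\<^esub> x \<in> \<Union>C" if "a \<in> carrier R" "x \<in> \<Union>C" for a x
        proof -
          obtain Z where Z: "Z \<in> C" "x \<in> Z" using \<open>x \<in> \<Union>C\<close> by blast
          then have "submodule Z R ?M" using CA by blast
          from submoduleD(4)[OF this \<open>a \<in> carrier R\<close> Z(2)] show ?thesis using Z(1) by blast
        qed
      qed
      then show ?thesis using CA False by blast
    qed
  qed
  then obtain J where J: "submodule J R ?M" "J0 \<subseteq> J" "\<one>\<^bsub>R\<^esub> \<notin> J"
    and max: "\<And>X. submodule X R ?M \<Longrightarrow> J0 \<subseteq> X \<Longrightarrow> \<one>\<^bsub>R\<^esub> \<notin> X \<Longrightarrow> J \<subseteq> X \<Longrightarrow> X = J"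
    by (elim bexE CollectE conjE) blast
  have "J' = J \<or> J' = carrier R" if J': "submodule J' R ?M" "J \<subseteq> J'" for J'
  proof (cases "\<one>\<^bsub>R\<^esub> \<in> J'")
    case True
    have "x \<in> J'" if "x \<in> carrier R" for x
      using submoduleD(4)[OF J'(1) that True] that by (simp add: regular_module_def)
    moreover have "J' \<subseteq> carrier R" using submoduleD(1)[OF J'(1)] by (simp add: regular_module_def)
    ultimately show ?thesis by blast
  next
    case False
    then show ?thesis using max[OF J'(1)] J' J(2) by blast
  qed
  then show ?thesis using J by blast
qed

text \<open>A submodule of \<open>M'\<close> is the image of its preimage, and the preimage lies
  between the kernel \<open>J\<close> and \<open>M\<close>, where only the two ends are
  available.\<close>

lemma maximal_submodule_irreducible:
  assumes s: "module_surj R M M' \<rho>" and ker: "\<And>x. x \<in> carrier M \<Longrightarrow> \<rho> x = \<zero>\<^bsub>M'\<^esub> \<longleftrightarrow> x \<in> J"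
    and J: "J \<subset> carrier M" "\<And>J'. submodule J' R M \<Longrightarrow> J \<subseteq> J' \<Longrightarrow> J' = J \<or> J' = carrier M"
  shows "irreducible_module R M'"
  unfolding irreducible_module_def
proof (intro conjI allI impI)
  note S = module_surjD[OF s]
  show "left_module R M'" by (rule left_module_surj_image[OF s])
  obtain x where "x \<in> carrier M" "x \<notin> J" using J(1) by blast
  then show "carrier M' \<noteq> {\<zero>\<^bsub>M'\<^esub>}" using ker S(6) by blast
  fix N assume N: "submodule N R M'"
  let ?J = "{x \<in> carrier M. \<rho> x \<in> N}"
  have kJ: "x \<in> carrier M \<and> \<rho> x = \<zero>\<^bsub>M'\<^esub>" if "x \<in> J" for x
    using J(1) ker[of x] that by blast
  then have "J \<subseteq> ?J" using submoduleD(2)[OF N] by (simp add: subset_iff)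
  then have "?J = J \<or> ?J = carrier M" using J(2) submodule_vimage[OF s N] by blast
  moreover have "N = \<rho> ` ?J" using submoduleD(1)[OF N] S(2) by auto
  moreover have "\<rho> ` J = {\<zero>\<^bsub>M'\<^esub>}"
  proof -
    interpret left_module R M by (rule S(1))
    have "\<zero>\<^bsub>M\<^esub> \<in> J" using ker[of "\<zero>\<^bsub>M\<^esub>"] S(3) by simp
    then have "\<rho> \<zero>\<^bsub>M\<^esub> \<in> \<rho> ` J" by (rule imageI)
    then show ?thesis using kJ S(3) by (intro equalityI image_subsetI) simp_all
  qed
  ultimately show "N = {\<zero>\<^bsub>M'\<^esub>} \<or> N = carrier M'" using S(2) by (elim disjE) simp_all
qed



section \<open>Irreducible quotients of Verma modules\<close>

abbreviation yangian_class :: "nat \<Rightarrow> 'k::field falg \<Rightarrow> 'k falg set" where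
  "yangian_class n f \<equiv> yangian_ideal n +>\<^bsub>free_alg n\<^esub> f"

lemma ring_yangian_sp: "ring (yangian_sp n)"
  unfolding yangian_sp_def by (rule ideal.quotient_is_ring[OF ideal_yangian_ideal])

lemma yangian_class_simps:
  fixes f g :: "'k::field falg"
  shows "carrier (yangian_sp n :: 'k falg set ring) = yangian_class n ` carrier (free_alg n)"
    and "yangian_class n (1 :: 'k falg) = \<one>\<^bsub>yangian_sp n\<^esub>"
    and "yangian_class n (0 :: 'k falg) = \<zero>\<^bsub>yangian_sp n\<^esub>"
    and "\<lbrakk>f \<in> carrier (free_alg n); g \<in> carrier (free_alg n)\<rbrakk> \<Longrightarrow>
      yangian_class n (f * g) = yangian_class n f \<otimes>\<^bsub>yangian_sp n\<^esub> yangian_class n g"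
    and "\<lbrakk>f \<in> carrier (free_alg n); g \<in> carrier (free_alg n)\<rbrakk> \<Longrightarrow>
      yangian_class n (f + g) = yangian_class n f \<oplus>\<^bsub>yangian_sp n\<^esub> yangian_class n g"
    and "\<lbrakk>f \<in> carrier (free_alg n); g \<in> carrier (free_alg n)\<rbrakk> \<Longrightarrow>
      yangian_class n (f - g) = yangian_class n f \<ominus>\<^bsub>yangian_sp n\<^esub> yangian_class n g"
    and "\<lbrakk>f \<in> carrier (free_alg n); g \<in> carrier (free_alg n); yangian_class n f = yangian_class n g\<rbrakk> \<Longrightarrow>
      f - g \<in> yangian_ideal n"
proof -
  interpret I: ideal "yangian_ideal n :: 'k falg set" "free_alg n" by (rule ideal_yangian_ideal)
  interpret Y: ring "yangian_sp n :: 'k falg set ring" by (rule ring_yangian_sp)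
  show car: "carrier (yangian_sp n :: 'k falg set ring) = yangian_class n ` carrier (free_alg n)"
    by (auto simp: yangian_sp_def FactRing_def A_RCOSETS_def')
  show "yangian_class n (1 :: 'k falg) = \<one>\<^bsub>yangian_sp n\<^esub>"
    by (simp add: yangian_sp_def FactRing_def)
  have z: "0 \<in> (yangian_ideal n :: 'k falg set)"
    using additive_subgroup.zero_closed[OF I.is_additive_subgroup] by simp
  show zero: "yangian_class n (0 :: 'k falg) = \<zero>\<^bsub>yangian_sp n\<^esub>"
    using I.a_rcos_const[OF z] by (simp add: yangian_sp_def FactRing_def)
  show "yangian_class n (f * g) = yangian_class n f \<otimes>\<^bsub>yangian_sp n\<^esub> yangian_class n g"
    if "f \<in> carrier (free_alg n)" "g \<in> carrier (free_alg n)"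
    using I.rcoset_mult_add[OF that] by (simp add: yangian_sp_def FactRing_def)
  have add: "yangian_class n (f + g) = yangian_class n f \<oplus>\<^bsub>yangian_sp n\<^esub> yangian_class n g"
    if "f \<in> carrier (free_alg n)" "g \<in> carrier (free_alg n)" for f g :: "'k falg"
    using I.a_rcos_sum[OF that] by (simp add: yangian_sp_def FactRing_def)
  then show "yangian_class n (f + g) = yangian_class n f \<oplus>\<^bsub>yangian_sp n\<^esub> yangian_class n g"
    if "f \<in> carrier (free_alg n)" "g \<in> carrier (free_alg n)"
    using that by blast
  have cl: "yangian_class n f \<in> carrier (yangian_sp n)" if "f \<in> carrier (free_alg n)" for f :: "'k falg"
    using that car by blast
  show "yangian_class n (f - g) = yangian_class n f \<ominus>\<^bsub>yangian_sp n\<^esub> yangian_class n g"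
    if f: "f \<in> carrier (free_alg n)" and g: "g \<in> carrier (free_alg n)"
  proof -
    have "yangian_class n (- g) \<oplus>\<^bsub>yangian_sp n\<^esub> yangian_class n g = \<zero>\<^bsub>yangian_sp n\<^esub>"
      using add[of "- g" g] g free_alg_closed(5)[OF g] zero by simp
    then have "\<ominus>\<^bsub>yangian_sp n\<^esub> yangian_class n g = yangian_class n (- g)"
      by (rule Y.minus_equality) (use cl g free_alg_closed(5) in blast)+
    then show ?thesis
      using add[of f "- g"] f free_alg_closed(5)[OF g] by (simp add: a_minus_def)
  qed
  show "f - g \<in> yangian_ideal n"
    if "f \<in> carrier (free_alg n)" "g \<in> carrier (free_alg n)" "yangian_class n f = yangian_class n g"
  proof -
    have "f \<in> yangian_class n g" using I.a_rcos_self[OF that(1)] that(3) by simp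
    then obtain h where "h \<in> yangian_ideal n" "f = h + g" by (auto simp: a_r_coset_def')
    then show ?thesis by simp
  qed
qed

lemma regular_module_simps [simp]:
  "carrier (regular_module R) = carrier R" "add (regular_module R) = add R"
  "zero (regular_module R) = zero R" "smult (regular_module R) = mult R"
  by (simp_all add: regular_module_def)

lemma scal_simps: "scal (c + d) = scal c + scal d" "scal 0 = 0"
  using ring_map.add[of scal] ring_map.zero[of scal] scal_scalar_map scalar_map.axioms(1) by auto

text \<open>The preimage J0 of K is a proper left ideal of the Yangian that contains the generators
  of the Verma left ideal L. With J maximal above J0, the representation is realised as (Y/L)/(J/L),
  the two-step form that the definition prescribes, and \<open>\<rho>\<close> identifies it with
  Y/J.\<close>

lemma exists_irreducible_highest_weight_rep:
  fixes \<phi> :: "'k::field falg \<Rightarrow> 'r::ring_1" and \<mu> :: "nat \<Rightarrow> 'k fps"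
  assumes \<phi>: "ring_map \<phi>" and K: "left_ideal K" "1 \<notin> K"
    and I: "\<And>f. f \<in> yangian_ideal n \<Longrightarrow> \<phi> f = 0"
    and raising: "\<And>i j r. \<lbrakk>i \<in> index_set n; j \<in> index_set n; i < j\<rbrakk> \<Longrightarrow> \<phi> (gen_s i j r) \<in> K"
    and diagonal: "\<And>i r. i \<in> {1..n} \<Longrightarrow>
      \<phi> (gen_s (int i) (int i) r) - \<phi> (scal (fps_nth (\<mu> i) r)) \<in> K"
    and spanning: "\<exists>B\<subseteq>carrier (free_alg n). finite B \<and>
      (\<forall>f\<in>carrier (free_alg n). \<exists>c. \<phi> f - \<phi> (\<Sum>b\<in>B. scal (c b) * b) \<in> K)"
  shows "\<exists>V. irreducible_highest_weight_rep n \<mu> V \<and> finite_dimensional_rep n V"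
proof -
  let ?A = "free_alg n :: 'k falg ring" and ?Y = "yangian_sp n :: 'k falg set ring"
  let ?q = "yangian_class n :: 'k falg \<Rightarrow> 'k falg set" and ?M = "regular_module (yangian_sp n :: 'k falg set ring)"
  interpret p: ring_map \<phi> by fact
  interpret Y: ring ?Y by (rule ring_yangian_sp)
  note K' = left_idealD[OF K(1)] and q = yangian_class_simps[where n = n and ?'k = 'k]
  have M: "left_module ?Y ?M" by (rule left_module_regular[OF ring_yangian_sp])
  have qc: "?q f \<in> carrier ?Y" if "f \<in> carrier ?A" for f using that q(1) by blast
  have i1: "int i \<in> index_set n" if "i \<in> {1..n}" for i using that by (auto simp: index_set_def)

  define J0 where "J0 = {?q f | f. f \<in> carrier ?A \<and> \<phi> f \<in> K}"
  \<comment> \<open>Membership depends only on the class, because \<open>\<phi>\<close> vanishes on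
    the ideal of relations.\<close>
  have J0_iff: "?q f \<in> J0 \<longleftrightarrow> \<phi> f \<in> K" if f: "f \<in> carrier ?A" for f
  proof
    assume "?q f \<in> J0"
    then obtain g where g: "g \<in> carrier ?A" "\<phi> g \<in> K" "?q f = ?q g" by (auto simp: J0_def)
    then have "\<phi> (f - g) = 0" using I q(7)[OF f g(1)] by blast
    then show "\<phi> f \<in> K" using g(2) by (simp add: p.diff)
  qed (use f in \<open>auto simp: J0_def\<close>)
  have J0: "submodule J0 ?Y ?M"
  proof (rule submoduleI_left[OF M])
    show "J0 \<subseteq> carrier ?M" using qc by (auto simp: J0_def)
    show "\<zero>\<^bsub>?M\<^esub> \<in> J0" using J0_iff[OF free_alg_closed(2)] q(3) K'(1) p.zero by simp
    show "x \<oplus>\<^bsub>?M\<^esub> y \<in> J0" if xy: "x \<in> J0" "y \<in> J0" for x y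
    proof -
      obtain f g where "f \<in> carrier ?A" "\<phi> f \<in> K" "x = ?q f" "g \<in> carrier ?A" "\<phi> g \<in> K" "y = ?q g"
        using xy by (auto simp: J0_def)
      then show ?thesis
        using J0_iff[of "f + g"] q(5)[of f g] K'(2) by (simp add: p.add free_alg_closed(6))
    qed
    show "a \<odot>\<^bsub>?M\<^esub> x \<in> J0" if ax: "a \<in> carrier ?Y" "x \<in> J0" for a x
    proof -
      obtain f g where "f \<in> carrier ?A" "a = ?q f" "g \<in> carrier ?A" "\<phi> g \<in> K" "x = ?q g"
        using ax q(1) by (auto simp: J0_def)
      then show ?thesis
        using J0_iff[of "f * g"] q(4)[of f g] K'(3) by (simp add: p.mult free_alg_closed(4))
    qed
  qed
  have "\<one>\<^bsub>?Y\<^esub> \<notin> J0" using J0_iff[OF free_alg_closed(1)] q(2) K(2) p.one by simp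
  then obtain J where J: "submodule J ?Y ?M" "J0 \<subseteq> J" "\<one>\<^bsub>?Y\<^esub> \<notin> J"
    and J_max: "\<And>J'. submodule J' ?Y ?M \<Longrightarrow> J \<subseteq> J' \<Longrightarrow> J' = J \<or> J' = carrier ?Y"
    using exists_maximal_left_ideal[OF ring_yangian_sp J0] by blast

  define G where "G = {Y_s n i j r | i j r. i \<in> index_set n \<and> j \<in> index_set n \<and> i < j} \<union>
      {Y_s n (int i) (int i) r \<ominus>\<^bsub>?Y\<^esub> Y_scal n (fps_nth (\<mu> i) r) | i r. i \<in> {1..n}}"
  define L where "L = verma_left_ideal n \<mu>"
  have LG: "L = generated_submodule ?Y ?M G" by (simp add: L_def verma_left_ideal_def G_def)
  have GJ0: "G \<subseteq> J0"
  proof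
    fix x assume "x \<in> G"
    then consider i j r where "x = Y_s n i j r" "i \<in> index_set n" "j \<in> index_set n" "i < j"
      | i r where "x = Y_s n (int i) (int i) r \<ominus>\<^bsub>?Y\<^esub> Y_scal n (fps_nth (\<mu> i) r)" "i \<in> {1..n}"
      by (auto simp: G_def)
    then show "x \<in> J0"
    proof cases
      case 1
      then show ?thesis using J0_iff[OF gen_s_in_free_alg] raising by (simp add: Y_s_def)
    next
      case 2
      then show ?thesis
        using J0_iff[OF free_alg_closed(3)] diagonal i1
        by (simp add: Y_s_def Y_scal_def q(6)[symmetric] gen_s_in_free_alg scal_in_free_alg p.diff)
    qed
  qed
  have Gc: "G \<subseteq> carrier ?M" using GJ0 submoduleD(1)[OF J0] by blast
  have L: "submodule L ?Y ?M" "G \<subseteq> L" "L \<subseteq> J"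
    unfolding LG using submodule_generated[OF M Gc] GJ0 J0 J(2) by blast+

  define W where "W = verma_module n \<mu>"
  define \<pi> where "\<pi> = (\<lambda>y. L +>\<^bsub>?M\<^esub> y)"
  have W: "W = quotient_module ?M L" by (simp add: W_def verma_module_def L_def)
  have \<pi>: "module_surj ?Y ?M W \<pi>" and \<pi>0: "\<And>y. y \<in> carrier ?Y \<Longrightarrow> \<pi> y = L \<longleftrightarrow> y \<in> L"
    unfolding W \<pi>_def using module_surj_quotient[OF M L(1)] by auto
  have LW: "left_module ?Y W" by (rule left_module_surj_image[OF \<pi>])
  define N where "N = \<pi> ` J"
  have N: "submodule N ?Y W" unfolding N_def by (rule submodule_image[OF \<pi> J(1)])
  define V where "V = quotient_module W N"
  define \<rho> where "\<rho> = (\<lambda>y. N +>\<^bsub>W\<^esub> \<pi> y)"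
  have \<rho>: "module_surj ?Y ?M V \<rho>"
    unfolding \<rho>_def V_def by (rule module_surj_comp[OF \<pi> module_surj_quotient(1)[OF LW N]])
  note r = module_surjD[OF \<rho>]
  interpret V: left_module ?Y V by (rule left_module_surj_image[OF \<rho>])
  have JY: "J \<subseteq> carrier ?Y" using submoduleD(1)[OF J(1)] by simp
  \<comment> \<open>If y and some z in J have the same class modulo L, then y - z lies in L, hence
    in J, and so does y.\<close>
  have ker: "\<rho> y = \<zero>\<^bsub>V\<^esub> \<longleftrightarrow> y \<in> J" if y: "y \<in> carrier ?Y" for y
  proof -
    have "\<rho> y = \<zero>\<^bsub>V\<^esub> \<longleftrightarrow> \<pi> y \<in> N"
      unfolding \<rho>_def V_def using module_surj_quotient(2)[OF LW N] module_surjD(6)[OF \<pi>, of y] y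
      by (simp add: quotient_module_def)
    also have "\<dots> \<longleftrightarrow> y \<in> J"
    proof
      assume "\<pi> y \<in> N"
      then obtain z where z: "z \<in> J" "\<pi> y = \<pi> z" by (auto simp: N_def)
      have zc: "z \<in> carrier ?Y" using z JY by blast
      interpret W: left_module ?Y W by (rule LW)
      have "\<pi> (y \<ominus>\<^bsub>?Y\<^esub> z) \<oplus>\<^bsub>W\<^esub> \<pi> z = \<pi> z"
      proof -
        have "\<pi> (y \<ominus>\<^bsub>?Y\<^esub> z) \<oplus>\<^bsub>W\<^esub> \<pi> z = \<pi> (y \<ominus>\<^bsub>?Y\<^esub> z \<oplus>\<^bsub>?Y\<^esub> z)"
          using module_surjD(4)[OF \<pi>, of "y \<ominus>\<^bsub>?Y\<^esub> z" z] y zc by simp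
        also have "y \<ominus>\<^bsub>?Y\<^esub> z \<oplus>\<^bsub>?Y\<^esub> z = y"
          using y zc by (simp add: a_minus_def Y.a_assoc Y.l_neg)
        finally show ?thesis using z by simp
      qed
      then have "\<pi> (y \<ominus>\<^bsub>?Y\<^esub> z) = \<zero>\<^bsub>W\<^esub>"
        using module_surjD(6)[OF \<pi>, of z] module_surjD(6)[OF \<pi>, of "y \<ominus>\<^bsub>?Y\<^esub> z"] y zc
        by (simp add: W.M.add.r_cancel_one)
      then have "y \<ominus>\<^bsub>?Y\<^esub> z \<in> L" using \<pi>0[of "y \<ominus>\<^bsub>?Y\<^esub> z"] y zc by (simp add: W quotient_module_def)
      then have "y \<ominus>\<^bsub>?Y\<^esub> z \<oplus>\<^bsub>?Y\<^esub> z \<in> J"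
        using submoduleD(3)[OF J(1), of "y \<ominus>\<^bsub>?Y\<^esub> z" z] L(3) z by auto
      then show "y \<in> J" using y zc by (simp add: a_minus_def Y.a_assoc Y.l_neg)
    qed (auto simp: N_def)
    finally show ?thesis .
  qed
  have irr: "irreducible_module ?Y V"
  proof (rule maximal_submodule_irreducible[OF \<rho>])
    show "J \<subset> carrier ?M" using JY J(3) Y.one_closed by auto
  qed (use ker J_max in auto)

  let ?\<xi> = "\<rho> \<one>\<^bsub>?Y\<^esub>"
  have act: "y \<odot>\<^bsub>V\<^esub> ?\<xi> = \<rho> y" if "y \<in> carrier ?Y" for y
    using r(5)[of y "\<one>\<^bsub>?Y\<^esub>"] that by simp
  have \<xi>: "?\<xi> \<in> carrier V" using r(6) by simp
  have hw: "highest_weight_rep n \<mu> V"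
    unfolding highest_weight_rep_def
  proof (intro conjI bexI[of _ ?\<xi>] ballI impI allI)
    show "left_module ?Y V" by (rule V.left_module_axioms)
    show "?\<xi> \<noteq> \<zero>\<^bsub>V\<^esub>" using ker J(3) by simp
    have "carrier V \<subseteq> generated_submodule ?Y V {?\<xi>}"
    proof
      fix x assume "x \<in> carrier V"
      then obtain y where y: "y \<in> carrier ?Y" "x = \<rho> y" using r(2) by auto
      have "y \<odot>\<^bsub>V\<^esub> ?\<xi> \<in> generated_submodule ?Y V {?\<xi>}"
        using submodule_generated[OF V.left_module_axioms, of "{?\<xi>}"] \<xi>
        by (intro submoduleD(4)[OF _ y(1)]) auto
      then show "x \<in> generated_submodule ?Y V {?\<xi>}" using act y by simp
    qed
    then show "generated_submodule ?Y V {?\<xi>} = carrier V"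
      using submoduleD(1)[OF submodule_generated(1)[OF V.left_module_axioms, of "{?\<xi>}"]] \<xi> by auto
    show "Y_s n i j k \<odot>\<^bsub>V\<^esub> ?\<xi> = \<zero>\<^bsub>V\<^esub>" if "i \<in> index_set n" "j \<in> index_set n" "i < j" for i j k
    proof -
      have "Y_s n i j k \<in> G" using that by (auto simp: G_def)
      then show ?thesis using act ker L(2,3) JY by blast
    qed
    show "Y_s n (int i) (int i) k \<odot>\<^bsub>V\<^esub> ?\<xi> = Y_scal n (fps_nth (\<mu> i) k) \<odot>\<^bsub>V\<^esub> ?\<xi>" if i: "i \<in> {1..n}" for i k
    proof -
      let ?s = "Y_s n (int i) (int i) k :: 'k falg set" and ?c = "Y_scal n (fps_nth (\<mu> i) k)"
      have c: "?s \<in> carrier ?Y" "?c \<in> carrier ?Y"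
        using qc gen_s_in_free_alg[OF i1[OF i] i1[OF i]] scal_in_free_alg by (auto simp: Y_s_def Y_scal_def)
      have "?s \<ominus>\<^bsub>?Y\<^esub> ?c \<in> G" using i by (auto simp: G_def)
      then have "\<rho> (?s \<ominus>\<^bsub>?Y\<^esub> ?c) = \<zero>\<^bsub>V\<^esub>" using ker L(2,3) JY by blast
      moreover have "\<rho> (?s \<ominus>\<^bsub>?Y\<^esub> ?c \<oplus>\<^bsub>?Y\<^esub> ?c) = \<rho> (?s \<ominus>\<^bsub>?Y\<^esub> ?c) \<oplus>\<^bsub>V\<^esub> \<rho> ?c"
        using r(4)[of "?s \<ominus>\<^bsub>?Y\<^esub> ?c" ?c] c by simp
      moreover have "?s \<ominus>\<^bsub>?Y\<^esub> ?c \<oplus>\<^bsub>?Y\<^esub> ?c = ?s"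
        using c by (simp add: a_minus_def Y.a_assoc Y.l_neg)
      ultimately show ?thesis using act c r(6) by simp
    qed
  qed (rule \<xi>)

  have fd: "finite_dimensional_rep n V"
  proof -
    obtain B where B: "B \<subseteq> carrier ?A" "finite B"
      and span: "\<And>f. f \<in> carrier ?A \<Longrightarrow> \<exists>c. \<phi> f - \<phi> (\<Sum>b\<in>B. scal (c b) * b) \<in> K"
      using spanning by blast
    define \<sigma> where "\<sigma> = (\<lambda>f. \<rho> (?q f))"
    let ?T = "\<sigma> ` B"
    have \<sigma>c: "\<sigma> f \<in> carrier V" if "f \<in> carrier ?A" for f using that qc r(6) by (simp add: \<sigma>_def)
    have \<sigma>_add: "\<sigma> (f + g) = \<sigma> f \<oplus>\<^bsub>V\<^esub> \<sigma> g" if "f \<in> carrier ?A" "g \<in> carrier ?A" for f g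
      using that qc r(4) by (simp add: \<sigma>_def q(5))
    have \<sigma>_scal: "\<sigma> (scal c * f) = Y_scal n c \<odot>\<^bsub>V\<^esub> \<sigma> f" if "f \<in> carrier ?A" for c f
      using that qc r(5) by (simp add: \<sigma>_def q(4) Y_scal_def scal_in_free_alg)
    have sc: "Y_scal n c \<in> carrier ?Y" for c :: 'k
      using qc by (simp add: Y_scal_def scal_in_free_alg)
    have Tc: "?T \<subseteq> carrier V" using \<sigma>c B(1) by blast
    \<comment> \<open>Distinct elements of B may have the same image under \<open>\<sigma>\<close>,
      so the coefficients of coinciding images are added up.\<close>
    have lin: "\<exists>c'. \<sigma> (\<Sum>b\<in>B1. scal (c b) * b) = (\<Oplus>\<^bsub>V\<^esub>t\<in>?T. Y_scal n (c' t) \<odot>\<^bsub>V\<^esub> t)"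
      if "finite B1" "B1 \<subseteq> B" for B1 c
      using that
    proof (induction B1 rule: finite_induct)
      case empty
      have "\<sigma> 0 = \<zero>\<^bsub>V\<^esub>" using r(3) q(3) by (simp add: \<sigma>_def)
      moreover have "(\<Oplus>\<^bsub>V\<^esub>t\<in>?T. Y_scal n 0 \<odot>\<^bsub>V\<^esub> t) = (\<Oplus>\<^bsub>V\<^esub>t\<in>?T. \<zero>\<^bsub>V\<^esub>)"
        using Tc V.smult_zero q(3)
        by (intro V.M.finsum_cong') (auto simp: Y_scal_def scal_simps)
      ultimately show ?case by (intro exI[of _ "\<lambda>t. 0"]) simp
    next
      case (insert b B1)
      then obtain c' where c': "\<sigma> (\<Sum>b\<in>B1. scal (c b) * b) = (\<Oplus>\<^bsub>V\<^esub>t\<in>?T. Y_scal n (c' t) \<odot>\<^bsub>V\<^esub> t)"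
        by auto
      have b: "b \<in> carrier ?A" "\<sigma> b \<in> ?T" using insert.prems B(1) by auto
      let ?d = "\<lambda>t. if \<sigma> b = t then c b else 0"
      have cl: "(\<lambda>t. Y_scal n (e t) \<odot>\<^bsub>V\<^esub> t) \<in> ?T \<rightarrow> carrier V" for e
        using Tc sc V.smult_closed by auto
      have "\<sigma> (\<Sum>b\<in>insert b B1. scal (c b) * b) = \<sigma> (scal (c b) * b) \<oplus>\<^bsub>V\<^esub> \<sigma> (\<Sum>b\<in>B1. scal (c b) * b)"
      proof -
        have "(\<Sum>b\<in>B1. scal (c b) * b) \<in> carrier ?A"
          by (intro unital_subring_sum[OF unital_subring_free_alg] free_alg_closed(4) scal_in_free_alg)
            (use insert.prems B(1) in blast)
        then show ?thesis
          using insert.hyps \<sigma>_add[OF free_alg_closed(4)[OF scal_in_free_alg b(1)]] by simp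
      qed
      also have "\<sigma> (scal (c b) * b) = (\<Oplus>\<^bsub>V\<^esub>t\<in>?T. Y_scal n (?d t) \<odot>\<^bsub>V\<^esub> t)"
      proof -
        have "(\<Oplus>\<^bsub>V\<^esub>t\<in>?T. Y_scal n (?d t) \<odot>\<^bsub>V\<^esub> t) =
            (\<Oplus>\<^bsub>V\<^esub>t\<in>?T. if \<sigma> b = t then Y_scal n (c b) \<odot>\<^bsub>V\<^esub> t else \<zero>\<^bsub>V\<^esub>)"
          using Tc sc V.smult_closed V.smult_zero q(3)
          by (intro V.M.finsum_cong') (auto simp: Y_scal_def scal_simps)
        also have "\<dots> = Y_scal n (c b) \<odot>\<^bsub>V\<^esub> \<sigma> b"
          by (rule V.M.finsum_singleton) (use b(2) B(2) cl[of "\<lambda>_. c b"] in auto)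
        finally show ?thesis using \<sigma>_scal[OF b(1)] by simp
      qed
      also have "\<dots> \<oplus>\<^bsub>V\<^esub> \<sigma> (\<Sum>b\<in>B1. scal (c b) * b) =
          (\<Oplus>\<^bsub>V\<^esub>t\<in>?T. Y_scal n (?d t) \<odot>\<^bsub>V\<^esub> t \<oplus>\<^bsub>V\<^esub> Y_scal n (c' t) \<odot>\<^bsub>V\<^esub> t)"
        unfolding c' by (rule V.M.finsum_addf[symmetric]) (rule cl)+
      also have "\<dots> = (\<Oplus>\<^bsub>V\<^esub>t\<in>?T. Y_scal n (?d t + c' t) \<odot>\<^bsub>V\<^esub> t)"
      proof (rule V.M.finsum_cong'[OF refl cl])
        fix t assume "t \<in> ?T"
        then have t: "t \<in> carrier V" using Tc by blast
        have "Y_scal n (?d t + c' t) = Y_scal n (?d t) \<oplus>\<^bsub>?Y\<^esub> Y_scal n (c' t)"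
          by (simp add: Y_scal_def scal_simps q(5)[symmetric] scal_in_free_alg)
        then show "Y_scal n (?d t) \<odot>\<^bsub>V\<^esub> t \<oplus>\<^bsub>V\<^esub> Y_scal n (c' t) \<odot>\<^bsub>V\<^esub> t = Y_scal n (?d t + c' t) \<odot>\<^bsub>V\<^esub> t"
          using V.smult_l_distr[OF sc sc t] by simp
      qed
      finally show ?case by (rule exI[of _ "\<lambda>t. ?d t + c' t"])
    qed
    have "\<exists>c. x = (\<Oplus>\<^bsub>V\<^esub>t\<in>?T. Y_scal n (c t) \<odot>\<^bsub>V\<^esub> t)" if x: "x \<in> carrier V" for x
    proof -
      obtain y where y: "y \<in> carrier ?Y" "x = \<rho> y" using x r(2) by auto
      then obtain f where f: "f \<in> carrier ?A" "x = \<sigma> f" using q(1) by (auto simp: \<sigma>_def)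
      obtain c where c: "\<phi> f - \<phi> (\<Sum>b\<in>B. scal (c b) * b) \<in> K" using span[OF f(1)] by blast
      let ?s = "\<Sum>b\<in>B. scal (c b) * b"
      have s: "?s \<in> carrier ?A"
        by (intro unital_subring_sum[OF unital_subring_free_alg] free_alg_closed(4) scal_in_free_alg)
          (use B(1) in blast)
      \<comment> \<open>The spanning relation holds modulo J0, hence modulo the larger J.\<close>
      have "?q (f - ?s) \<in> J"
        using J0_iff[OF free_alg_closed(3)[OF f(1) s]] c J(2) by (auto simp: p.diff)
      then have "\<sigma> (f - ?s) = \<zero>\<^bsub>V\<^esub>"
        using ker[OF qc[OF free_alg_closed(3)[OF f(1) s]]] by (simp add: \<sigma>_def)
      then have "\<sigma> f = \<sigma> ?s"
        using \<sigma>_add[OF free_alg_closed(3)[OF f(1) s] s] \<sigma>c[OF s] by simp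
      then show ?thesis using lin[OF B(2) order_refl, of c] f(2) by auto
    qed
    then show ?thesis
      unfolding finite_dimensional_rep_def using B(2) Tc by (intro exI[of _ ?T]) auto
  qed
  show ?thesis
    using hw irr fd N unfolding irreducible_highest_weight_rep_def V_def W_def by blast
qed



section \<open>Prescribed ratios of the highest weight\<close>

text \<open>The pair holds the pole and the filling level of one copy, that is,
  \<open>\<beta> m\<close> and \<open>d m\<close>; the value is the corresponding factor of
  \<open>weight\<close>.\<close>

definition copy_weight :: "int \<Rightarrow> 'k::field \<times> int \<Rightarrow> 'k fls" where
  "copy_weight i c = (1 + of_bool (i \<le> snd c) * (1 / (fls_X_inv - fls_const (fst c)))) *
     (1 + of_bool (- i \<le> snd c) * (1 / (- fls_X_inv - fls_const (fst c))))"

definition list_weight :: "int \<Rightarrow> ('k::field \<times> int) list \<Rightarrow> 'k fls" where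
  "list_weight i cs = prod_list (map (copy_weight i) cs)"

lemma starts_with_list_weight: "starts_with 1 (list_weight i cs)"
proof (induction cs)
  case Nil
  show ?case by (simp add: list_weight_def starts_with_def)
next
  case (Cons c cs)
  have one: "starts_with 1 1" by (simp add: starts_with_def)
  have pole: "starts_with 0 (of_bool e * (1 / (fls_X_inv - fls_const b)))"
    "starts_with 0 (of_bool e * (1 / (- fls_X_inv - fls_const b)))" for e and b :: 'a
    using starts_with_linear_inverse[of b] by (cases e; simp add: starts_with_def)+
  have "starts_with 1 (copy_weight i c)"
    unfolding copy_weight_def
    using starts_with_mult[OF starts_with_add[OF one pole(1)] starts_with_add[OF one pole(2)]] by simp
  then show ?case
    using starts_with_mult[OF _ Cons.IH] by (fastforce simp: list_weight_def)
qed

lemma exists_rep_with_list_weight: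
  fixes cs :: "('k::field \<times> int) list"
  assumes two: "(2 :: 'k) \<noteq> 0"
  shows "\<exists>V. irreducible_highest_weight_rep n (\<lambda>i. fls_regpart (list_weight (int i) cs)) V \<and>
    finite_dimensional_rep n V"
proof -
  define M where "M = length cs"
  define \<beta> where "\<beta> = (\<lambda>m. fst (cs ! m))"
  \<comment> \<open>Past the end of the list these values are unspecified. They concern copies with
    number at least M, which do not occur in \<open>dressed M\<close>.\<close>
  define d where "d = (\<lambda>m. snd (cs ! m))"
  interpret gl_copies fock_scalar n hop \<beta> by (rule gl_copies_hop[OF two])
  let ?K = "vacuum_ideal n d :: 'k fock_op set"
  have weight: "weight d M i = list_weight i cs" for i
    unfolding weight_def
    by (simp add: list_weight_def prod.list_conv_set_nth atLeast0LessThan copy_weight_def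
        M_def \<beta>_def d_def)
  interpret e: ring_map "dressed_eval M" by (rule ring_map_dressed_eval)
  have hw1: "dressed M i j \<in> fls_over ?K" if "i \<in> index_set n" "j \<in> index_set n" "i < j" for i j
    by (rule dressed_highest_weight(1)[where d = d])
      (assumption | rule left_ideal_vacuum_ideal hop_vacuum that)+
  have hw2: "dressed M i i - series (weight d M i) \<in> fls_over ?K" if "i \<in> index_set n" "0 < i" for i
    by (rule dressed_highest_weight(2)) (assumption | rule left_ideal_vacuum_ideal hop_vacuum that)+
  show ?thesis
  proof (rule exists_irreducible_highest_weight_rep[OF ring_map_dressed_eval[of M], of ?K])
    show "left_ideal ?K" by (rule left_ideal_vacuum_ideal)
    show "1 \<notin> ?K" by (rule one_notin_vacuum_ideal)
    show "dressed_eval M f = 0" if "f \<in> yangian_ideal n" for f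
      by (rule dressed_eval_yangian_ideal[OF that])
    show "dressed_eval M (gen_s i j r) \<in> ?K"
      if "i \<in> index_set n" "j \<in> index_set n" "i < j" for i j r
      using hw1[OF that] that by (simp add: dressed_eval_gen_s fls_over_def)
    show "dressed_eval M (gen_s (int i) (int i) r) -
        dressed_eval M (scal (fps_nth (fls_regpart (list_weight (int i) cs)) r)) \<in> ?K"
      if "i \<in> {1..n}" for i r
    proof -
      have i: "int i \<in> index_set n" "0 < int i" using that by (auto simp: index_set_def)
      have "dressed M (int i) (int i) - series (weight d M (int i)) \<in> fls_over ?K"
        by (rule hw2[OF i])
      then have "fls_nth (dressed M (int i) (int i)) (int r) -
          fock_scalar (fls_nth (weight d M (int i)) (int r)) \<in> ?K"
        by (simp add: fls_over_def fls_nth_map_fls zero)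
      then show ?thesis
        using i by (simp add: dressed_eval_gen_s dressed_eval_scal weight)
    qed
    let ?C = "carrier (free_alg n) :: 'k falg set"
    have pres: "dressed_eval M ` ?C \<subseteq> preservers (configurations n M d)"
    proof (rule image_subsetI)
      fix f :: "'k falg" assume f: "f \<in> ?C"
      show "dressed_eval M f \<in> preservers (configurations n M d)"
        unfolding dressed_eval_def
      proof (rule falg_eval_in_subring[OF unital_subring_preservers fock_scalar_preserves])
        fix w x assume "w \<in> Poly_Mapping.keys f" "x \<in> set (letters w)"
        then obtain i j r where x: "x = (i, j, r)" "i \<in> index_set n" "j \<in> index_set n"
          using f by (fastforce simp: carrier_free_alg)
        have "dressed M i j \<in> fls_over (preservers (configurations n M d))"
          by (rule dressed_over[OF unital_subring_preservers fock_scalar_preserves hop_preserves order_refl x(2,3)])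
        then show "(\<lambda>(i, j, r). fls_nth (dressed M i j) (int r)) x \<in> preservers (configurations n M d)"
          by (simp add: x fls_over_def)
      qed
    qed
    have "dressed_eval M (\<Sum>b\<in>B. scal (c b) * b) = (\<Sum>b\<in>B. fock_scalar (c b) * dressed_eval M b)" for B c
      by (simp add: e.sum e.mult dressed_eval_scal)
    then show "\<exists>B\<subseteq>?C. finite B \<and>
        (\<forall>f\<in>?C. \<exists>c. dressed_eval M f - dressed_eval M (\<Sum>b\<in>B. scal (c b) * b) \<in> ?K)"
      using finite_spanning_mod_vacuum_ideal[OF pres] by (simp only:)
  qed
qed

section \<open>Ratios of the weights\<close>

lemma prod_list_map_filter:
  "prod_list (map (\<lambda>c. if Q c then g c else 1) cs) = (prod_list (map g (filter Q cs)) :: 'a::comm_monoid_mult)"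
  by (induction cs) auto

lemma prod_list_map_mult:
  "prod_list (map (\<lambda>c. f c * g c) cs) = prod_list (map f cs) * (prod_list (map g cs) :: 'a::comm_monoid_mult)"
  by (induction cs) (simp_all add: mult_ac)

text \<open>Only the level i separates the indices i and i + 1. The second factor of a copy is the
  same at all positive indices, since every level is at least -1.\<close>

lemma list_weight_Suc:
  "list_weight (int i) cs = list_weight (int (i + 1)) cs *
     prod_list (map (\<lambda>c. 1 + 1 / (fls_X_inv - fls_const (fst c))) (filter (\<lambda>c. snd c = int i) cs))"
  if "\<And>c. c \<in> set cs \<Longrightarrow> - 1 \<le> snd c" "1 \<le> i"
proof -
  let ?h = "\<lambda>c. if snd c = int i then 1 + 1 / (fls_X_inv - fls_const (fst c)) else 1"
  have "copy_weight (int i) c = copy_weight (int (i + 1)) c * ?h c" if "c \<in> set cs" for c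
  proof -
    have "- 1 \<le> snd c" using \<open>\<And>c. c \<in> set cs \<Longrightarrow> - 1 \<le> snd c\<close> that .
    then have "of_bool (- int i \<le> snd c) = (1 :: 'a fls)" "of_bool (- int (i + 1) \<le> snd c) = (1 :: 'a fls)"
      using \<open>1 \<le> i\<close> by auto
    moreover have "of_bool (int i \<le> snd c) = (of_bool (snd c = int i \<or> int (i + 1) \<le> snd c) :: 'a fls)"
      by (rule arg_cong[of _ _ of_bool]) auto
    ultimately show ?thesis by (auto simp: copy_weight_def)
  qed
  then have "map (copy_weight (int i)) cs = map (\<lambda>c. copy_weight (int (i + 1)) c * ?h c) cs"
    by simp
  then show ?thesis
    unfolding list_weight_def prod_list_map_filter[symmetric] by (simp only: prod_list_map_mult)
qed

text \<open>A copy of level at least 1 contributes both factors at index 1; these are exchanged by u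
  -> -u, so their product is even. A copy of level -1 contributes the second factor alone. The
  cross-multiplied form keeps the induction free of conditions of nonvanishing.\<close>

lemma list_weight_flip:
  fixes cs :: "('k::field \<times> int) list"
  assumes "\<And>c. c \<in> set cs \<Longrightarrow> snd c = - 1 \<or> 1 \<le> snd c"
  defines "bs \<equiv> filter (\<lambda>c. snd c = - 1) cs"
  shows "fls_flip (list_weight 1 cs) * prod_list (map (\<lambda>c. 1 + 1 / (- fls_X_inv - fls_const (fst c))) bs) =
    list_weight 1 cs * prod_list (map (\<lambda>c. 1 + 1 / (fls_X_inv - fls_const (fst c))) bs)"
  using assms(1) unfolding bs_def
proof (induction cs)
  interpret F: ring_map "fls_flip :: 'k fls \<Rightarrow> 'k fls" by (rule ring_map_fls_flip)
  case Nil
  then show ?case by (simp add: list_weight_def F.one)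
next
  interpret F: ring_map "fls_flip :: 'k fls \<Rightarrow> 'k fls" by (rule ring_map_fls_flip)
  case (Cons c cs)
  let ?p = "\<lambda>c::'k \<times> int. 1 + 1 / (fls_X_inv - fls_const (fst c))"
    and ?q = "\<lambda>c::'k \<times> int. 1 + 1 / (- fls_X_inv - fls_const (fst c))"
  have flip: "fls_flip (?p c) = ?q c" "fls_flip (?q c) = ?p c"
    by (simp_all add: F.add F.one F.diff F.uminus ring_map_divide[OF ring_map_fls_flip] fls_flip_X_inv fls_flip_const)
  have IH: "fls_flip (list_weight 1 cs) * prod_list (map ?q (filter (\<lambda>c. snd c = - 1) cs)) =
      list_weight 1 cs * prod_list (map ?p (filter (\<lambda>c. snd c = - 1) cs))"
    using Cons by simp
  have w: "list_weight 1 (c # cs) = copy_weight 1 c * list_weight 1 cs" by (simp add: list_weight_def)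
  show ?case
  proof (cases "snd c = - 1")
    case True
    then have "copy_weight 1 c = ?q c" by (simp add: copy_weight_def)
    then have "fls_flip (list_weight 1 (c # cs)) * prod_list (map ?q (filter (\<lambda>c. snd c = - 1) (c # cs))) =
        ?p c * ?q c * (fls_flip (list_weight 1 cs) * prod_list (map ?q (filter (\<lambda>c. snd c = - 1) cs)))"
      using True by (simp only: w F.mult flip filter.simps if_True simp_thms list.map prod_list.Cons mult_ac)
    then show ?thesis
      unfolding IH using True \<open>copy_weight 1 c = ?q c\<close>
      by (simp only: w filter.simps if_True simp_thms list.map prod_list.Cons mult_ac)
  next
    case False
    then have "1 \<le> snd c" using Cons.prems[of c] by simp
    then have "copy_weight 1 c = ?p c * ?q c" by (simp add: copy_weight_def)
    then have "fls_flip (copy_weight 1 c) = copy_weight 1 c"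
      by (simp only: F.mult flip mult.commute)
    then show ?thesis
      using False IH by (simp add: w F.mult mult.assoc)
  qed
qed

section \<open>Values of polynomials at series, and their factorizations\<close>

lemma poly_at_pCons: "poly_at (pCons a p) w = fls_const a + w * poly_at p w"
  by (simp add: poly_at_def map_poly_pCons)

lemma poly_at_mult: "poly_at (p * q) w = poly_at p w * poly_at q w"
proof -
  have z: "poly_at 0 w = 0" by (simp add: poly_at_def)
  have add: "poly_at (p + q) w = poly_at p w + poly_at q w" for p q
    by (induction p q rule: poly_induct2) (simp_all add: z poly_at_pCons fls_plus_const[symmetric] algebra_simps)
  have smult: "poly_at (Polynomial.smult c p) w = fls_const c * poly_at p w" for c p
    by (induction p) (simp_all add: z poly_at_pCons algebra_simps)
  show ?thesis
    by (induction p) (simp_all add: z poly_at_pCons add smult algebra_simps)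
qed

lemma poly_at_linear: "poly_at [:a, 1:] w = fls_const a + w"
  by (simp add: poly_at_def map_poly_pCons)

lemma poly_at_prod_list: "poly_at (prod_list ps) w = prod_list (map (\<lambda>p. poly_at p w) ps)"
  by (induction ps) (simp_all add: poly_at_mult, simp add: poly_at_def)

lemma prod_list_map_divide:
  "prod_list (map (\<lambda>c. f c / g c) cs) = prod_list (map f cs) / (prod_list (map g cs) :: 'a::field)"
  by (induction cs) simp_all

lemma monic_factorization:
  fixes P :: "'k::alg_closed_field poly"
  assumes "lead_coeff P = 1"
  shows "\<exists>as. P = prod_list (map (\<lambda>a. [:- a, 1:]) as)"
proof -
  have "P \<noteq> 0" using assms by auto
  then obtain A where "P = (\<Prod>x\<in>#A. [:-x, 1:])"
    using alg_closed_imp_factorization[of P] assms by auto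
  moreover obtain as where "mset as = A" using ex_mset by blast
  ultimately show ?thesis by (metis mset_map prod_mset_prod_list)
qed

text \<open>The question is whether 1 - b is a root of the cofactor Q of u - b. If b and 1 - b
  differ, this is the symmetry of P. If b = 1 - b, the factor u - b changes sign under u -> 1 - u,
  hence so does Q, and 2 Q(b) = 0. In both cases the invariant quadratic (u - b)(u - (1 - b)) splits
  off and the cofactor inherits the symmetry.\<close>

lemma reflection_symmetric_factorization:
  fixes P :: "'k::alg_closed_field poly"
  assumes two: "(2 :: 'k) \<noteq> 0" and "lead_coeff P = 1" and "P = pcompose P [:1, -1:]"
  shows "\<exists>bs. P = prod_list (map (\<lambda>b. [:- b, 1:] * [:b - 1, 1:]) bs)"
  using assms(2,3)
proof (induction "degree P" arbitrary: P rule: less_induct)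
  case less
  show ?case
  proof (cases "degree P = 0")
    case True
    then obtain a where "P = [:a:]" by (rule degree_eq_zeroE)
    then have "P = 1" using less.prems(1) by (simp add: one_pCons)
    then show ?thesis by (intro exI[of _ "[]"]) simp
  next
    case False
    then obtain b where b: "poly P b = 0" using alg_closed_imp_poly_has_root by blast
    then obtain Q where Q: "P = [:- b, 1:] * Q" by (auto simp: poly_eq_0_iff_dvd elim: dvdE)
    have "[:- b, 1:] * Q = pcompose [:- b, 1:] [:1, - 1:] * pcompose Q [:1, - 1:]"
      using less.prems(2) unfolding Q pcompose_mult .
    then have sym: "[:- b, 1:] * Q = [:1 - b, - 1:] * pcompose Q [:1, - 1:]"
      by (simp add: pcompose_pCons)
    have root: "poly Q (1 - b) = 0"
    proof (cases "1 - b = b")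
      case True
      have n: "[:1 - b, - 1:] = - [:- b, 1:]" using True by simp
      then have "[:- b, 1:] * (Q + pcompose Q [:1, - 1:]) = 0"
        by (simp only: distrib_left sym n mult_minus_left left_minus)
      then have "Q + pcompose Q [:1, - 1:] = 0" by (simp only: mult_eq_0_iff) simp
      then have "poly Q b + poly (pcompose Q [:1, - 1:]) b = 0"
        by (metis poly_0 poly_add)
      moreover have "poly [:1, - 1:] b = b" using True by simp
      ultimately have "2 * poly Q b = 0" by (simp only: poly_pcompose mult_2)
      then have "poly Q b = 0" using two by simp
      then show ?thesis by (simp only: True)
    next
      case False
      have "poly ([:- b, 1:] * Q) (1 - b) = poly ([:1 - b, - 1:] * pcompose Q [:1, - 1:]) (1 - b)"
        unfolding sym ..
      moreover have "poly [:- b, 1:] (1 - b) = (1 - b) - b" "poly [:1 - b, - 1:] (1 - b) = 0" by simp_all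
      ultimately have "((1 - b) - b) * poly Q (1 - b) = 0" by (simp only: poly_mult mult_zero_left)
      then show ?thesis using False by (simp only: mult_eq_0_iff right_minus_eq simp_thms)
    qed
    then obtain Q' where Q': "Q = [:- (1 - b), 1:] * Q'" by (auto simp: poly_eq_0_iff_dvd elim: dvdE)
    let ?F = "[:- b, 1:] * [:b - 1, 1:]"
    have P: "P = ?F * Q'" using Q Q' by (simp only: mult.assoc minus_diff_eq)
    have F: "pcompose ?F [:1, - 1:] = ?F"
      by (simp add: pcompose_pCons algebra_simps)
    have "lead_coeff ?F = 1" by (subst lead_coeff_mult) simp
    then have "lead_coeff Q' = 1" using less.prems(1) by (simp only: P lead_coeff_mult mult_1_left)
    moreover have "Q' = pcompose Q' [:1, - 1:]"
    proof -
      have "?F * Q' = ?F * pcompose Q' [:1, - 1:]"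
        using less.prems(2) unfolding P pcompose_mult[of ?F] F .
      then show ?thesis by (simp only: mult_cancel_left) simp
    qed
    moreover have "degree Q' < degree P"
    proof -
      have "Q' \<noteq> 0" using \<open>lead_coeff Q' = 1\<close> by auto
      then have "degree P = degree ?F + degree Q'" unfolding P by (intro degree_mult_eq) simp_all
      moreover have "degree ?F = 2" by (subst degree_mult_eq) simp_all
      ultimately show ?thesis by simp
    qed
    ultimately obtain bs where "Q' = prod_list (map (\<lambda>b. [:- b, 1:] * [:b - 1, 1:]) bs)"
      using less.hyps by blast
    then show ?thesis by (intro exI[of _ "b # bs"]) (simp only: P list.map prod_list.Cons)
  qed
qed

theorem theorem3p23:
  fixes p n :: nat
    and P :: "nat \<Rightarrow> 'k::alg_closed_field poly"
  assumes "CHAR('k) = p" and "p > 2" and "n \<ge> 1"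
    and "\<And>i. i \<in> {1..n} \<Longrightarrow> lead_coeff (P i) = 1"
    and "P 1 = pcompose (P 1) [:1, -1:]"
  shows "\<exists>(\<mu> :: nat \<Rightarrow> 'k fps) (V :: ('k falg set, 'k falg set set set) module).
    (\<forall>i\<in>{1..n}. fps_nth (\<mu> i) 0 = 1) \<and>
    irreducible_highest_weight_rep n \<mu> V \<and>
    finite_dimensional_rep n V \<and>
    (\<forall>i\<in>{1..n-1}. fps_to_fls (\<mu> i) / fps_to_fls (\<mu> (i + 1))
        = poly_at (P (i + 1)) (fls_X_inv + 1) / poly_at (P (i + 1)) fls_X_inv) \<and>
    fps_to_fls (fps_compose (\<mu> 1) (- fps_X)) / fps_to_fls (\<mu> 1)
        = poly_at (P 1) (fls_X_inv + 1) / poly_at (P 1) fls_X_inv"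
proof -
  have two: "(2 :: 'k) \<noteq> 0"
  proof
    assume "(2 :: 'k) = 0"
    then have "CHAR('k) dvd 2" using of_nat_eq_0_iff_char_dvd[of 2, where 'a = 'k] by simp
    then show False using assms(1,2) dvd_imp_le[of p 2] by simp
  qed
  have "\<exists>bs. P 1 = prod_list (map (\<lambda>b. [:- b, 1:] * [:b - 1, 1:]) bs)"
    by (rule reflection_symmetric_factorization[OF two _ assms(5)]) (use assms(3,4) in auto)
  then obtain bs where bs: "P 1 = prod_list (map (\<lambda>b. [:- b, 1:] * [:b - 1, 1:]) bs)" ..
  have "\<exists>as. P i = prod_list (map (\<lambda>a. [:- a, 1:]) as)" if "i \<in> {1..n}" for i
    using monic_factorization assms(4)[OF that] by blast
  then obtain as where as: "\<And>i. i \<in> {1..n} \<Longrightarrow> P i = prod_list (map (\<lambda>a. [:- a, 1:]) (as i))"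
    by metis
  \<comment> \<open>Level i controls mu_i/mu_{i+1} and so receives the roots of P_{i+1}, for i up to
    n - 1. A pair b, 1 - b of roots of P_1 is entered once, through b, at level -1.\<close>
  define cs where "cs = map (\<lambda>b. (b, - 1)) bs @ concat (map (\<lambda>i. map (\<lambda>a. (a, int i)) (as (i + 1))) [1..<n])"
  have snd_cs: "snd c = - 1 \<or> 1 \<le> snd c" if "c \<in> set cs" for c
    using that by (auto simp: cs_def)
  have filter_bs: "filter (\<lambda>c. snd c = - 1) cs = map (\<lambda>b. (b, - 1)) bs"
    by (auto simp: cs_def filter_concat filter_map o_def filter_empty_conv)
  have filter_as: "filter (\<lambda>c. snd c = int i) cs = map (\<lambda>a. (a, int i)) (as (i + 1))" if i: "i \<in> {1..n-1}" for i
  proof -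
    have *: "concat (map (\<lambda>j. if j = i then g j else []) xs) = (if i \<in> set xs then g i else [])"
      if "distinct xs" for g :: "nat \<Rightarrow> ('k \<times> int) list" and xs
      using that by (induction xs) auto
    have "filter (\<lambda>c. snd c = int i) cs =
        concat (map (\<lambda>j. if j = i then map (\<lambda>a. (a, int j)) (as (j + 1)) else []) [1..<n])"
      by (auto simp: cs_def filter_concat filter_map o_def filter_empty_conv intro!: arg_cong[of _ _ concat])
    then show ?thesis using i by (subst (asm) *) auto
  qed
  define \<mu> where "\<mu> = (\<lambda>i. fls_regpart (list_weight (int i) cs))"
  obtain V where V: "irreducible_highest_weight_rep n \<mu> V" "finite_dimensional_rep n V"
    using exists_rep_with_list_weight[OF two] unfolding \<mu>_def by blast
  \<comment> \<open>A weight has no terms of positive degree in u, so passing to the regular part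
    loses nothing.\<close>
  have \<mu>: "fps_to_fls (\<mu> i) = list_weight (int i) cs" for i
    using starts_with_list_weight[of "int i" cs]
    by (intro fls_eqI) (auto simp: \<mu>_def starts_with_def)
  have nz: "list_weight i cs \<noteq> 0" for i
    using starts_with_list_weight[of i cs] by (auto simp: starts_with_def)
  have X: "fls_X_inv - fls_const c \<noteq> 0" "fls_X_inv + fls_const c \<noteq> 0" for c :: 'k
    by (rule linear_fls_nonzero)+
  have c1: "fls_const (c - 1) = fls_const c - 1" for c :: 'k
    by (rule fls_eqI) simp
  have p: "1 + 1 / (fls_X_inv - fls_const b) = (fls_X_inv + 1 - fls_const b) / (fls_X_inv - fls_const b)" for b :: 'k
  proof -
    have "1 + 1 / w = (w + 1) / w" if "w \<noteq> 0" for w :: "'k fls"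
      using that by (simp add: add_divide_distrib)
    from this[OF X(1)] show ?thesis by (simp only: diff_add_eq)
  qed
  have lin: "poly_at [:- b, 1:] w = w - fls_const b" "poly_at [:b - 1, 1:] w = w + fls_const (b - 1)"
    for b :: 'k and w
    by (simp_all add: poly_at_linear)
  have ratio: "fps_to_fls (\<mu> i) / fps_to_fls (\<mu> (i + 1))
        = poly_at (P (i + 1)) (fls_X_inv + 1) / poly_at (P (i + 1)) fls_X_inv" if i: "i \<in> {1..n-1}" for i
  proof -
    have "list_weight (int i) cs = list_weight (int (i + 1)) cs *
        prod_list (map (\<lambda>a. 1 + 1 / (fls_X_inv - fls_const a)) (as (i + 1)))"
          proof -
      have "- 1 \<le> snd c" if "c \<in> set cs" for c using snd_cs[OF that] by auto
      moreover have "1 \<le> i" using i by simp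
      ultimately show ?thesis using list_weight_Suc[of cs i] by (simp add: filter_as[OF i] o_def)
    qed
    then have "fps_to_fls (\<mu> i) / fps_to_fls (\<mu> (i + 1)) =
        prod_list (map (\<lambda>a. 1 + 1 / (fls_X_inv - fls_const a)) (as (i + 1)))"
      using nz by (simp add: \<mu>)
    also have "\<dots> = prod_list (map (\<lambda>a. poly_at [:- a, 1:] (fls_X_inv + 1) / poly_at [:- a, 1:] fls_X_inv) (as (i + 1)))"
      by (simp only: p lin)
    also have "\<dots> = poly_at (P (i + 1)) (fls_X_inv + 1) / poly_at (P (i + 1)) fls_X_inv"
    proof -
      have "P (i + 1) = prod_list (map (\<lambda>a. [:- a, 1:]) (as (i + 1)))"
        by (rule as) (use i in auto)
      then show ?thesis by (simp only: poly_at_prod_list prod_list_map_divide map_map o_def)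
    qed
    finally show ?thesis .
  qed
  have "fps_to_fls (fps_compose (\<mu> 1) (- fps_X)) / fps_to_fls (\<mu> 1)
        = poly_at (P 1) (fls_X_inv + 1) / poly_at (P 1) fls_X_inv"
  proof -
    let ?p = "\<lambda>b::'k. 1 + 1 / (fls_X_inv - fls_const b)" and ?q = "\<lambda>b::'k. 1 + 1 / (- fls_X_inv - fls_const b)"
    \<comment> \<open>Numerator and denominator are the values at u and at u + 1 of u - (1 - b), the
      partner of u - b, so dividing by this quotient supplies the missing half of the pair.\<close>
    have q: "?q b = (fls_X_inv + fls_const (b - 1)) / (fls_X_inv + fls_const b)" for b
    proof -
      have n: "- fls_X_inv - fls_const b = - (fls_X_inv + fls_const b)" by simp
      have "1 + 1 / (- w) = (w - 1) / w" if "w \<noteq> 0" for w :: "'k fls"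
        using that by (simp add: diff_divide_distrib)
      from this[OF X(2)] show ?thesis unfolding n c1 by (simp only: add_diff_eq)
    qed
    have q0: "?q b \<noteq> 0" for b unfolding q using X by simp
    have "fls_flip (list_weight 1 cs) * prod_list (map ?q bs) = list_weight 1 cs * prod_list (map ?p bs)"
    proof -
      note list_weight_flip[of cs, unfolded filter_bs map_map o_def fst_conv]
      then show ?thesis using snd_cs by blast
    qed
    moreover have "prod_list (map ?q bs) \<noteq> 0" using q0 by (induction bs) (simp_all only: list.map prod_list.Nil prod_list.Cons mult_eq_0_iff one_neq_zero simp_thms)
    moreover have cross: "x / y = w / z" if "x * z = y * w" "z \<noteq> 0" "y \<noteq> 0" for x y z w :: "'k fls"
      using that by (simp add: frac_eq_eq mult.commute)
    ultimately have "fls_flip (list_weight 1 cs) / list_weight 1 cs = prod_list (map ?p bs) / prod_list (map ?q bs)"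
      by (intro cross nz)
    also have "\<dots> = prod_list (map (\<lambda>b. ?p b / ?q b) bs)"
      by (rule prod_list_map_divide[symmetric])
    also have "\<dots> = prod_list (map (\<lambda>b. poly_at ([:- b, 1:] * [:b - 1, 1:]) (fls_X_inv + 1) /
        poly_at ([:- b, 1:] * [:b - 1, 1:]) fls_X_inv) bs)"
    proof (intro arg_cong[of _ _ prod_list] map_cong refl)
      fix b
      have "?p b / ?q b = ((fls_X_inv + 1 - fls_const b) * (fls_X_inv + fls_const b)) /
          ((fls_X_inv - fls_const b) * (fls_X_inv + fls_const (b - 1)))"
        unfolding p q by (rule divide_divide_times_eq)
      moreover have "fls_X_inv + 1 + fls_const (b - 1) = fls_X_inv + fls_const b"
        by (simp add: c1)
      ultimately show "?p b / ?q b = poly_at ([:- b, 1:] * [:b - 1, 1:]) (fls_X_inv + 1) /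
          poly_at ([:- b, 1:] * [:b - 1, 1:]) fls_X_inv"
        by (simp only: poly_at_mult lin)
    qed
    also have "\<dots> = poly_at (P 1) (fls_X_inv + 1) / poly_at (P 1) fls_X_inv"
      by (simp only: bs poly_at_prod_list prod_list_map_divide map_map o_def)
    finally show ?thesis by (simp only: fps_to_fls_compose_uminus_X \<mu> of_nat_1)
  qed
  moreover have "\<forall>i\<in>{1..n}. fps_nth (\<mu> i) 0 = 1"
    using starts_with_list_weight by (auto simp: \<mu>_def starts_with_def)
  ultimately show ?thesis using V ratio by blast
qed


end
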